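(* Let $X$ be a proper geodesic metric space with a convergence boundary $\partial X$ and let $\Gamma<\mathrm{Isom}(X)$ be a non-elementary discrete subgroup. Assume that the proper action $\Gamma\curvearrowright X$ is of divergence type with a (non-pinched) contracting element. If a discrete group $H<\mathrm{Isom}(X)$ is confined by $\Gamma$ with a finite confining subset that intersects $E(\Gamma)$ trivially, then $$\omega_H+\frac{\omega_{\Gamma/H}}{2}\ge\omega_\Gamma.$$
   Context: Fix $o\in X$. Contracting: a closed $Z\subseteq X$ is $C$-contracting if $\mathrm{diam}(\pi_Z(x)\cup\pi_Z(y))\le C$ whenever $d(x,y)\le d(x,Z)$, where $\pi_Z$ is the nearest-point projection (set). An isometry $g$ is contracting if $n\mapsto g^no$ is a quasi-isometric embedding of $\mathbb Z$ with contracting image. A group is elementary if finite or virtually $\mathbb Z$. $\omega_H=\limsup_n\frac1n\log\sharp\{ho:h\in H,d(o,ho)\le n\}$. Divergence type: $\sum_{g\in\Gamma}e^{-\omega_\Gamma d(o,go)}=\infty$. On $X/H=\{Hx\}$ put $\bar d(Hx,Hy)=\inf_{h\in H}d(x,hy)$, and $\omega_{\Gamma/H}=\limsup_n\frac1n\log\sharp\{Hgo:g\in\Gamma,\bar d(Ho,Hgo)\le n\}$. ($H$ need not be contained in $\Gamma$.) Confined with finite confining subset $P$: $P\subseteq\mathrm{Isom}(X)$ is finite and $g^{-1}Hg\cap(P\setminus\{1\})\ne\emptyset$ for all $g\in\Gamma$. "Intersects $E(\Gamma)$ trivially" means $P\cap E(\Gamma)\subseteq\{1\}$. Convergence boundary: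 a metrizable compactification $\overline X=X\cup\partial X$ with $X$ open and dense, to which the action of $\mathrm{Isom}(X)$ extends by homeomorphisms, with an $\mathrm{Isom}(X)$-invariant partition $[\cdot]$ of $\partial X$ ($[\xi]$ is the class of $\xi$; $[A]=\bigcup_{\xi\in A}[\xi]$). A sequence tends (accumulates) to $[\xi]$ if its limit (all its accumulation points) lie in $[\xi]$; subsets or points $A_n$ are escaping if $d(o,A_n)\to\infty$. Required: (A) any contracting geodesic ray $\gamma$ accumulates into a closed class $[\xi]$, and any $y_n\in X$ with $\pi_\gamma(y_n)$ escaping tends to $[\xi]$. (B) for any escaping sequence of $C$-contracting quasi-geodesics $X_n$ ($C$ fixed), and any $o$, some subsequence of the cones $\Omega_o(X_n)=\{y\in X:\text{some geodesic }[o,y]\text{ meets }X_n\}$ accumulates to a class $[\xi]$, i.e. any convergent sequence $y_n\in\Omega_o(X_n)$ tends to a point of $[\xi]$. (C) the set $\mathcal C$ of non-pinched points is nonempty, where $\xi$ is non-pinched if for all sequences $x_n,y_n\in X$ converging to $[\xi]$ the segments $[x_n,y_n]$ are escaping; and for $\xi\in\mathcal C$, $[\cdot]$ is closed on $U=\Gamma[\xi]$: if $x_n,y_n\in U$, $[x_n]=[y_n]$, $x_n\to\xi'$, $y_n\to\eta'$, then $[\xi']=[\eta']$. By (A) the rays $n\mapsto f^{\pm n}o$, $n\geq 0$, of a contracting element $f$ determine classes $[f^+],[f^-]$; $f$ is non-pinched if $[f^+]\cup[f^-]\subseteq\mathcal C$. $E(\Gamma)=\{g\in\mathrm{Isom}(X):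 g[\xi]=[\xi]\text{ for every class }[\xi]\subseteq[\Lambda(\Gamma o)]\}$, where $\Lambda(\Gamma o)$ is the set of accumulation points of $\Gamma o$ in $\partial X$. *)

theory Defs
  imports "HOL-Analysis.Analysis" "HOL-Algebra.Algebra"
begin

section \<open>Geodesics, quasi-geodesics and contracting subsets\<close>

text \<open>The space is the whole type \<open>'a\<close> of class \<^class>\<open>metric_space\<close>.\<close>

definition proper_space :: "'a::metric_space itself \<Rightarrow> bool" where
  "proper_space _ \<longleftrightarrow> (\<forall>(x::'a) r. compact (cball x r))"

definition geodesic_segment :: "'a::metric_space \<Rightarrow> 'a \<Rightarrow> 'a set \<Rightarrow> bool" where
  "geodesic_segment x y S \<longleftrightarrow>
     (\<exists>\<gamma>. (\<forall>s\<in>{0..dist x y}. \<forall>t\<in>{0..dist x y}. dist (\<gamma> s) (\<gamma> t) = \<bar>s - t\<bar>) \<and>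
          \<gamma> 0 = x \<and> \<gamma> (dist x y) = y \<and> S = \<gamma> ` {0..dist x y})"

definition geodesic_space :: "'a::metric_space itself \<Rightarrow> bool" where
  "geodesic_space _ \<longleftrightarrow> (\<forall>x y::'a. \<exists>S. geodesic_segment x y S)"

definition geodesic_ray :: "(real \<Rightarrow> 'a::metric_space) \<Rightarrow> bool" where
  "geodesic_ray \<gamma> \<longleftrightarrow> (\<forall>s\<ge>0. \<forall>t\<ge>0. dist (\<gamma> s) (\<gamma> t) = \<bar>s - t\<bar>)"

definition quasi_isometric_embedding_on :: "real set \<Rightarrow> (real \<Rightarrow> 'a::metric_space) \<Rightarrow> bool" where
  "quasi_isometric_embedding_on S q \<longleftrightarrow>
     (\<exists>k\<ge>1. \<exists>c\<ge>0. \<forall>s\<in>S. \<forall>t\<in>S.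
        \<bar>s - t\<bar> / k - c \<le> dist (q s) (q t) \<and> dist (q s) (q t) \<le> k * \<bar>s - t\<bar> + c)"

definition quasi_geodesic :: "'a::metric_space set \<Rightarrow> bool" where
  "quasi_geodesic Z \<longleftrightarrow>
     (\<exists>I q. is_interval I \<and> I \<noteq> {} \<and> quasi_isometric_embedding_on I q \<and> Z = q ` I)"

definition nearest_point_proj :: "'a::metric_space set \<Rightarrow> 'a \<Rightarrow> 'a set" where
  "nearest_point_proj Z x = {z \<in> Z. dist x z = infdist x Z}"

definition contracting :: "real \<Rightarrow> 'a::metric_space set \<Rightarrow> bool" where
  "contracting C Z \<longleftrightarrow> closed Z \<and>
     (\<forall>x y. dist x y \<le> infdist x Z \<longrightarrow>
        diameter (nearest_point_proj Z x \<union> nearest_point_proj Z y) \<le> C)"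

text \<open>Whether a sequence of subsets is escaping does not depend on the base point, so no base
  point is fixed here. As \<^term>\<open>infdist x {} = 0\<close>, the sets of an escaping sequence are
  nonempty from some index on.\<close>

definition escaping :: "(nat \<Rightarrow> 'a::metric_space set) \<Rightarrow> bool" where
  "escaping A \<longleftrightarrow> (\<forall>x. filterlim (\<lambda>n. infdist x (A n)) at_top sequentially)"

definition cone :: "'a::metric_space \<Rightarrow> 'a set \<Rightarrow> 'a set" where
  "cone x Z = {y. \<exists>S. geodesic_segment x y S \<and> S \<inter> Z \<noteq> {}}"


section \<open>The isometry group\<close>

definition isometry_group :: "('a::metric_space \<Rightarrow> 'a) monoid" where
  "isometry_group =
     \<lparr>carrier = {g. surj g \<and> (\<forall>x y. dist (g x) (g y) = dist x y)}, mult = (\<circ>), one = id\<rparr>"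

lemma group_isometry_group: "group (isometry_group :: ('a::metric_space \<Rightarrow> 'a) monoid)"
proof (rule groupI)
  fix g :: "'a \<Rightarrow> 'a"
  assume g: "g \<in> carrier isometry_group"
  then have inj: "inj g"
    by (auto simp: isometry_group_def inj_def) (metis dist_eq_0_iff)
  with g have "bij g"
    by (auto simp: isometry_group_def bij_def)
  moreover have "dist (inv_into UNIV g x) (inv_into UNIV g y) = dist x y" for x y
    using g by (auto simp: isometry_group_def) (metis surj_f_inv_f)
  ultimately have "inv_into UNIV g \<in> carrier isometry_group"
    by (auto simp: isometry_group_def bij_imp_bij_inv bij_is_surj)
  moreover have "inv_into UNIV g \<circ> g = id"
    using inj by simp
  ultimately show "\<exists>h\<in>carrier isometry_group. h \<otimes>\<^bsub>isometry_group\<^esub> g = \<one>\<^bsub>isometry_group\<^esub>"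
    by (intro bexI[of _ "inv_into UNIV g"]) (simp_all add: isometry_group_def)
qed (auto simp: isometry_group_def, metis rangeI surjD)

definition compact_open_topology :: "('a::topological_space \<Rightarrow> 'b::topological_space) topology" where
  "compact_open_topology =
     topology_generated_by {{f. f ` K \<subseteq> U} | K U. compact K \<and> open U}"

definition discrete_subgroup :: "('a::metric_space \<Rightarrow> 'a) set \<Rightarrow> bool" where
  "discrete_subgroup H \<longleftrightarrow> subgroup H isometry_group \<and>
     subtopology compact_open_topology H = discrete_topology H"

definition elementary_group :: "('g, 'm) monoid_scheme \<Rightarrow> bool" where
  "elementary_group G \<longleftrightarrow> finite (carrier G) \<or>
     (\<exists>K. subgroup K G \<and> finite (rcosets\<^bsub>G\<^esub> K) \<and> G\<lparr>carrier := K\<rparr> \<cong> integer_group)"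

definition contracting_isometry :: "'a::metric_space \<Rightarrow> ('a \<Rightarrow> 'a) \<Rightarrow> bool" where
  "contracting_isometry x\<^sub>0 g \<longleftrightarrow> g \<in> carrier isometry_group \<and>
     quasi_isometric_embedding_on \<int> (\<lambda>t. (g [^]\<^bsub>isometry_group\<^esub> \<lfloor>t\<rfloor>) x\<^sub>0) \<and>
     (\<exists>C. contracting C (range (\<lambda>n::int. (g [^]\<^bsub>isometry_group\<^esub> n) x\<^sub>0)))"

definition confined :: "('a::metric_space \<Rightarrow> 'a) set \<Rightarrow> ('a \<Rightarrow> 'a) set \<Rightarrow> ('a \<Rightarrow> 'a) set \<Rightarrow> bool" where
  "confined \<Gamma> H P \<longleftrightarrow> P \<subseteq> carrier isometry_group \<and> finite P \<and>
     (\<forall>g\<in>\<Gamma>. {inv\<^bsub>isometry_group\<^esub> g \<otimes>\<^bsub>isometry_group\<^esub> h \<otimes>\<^bsub>isometry_group\<^esub> g | h. h \<in> H}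
            \<inter> (P - {\<one>\<^bsub>isometry_group\<^esub>}) \<noteq> {})"


section \<open>Growth rates\<close>

definition orbit_of :: "('a \<Rightarrow> 'a) set \<Rightarrow> 'a \<Rightarrow> 'a set" where
  "orbit_of H x = (\<lambda>h. h x) ` H"

text \<open>The case distinction is needed because \<^const>\<open>card\<close> is 0 on infinite sets: for
  discrete \<open>H\<close> and \<open>\<Gamma>\<close> with \<open>H\<close> not contained in \<open>\<Gamma>\<close>, a ball of the quotient
  by \<open>H\<close> may contain infinitely many points of the image of an orbit of \<open>\<Gamma>\<close>.\<close>

definition log_card :: "'c set \<Rightarrow> ereal" where
  "log_card A = (if finite A then ereal (ln (real (card A))) else \<infinity>)"

definition exponential_growth :: "(nat \<Rightarrow> 'c set) \<Rightarrow> ereal" where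
  "exponential_growth A = limsup (\<lambda>n. ereal (1 / real n) * log_card (A n))"

definition growth_rate :: "('a::metric_space \<Rightarrow> 'a) set \<Rightarrow> 'a \<Rightarrow> ereal" where
  "growth_rate H x\<^sub>0 =
     exponential_growth (\<lambda>n. {h x\<^sub>0 | h. h \<in> H \<and> dist x\<^sub>0 (h x\<^sub>0) \<le> real n})"

definition quotient_dist :: "('a::metric_space \<Rightarrow> 'a) set \<Rightarrow> 'a \<Rightarrow> 'a \<Rightarrow> real" where
  "quotient_dist H x y = (INF h\<in>H. dist x (h y))"

definition quotient_growth_rate ::
    "('a::metric_space \<Rightarrow> 'a) set \<Rightarrow> ('a \<Rightarrow> 'a) set \<Rightarrow> 'a \<Rightarrow> ereal" where
  "quotient_growth_rate \<Gamma> H x\<^sub>0 =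
     exponential_growth
       (\<lambda>n. {orbit_of H (g x\<^sub>0) | g. g \<in> \<Gamma> \<and> quotient_dist H x\<^sub>0 (g x\<^sub>0) \<le> real n})"

text \<open>If the growth rate \<open>\<omega>\<close> is infinite, then the terms \<open>exp (- \<omega> d)\<close> with
  \<open>d > 0\<close> vanish and the Poincare series is a finite sum over a stabilizer, so an action of
  divergence type has finite growth rate.\<close>

definition divergence_type :: "('a::metric_space \<Rightarrow> 'a) set \<Rightarrow> 'a \<Rightarrow> bool" where
  "divergence_type \<Gamma> x\<^sub>0 \<longleftrightarrow> growth_rate \<Gamma> x\<^sub>0 \<noteq> \<infinity> \<and>
     (\<Sum>\<^sub>\<infinity>g\<in>\<Gamma>. ennreal (exp (- real_of_ereal (growth_rate \<Gamma> x\<^sub>0) * dist x\<^sub>0 (g x\<^sub>0)))) = \<infinity>"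


section \<open>Convergence boundaries\<close>

text \<open>A metrizable compactification is an open dense embedding \<open>\<iota> :: 'a \<Rightarrow> 'b\<close> into a compact
  type \<open>'b\<close> of class \<^class>\<open>metric_space\<close>; only the topology of \<open>'b\<close> is used.
  The partition of the boundary is given by an equivalence relation \<open>R\<close>, so that
  \<open>R `` {\<xi>}\<close> is the class of \<open>\<xi>\<close> and \<open>R `` A\<close> is the union of the classes of the
  elements of \<open>A\<close>.\<close>

definition boundary :: "('a \<Rightarrow> 'b) \<Rightarrow> 'b set" where
  "boundary \<iota> = - range \<iota>"

definition accumulation_points :: "(nat \<Rightarrow> 'b::topological_space) \<Rightarrow> 'b set" where
  "accumulation_points s = {l. \<exists>r. strict_mono r \<and> (s \<circ> r) \<longlonglongrightarrow> l}"

definition non_pinched_points :: "('a::metric_space \<Rightarrow> 'b::metric_space) \<Rightarrow> ('b \<times> 'b) set \<Rightarrow> 'b set" where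
  "non_pinched_points \<iota> R =
     {\<xi> \<in> boundary \<iota>. \<forall>x y S.
        (\<exists>l\<in>R `` {\<xi>}. (\<lambda>n. \<iota> (x n)) \<longlonglongrightarrow> l) \<and> (\<exists>l\<in>R `` {\<xi>}. (\<lambda>n. \<iota> (y n)) \<longlonglongrightarrow> l) \<and>
        (\<forall>n. geodesic_segment (x n) (y n) (S n)) \<longrightarrow> escaping S}"

text \<open>The extension \<open>act g\<close> of an isometry \<open>g\<close> is unique, since \<open>\<iota>\<close> has dense image, and
  for the same reason \<open>act\<close> is automatically compatible with composition.

  In the first axiom, a sequence that is not assumed convergent tends to a class if all its
  accumulation points lie in that class. In the second axiom, the cones accumulate to a class if
  all accumulation points of sequences of points in the cones do. As the cones of nonempty sets are
  nonempty and as both axioms quantify over arbitrary sequences, this agrees (by compactness)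
  with only testing convergent sequences.\<close>

locale convergence_boundary =
  fixes \<iota> :: "'a::metric_space \<Rightarrow> 'b::metric_space"
    and act :: "('a \<Rightarrow> 'a) \<Rightarrow> 'b \<Rightarrow> 'b"
    and R :: "('b \<times> 'b) set"
    and \<Gamma> :: "('a \<Rightarrow> 'a) set"
  assumes compact_compactification: "compact (UNIV :: 'b set)"
    and embedding: "\<exists>\<kappa>. homeomorphism UNIV (range \<iota>) \<iota> \<kappa>"
    and open_image: "open (range \<iota>)"
    and dense_image: "closure (range \<iota>) = UNIV"
    and act_homeomorphism:
      "g \<in> carrier isometry_group \<Longrightarrow> \<exists>k. homeomorphism UNIV UNIV (act g) k"
    and act_extends: "g \<in> carrier isometry_group \<Longrightarrow> act g (\<iota> x) = \<iota> (g x)"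
    and partition: "equiv (boundary \<iota>) R"
    and partition_invariant:
      "\<lbrakk>g \<in> carrier isometry_group; (\<xi>, \<eta>) \<in> R\<rbrakk> \<Longrightarrow> (act g \<xi>, act g \<eta>) \<in> R"
    and contracting_ray:
      "\<lbrakk>geodesic_ray \<gamma>; contracting C (\<gamma> ` {0..})\<rbrakk> \<Longrightarrow>
         \<exists>\<xi>\<in>boundary \<iota>. closed (R `` {\<xi>}) \<and>
           (\<forall>t. filterlim t at_top sequentially \<longrightarrow>
              accumulation_points (\<lambda>n. \<iota> (\<gamma> (t n))) \<subseteq> R `` {\<xi>}) \<and>
           (\<forall>y. escaping (\<lambda>n. nearest_point_proj (\<gamma> ` {0..}) (y n)) \<longrightarrow>
              accumulation_points (\<lambda>n. \<iota> (y n)) \<subseteq> R `` {\<xi>})"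
    and escaping_cones:
      "\<lbrakk>\<And>n. quasi_geodesic (Z n) \<and> contracting C (Z n); escaping Z\<rbrakk> \<Longrightarrow>
         \<exists>r. strict_mono r \<and> (\<exists>\<xi>\<in>boundary \<iota>.
           \<forall>y. (\<forall>n. y n \<in> cone x (Z (r n))) \<longrightarrow>
             accumulation_points (\<lambda>n. \<iota> (y n)) \<subseteq> R `` {\<xi>})"
    and non_pinched_nonempty: "non_pinched_points \<iota> R \<noteq> {}"
    and non_pinched_closed:
      "\<lbrakk>\<xi> \<in> non_pinched_points \<iota> R;
        \<And>n. u n \<in> (\<Union>g\<in>\<Gamma>. act g ` (R `` {\<xi>})); \<And>n. v n \<in> (\<Union>g\<in>\<Gamma>. act g ` (R `` {\<xi>}));
        \<And>n. R `` {u n} = R `` {v n}; u \<longlonglongrightarrow> \<xi>'; v \<longlonglongrightarrow> \<eta>'\<rbrakk> \<Longrightarrow>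
         R `` {\<xi>'} = R `` {\<eta>'}"

text \<open>The union of the classes of the accumulation points of \<open>n \<mapsto> f\<^sup>n x\<^sub>0\<close>, which is a single
  class for a contracting isometry \<open>f\<close> of a proper geodesic space.\<close>

definition attracting_class ::
    "('a::metric_space \<Rightarrow> 'b::metric_space) \<Rightarrow> ('b \<times> 'b) set \<Rightarrow> 'a \<Rightarrow> ('a \<Rightarrow> 'a) \<Rightarrow> 'b set" where
  "attracting_class \<iota> R x\<^sub>0 f =
     R `` accumulation_points (\<lambda>n. \<iota> ((f [^]\<^bsub>isometry_group\<^esub> n) x\<^sub>0))"

definition non_pinched_isometry ::
    "('a::metric_space \<Rightarrow> 'b::metric_space) \<Rightarrow> ('b \<times> 'b) set \<Rightarrow> 'a \<Rightarrow> ('a \<Rightarrow> 'a) \<Rightarrow> bool" where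
  "non_pinched_isometry \<iota> R x\<^sub>0 f \<longleftrightarrow>
     attracting_class \<iota> R x\<^sub>0 f \<union> attracting_class \<iota> R x\<^sub>0 (inv\<^bsub>isometry_group\<^esub> f)
       \<subseteq> non_pinched_points \<iota> R"

definition limit_set ::
    "('a::metric_space \<Rightarrow> 'b::metric_space) \<Rightarrow> ('a \<Rightarrow> 'a) set \<Rightarrow> 'a \<Rightarrow> 'b set" where
  "limit_set \<iota> \<Gamma> x\<^sub>0 = {\<xi> \<in> boundary \<iota>. \<xi> islimpt \<iota> ` orbit_of \<Gamma> x\<^sub>0}"

definition elliptic_radical ::
    "('a::metric_space \<Rightarrow> 'b::metric_space) \<Rightarrow> (('a \<Rightarrow> 'a) \<Rightarrow> 'b \<Rightarrow> 'b) \<Rightarrow> ('b \<times> 'b) set \<Rightarrow>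
     ('a \<Rightarrow> 'a) set \<Rightarrow> 'a \<Rightarrow> ('a \<Rightarrow> 'a) set" where
  "elliptic_radical \<iota> act R \<Gamma> x\<^sub>0 =
     {g \<in> carrier isometry_group.
        \<forall>\<xi>\<in>boundary \<iota>. R `` {\<xi>} \<subseteq> R `` limit_set \<iota> \<Gamma> x\<^sub>0 \<longrightarrow> act g ` (R `` {\<xi>}) = R `` {\<xi>}}"

end

theory Submission
  imports Defs "HOL-Real_Asymp.Real_Asymp"
begin

text \<open>
  Write \<open>o\<close> for the base point. By the Cauchy--Schwarz inequality, the square of the number of
  orbit points \<open>x o\<close>, \<open>x \<in> \<Gamma>\<close>, in the ball of radius \<open>n\<close> is at most the number of their
  \<open>H\<close>-orbits times the number of pairs \<open>(x o, y o)\<close> of such points with \<open>x o = h y o\<close> for some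
  \<open>h \<in> H\<close>. To such a pair we associate \<open>x q x\<inverse> h \<in> H\<close>, where \<open>q = k p k\<inverse>\<close> is taken
  from a finite set, \<open>p\<close> being a confining element at \<open>x k\<close>, in such a way that every geodesic
  from \<open>o\<close> to \<open>x q x\<inverse> h o\<close> passes near \<open>x o\<close>. This element moves \<open>o\<close> by at most \<open>2 n\<close> plus a
  constant, and it determines the pair up to a number of choices that is linear in \<open>n\<close>.
  Hence \<open>2 \<omega>\<^sub>\<Gamma> \<le> \<omega>\<^sub>\<Gamma>\<^sub>/\<^sub>H + 2 \<omega>\<^sub>H\<close>.

  To find \<open>k\<close>, use translates of the axis of a contracting element of \<open>\<Gamma>\<close> and their shadows,
  the sets of points that project to the positive half of the axis. There is a shadow \<open>V\<close> such
  that each \<open>p \<in> P\<close>, \<open>p \<noteq> 1\<close>, either moves \<open>V\<close> off itself or displaces the orbit points in \<open>V\<close> by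
  a bounded amount, and finitely many \<open>k\<close> suffice to move any two points into \<open>V\<close> by \<open>k\<inverse>\<close>. If
  \<open>k\<inverse> x\<inverse> o\<close> and \<open>k\<inverse> x\<inverse> h o\<close> are in \<open>V\<close> and \<open>p\<close> moves \<open>V\<close> off itself, then \<open>k\<close> is as required.
  If on the other hand \<open>p\<close> displaces the points of \<open>V\<close> boundedly, then
  \<open>x k p k\<inverse> x\<inverse>\<close> is one of finitely many elements of the discrete group \<open>H\<close>, so that having this
  for many \<open>k\<close> yields elements of \<open>\<Gamma>\<close> in the centralizer of a conjugate of \<open>p\<close>. This can be
  avoided by B. H. Neumann's lemma: the centralizer has infinite index in \<open>\<Gamma>\<close>, because
  otherwise \<open>p\<close> would displace the whole orbit \<open>\<Gamma> o\<close> by a bounded amount, and the convergence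
  axiom for cones, applied to the pairs \<open>{y, p y}\<close>, would show that \<open>p\<close> is in the elliptic radical.
\<close>

section \<open>Isometries and geodesics\<close>

lemma isometry_groupD:
  assumes "g \<in> carrier isometry_group"
  shows "dist (g x) (g y) = dist x y" "bij g"
  using assms by (auto simp: isometry_group_def bij_def inj_def) (metis dist_eq_0_iff)

lemma isometry_group_simps:
  "mult isometry_group = (\<circ>)" "one isometry_group = id"
  by (simp_all add: isometry_group_def)

lemma isometry_inverse:
  assumes "g \<in> carrier isometry_group"
  shows "g (inv_into UNIV g x) = x" "inv_into UNIV g (g x) = x"
  using isometry_groupD(2)[OF assms] by (simp_all add: bij_is_surj bij_is_inj surj_f_inv_f)

lemma m_inv_isometry_group:
  assumes "g \<in> carrier isometry_group"
  shows "m_inv isometry_group g = inv_into UNIV g"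
proof -
  interpret group isometry_group by (rule group_isometry_group)
  have "g \<circ> m_inv isometry_group g = id"
    using r_inv[OF assms] by (simp add: isometry_group_simps)
  then have "g (m_inv isometry_group g x) = x" for x
    by (metis comp_apply id_apply)
  then show ?thesis
    using isometry_inverse[OF assms] by (metis ext)
qed

locale isometry_subgroup =
  fixes \<Gamma> :: "('a::metric_space \<Rightarrow> 'a) set"
  assumes is_subgroup: "subgroup \<Gamma> isometry_group"
begin

lemma isometry: "g \<in> \<Gamma> \<Longrightarrow> g \<in> carrier isometry_group"
  using subgroup.subset[OF is_subgroup] by blast

lemma comp_mem: "g \<in> \<Gamma> \<Longrightarrow> h \<in> \<Gamma> \<Longrightarrow> g \<circ> h \<in> \<Gamma>"
  using subgroup.m_closed[OF is_subgroup] by (simp add: isometry_group_simps)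

lemma id_mem: "id \<in> \<Gamma>"
  using subgroup.one_closed[OF is_subgroup] by (simp add: isometry_group_simps)

lemma inv_mem: "g \<in> \<Gamma> \<Longrightarrow> inv_into UNIV g \<in> \<Gamma>"
  using subgroup.m_inv_closed[OF is_subgroup] m_inv_isometry_group isometry by metis

end

interpretation isometries: isometry_subgroup "carrier isometry_group"
  by (rule isometry_subgroup.intro) (rule group.subgroup_self[OF group_isometry_group])

lemma dist_inverse_isometry:
  assumes "g \<in> carrier isometry_group"
  shows "dist (inv_into UNIV g x) y = dist x (g y)" "dist x (inv_into UNIV g y) = dist (g x) y"
  using isometry_groupD(1)[OF assms] isometry_inverse(1)[OF assms] by metis+

lemma geodesic_segmentE:
  assumes "geodesic_segment x y S"
  obtains \<gamma> where "\<And>s t. s \<in> {0..dist x y} \<Longrightarrow> t \<in> {0..dist x y} \<Longrightarrow> dist (\<gamma> s) (\<gamma> t) = \<bar>s - t\<bar>"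
    "\<gamma> 0 = x" "\<gamma> (dist x y) = y" "S = \<gamma> ` {0..dist x y}"
  using assms that unfolding geodesic_segment_def by metis

lemma geodesic_segment_sym:
  assumes "geodesic_segment x y S"
  shows "geodesic_segment y x S"
proof -
  obtain \<gamma> where \<gamma>: "\<And>s t. s \<in> {0..dist x y} \<Longrightarrow> t \<in> {0..dist x y} \<Longrightarrow> dist (\<gamma> s) (\<gamma> t) = \<bar>s - t\<bar>"
    "\<gamma> 0 = x" "\<gamma> (dist x y) = y" "S = \<gamma> ` {0..dist x y}"
    by (rule geodesic_segmentE[OF assms], rule that)
  have "(\<lambda>t. dist x y - t) ` {0..dist x y} = {0..dist x y}"
    by (simp add: image_diff_atLeastAtMost)
  moreover have "(\<lambda>t. \<gamma> (dist x y - t)) ` {0..dist x y} = \<gamma> ` (\<lambda>t. dist x y - t) ` {0..dist x y}"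
    by (simp only: image_image)
  ultimately have "S = (\<lambda>t. \<gamma> (dist x y - t)) ` {0..dist y x}"
    by (simp only: \<gamma>(4) dist_commute[of y x])
  then show ?thesis
    unfolding geodesic_segment_def
    by (intro exI[of _ "\<lambda>t. \<gamma> (dist x y - t)"]) (auto simp: \<gamma> dist_commute)
qed

lemma geodesic_segment_dist_sum:
  assumes "geodesic_segment x y S" "z \<in> S"
  shows "dist x y = dist x z + dist z y"
proof -
  obtain \<gamma> where \<gamma>: "\<And>s t. s \<in> {0..dist x y} \<Longrightarrow> t \<in> {0..dist x y} \<Longrightarrow> dist (\<gamma> s) (\<gamma> t) = \<bar>s - t\<bar>"
    "\<gamma> 0 = x" "\<gamma> (dist x y) = y" "S = \<gamma> ` {0..dist x y}"
    by (rule geodesic_segmentE[OF assms(1)], rule that)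
  obtain t where t: "t \<in> {0..dist x y}" "z = \<gamma> t" using assms(2) \<gamma>(4) by blast
  then show ?thesis using \<gamma>(1)[of 0 t] \<gamma>(1)[of t "dist x y"] \<gamma>(2,3) by simp
qed

lemma geodesic_segment_image:
  assumes "g \<in> carrier isometry_group" "geodesic_segment x y S"
  shows "geodesic_segment (g x) (g y) (g ` S)"
proof -
  obtain \<gamma> where "\<And>s t. s \<in> {0..dist x y} \<Longrightarrow> t \<in> {0..dist x y} \<Longrightarrow> dist (\<gamma> s) (\<gamma> t) = \<bar>s - t\<bar>"
    "\<gamma> 0 = x" "\<gamma> (dist x y) = y" "S = \<gamma> ` {0..dist x y}"
    by (rule geodesic_segmentE[OF assms(2)], rule that)
  then show ?thesis
    unfolding geodesic_segment_def
    by (intro exI[of _ "g \<circ> \<gamma>"]) (simp add: isometry_groupD[OF assms(1)] image_image)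
qed

text \<open>A coarse form of betweenness. Geodesics need not be unique, so all of them are required
  to come near \<open>z\<close>; this makes the relation invariant under isometries and applicable
  to any chosen geodesic.\<close>

definition passes :: "'a::metric_space \<Rightarrow> 'a \<Rightarrow> 'a \<Rightarrow> real \<Rightarrow> bool" where
  "passes x y z r \<longleftrightarrow> (\<forall>S. geodesic_segment x y S \<longrightarrow> (\<exists>s\<in>S. dist s z \<le> r))"

lemma passes_sym: "passes x y z r \<Longrightarrow> passes y x z r"
  unfolding passes_def using geodesic_segment_sym by blast

lemma passes_image:
  assumes g: "g \<in> carrier isometry_group" and "passes x y z r"
  shows "passes (g x) (g y) (g z) r"
  unfolding passes_def
proof (intro allI impI)
  fix S assume S: "geodesic_segment (g x) (g y) S"
  have "geodesic_segment x y (inv_into UNIV g ` S)"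
    using geodesic_segment_image[OF isometries.inv_mem[OF g] S] by (simp add: isometry_inverse[OF g])
  then show "\<exists>s\<in>S. dist s (g z) \<le> r"
    using assms(2) unfolding passes_def by (force simp: dist_inverse_isometry[OF g])
qed

lemma passes_weaken:
  assumes "passes x y z r" "r + dist z z' \<le> r'"
  shows "passes x y z' r'"
  using assms unfolding passes_def
  by (meson dist_triangle order_trans add_right_mono)

text \<open>The reverse triangle inequality that coarse betweenness provides. Adding two of them
  with exchanged roles bounds a distance, which is how the contradictions in
  \<open>moved_subshadow\<close> arise.\<close>

lemma passes_dist_sum:
  assumes "geodesic_space TYPE('a::metric_space)" "passes (x::'a) y z r"
  shows "dist x z + dist z y \<le> dist x y + 2 * r"
proof -
  obtain S where S: "geodesic_segment x y S"
    using assms(1) unfolding geodesic_space_def by blast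
  then obtain s where s: "s \<in> S" "dist s z \<le> r"
    using assms(2) unfolding passes_def by blast
  show ?thesis
    using geodesic_segment_dist_sum[OF S s(1)] s(2) dist_triangle[of x z s] dist_triangle[of z y s]
    by (simp add: dist_commute)
qed

section \<open>Contracting sequences\<close>

text \<open>\<open>lower\<close> is the lower quasi-isometry bound multiplied by \<open>k\<close>;
  \<open>upper\<close> has no additive term because distinct integers differ by at least 1.\<close>

locale contracting_sequence =
  fixes a :: "int \<Rightarrow> 'a::metric_space" and C k c L :: real
  assumes proper: "proper_space TYPE('a)" and geodesic: "geodesic_space TYPE('a)"
    and contracting: "contracting C (range a)"
    and pos: "C > 0" "k > 0" "c \<ge> 0" "L \<ge> 0"
    and lower: "\<And>i j. \<bar>real_of_int i - real_of_int j\<bar> \<le> k * dist (a i) (a j) + c"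
    and upper: "\<And>i j. dist (a i) (a j) \<le> L * \<bar>real_of_int i - real_of_int j\<bar>"
begin

text \<open>Nearest points are recorded by their indices, so that projections can be compared in the
  order of the sequence. A point may have several indices.\<close>

definition idx :: "'a \<Rightarrow> int set" where
  "idx x = {n. dist x (a n) = infdist x (range a)}"

lemma idx_nonempty: "idx x \<noteq> {}"
proof -
  let ?K = "range a \<inter> cball x (dist x (a 0))"
  have "closed (range a)" "compact (cball x (dist x (a 0)))"
    using contracting proper by (auto simp: contracting_def proper_space_def)
  then have "compact ?K"
    by (simp add: closed_Int_compact)
  moreover have "a 0 \<in> ?K" by simp
  then have "?K \<noteq> {}" by blast
  moreover have "continuous_on ?K (dist x)"
    by (intro continuous_intros)
  ultimately obtain z where z: "z \<in> ?K" "\<And>w. w \<in> ?K \<Longrightarrow> dist x z \<le> dist x w"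
    using continuous_attains_inf by metis
  then obtain n where n: "z = a n" by blast
  have "dist x (a n) \<le> dist x (a m)" for m
    using z(1) z(2)[of "a m"] by (cases "a m \<in> ?K") (auto simp: n)
  then have "dist x (a n) \<le> infdist x (range a)"
    by (auto simp: infdist_def intro!: cINF_greatest)
  then have "n \<in> idx x"
    unfolding idx_def by (simp add: antisym infdist_le)
  then show ?thesis by blast
qed

lemma idx_self: "m \<in> idx (a m)"
  by (simp add: idx_def)

lemma idx_dist: "i \<in> idx x \<Longrightarrow> dist x (a i) = infdist x (range a)"
  by (simp add: idx_def)

lemma idx_close:
  assumes "dist x y \<le> infdist x (range a)" "i \<in> idx x" "j \<in> idx x \<union> idx y"
  shows "dist (a i) (a j) \<le> C"
proof -
  let ?U = "nearest_point_proj (range a) x \<union> nearest_point_proj (range a) y"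
  \<comment> \<open>\<open>diameter\<close> bounds distances only in bounded sets, since the
    supremum of an unbounded set of reals is unspecified.\<close>
  have "?U \<subseteq> cball x (infdist x (range a)) \<union> cball y (infdist y (range a))"
    by (auto simp: nearest_point_proj_def)
  then have "bounded ?U"
    using bounded_subset bounded_Un bounded_cball by metis
  moreover have "a i \<in> ?U" "a j \<in> ?U"
    using assms by (auto simp: idx_def nearest_point_proj_def)
  ultimately have "dist (a i) (a j) \<le> diameter ?U"
    using diameter_bounded_bound by blast
  then show ?thesis
    using contracting assms(1) unfolding contracting_def by fastforce
qed

text \<open>Either the contraction property applies, or \<open>x\<close> and \<open>y\<close> are
  within one and two times \<open>dist x y\<close> of the sequence, and the path through
  \<open>x\<close> and \<open>y\<close> has length at most \<open>4 * dist x y\<close>.\<close>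

lemma idx_lipschitz:
  assumes "i \<in> idx x" "j \<in> idx y"
  shows "dist (a i) (a j) \<le> C + 4 * dist x y"
proof (cases "dist x y \<le> infdist x (range a)")
  case True
  then show ?thesis using idx_close assms by (smt (verit) UnCI zero_le_dist)
next
  case False
  have "infdist y (range a) \<le> infdist x (range a) + dist x y"
    using infdist_triangle[of y "range a" x] by (simp add: dist_commute)
  then show ?thesis
    using False assms(1,2) dist_triangle[of "a i" "a j" x] dist_triangle[of x "a j" y] pos(1)
    unfolding idx_def by (auto simp: dist_commute)
qed

lemma idx_int_diff:
  assumes "dist (a i) (a j) \<le> r"
  shows "\<bar>real_of_int i - real_of_int j\<bar> \<le> k * r + c"
  using lower[of i j] mult_left_mono[OF assms, of k] pos by linarith

section \<open>Projections of geodesics to a contracting sequence\<close>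

definition unit_speed :: "real set \<Rightarrow> (real \<Rightarrow> 'a) \<Rightarrow> bool" where
  "unit_speed I \<gamma> \<longleftrightarrow> (\<forall>s\<in>I. \<forall>t\<in>I. dist (\<gamma> s) (\<gamma> t) = \<bar>s - t\<bar>)"

lemma unit_speed_subset: "unit_speed I \<gamma> \<Longrightarrow> J \<subseteq> I \<Longrightarrow> unit_speed J \<gamma>"
  unfolding unit_speed_def by blast

lemma unit_speed_infdist:
  assumes "unit_speed I \<gamma>" "s \<in> I" "t \<in> I"
  shows "\<bar>infdist (\<gamma> s) Z - infdist (\<gamma> t) Z\<bar> \<le> \<bar>s - t\<bar>"
proof -
  have "dist (\<gamma> s) (\<gamma> t) = \<bar>s - t\<bar>"
    using assms unfolding unit_speed_def by blast
  then show ?thesis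
    using infdist_triangle[of "\<gamma> s" Z "\<gamma> t"] infdist_triangle[of "\<gamma> t" Z "\<gamma> s"]
    by (simp add: dist_commute)
qed

lemma unit_speed_continuous:
  assumes "unit_speed I \<gamma>"
  shows "continuous_on I (\<lambda>t. infdist (\<gamma> t) Z)"
proof -
  have "1-lipschitz_on I (\<lambda>t. infdist (\<gamma> t) Z)"
    by (rule lipschitz_onI) (use unit_speed_infdist[OF assms] in \<open>auto simp: dist_real_def\<close>)
  then show ?thesis by (rule lipschitz_on_continuous_on)
qed

text \<open>The geodesic is cut into pieces of length at most \<open>\<delta>\<close>. Each is no
  longer than the distance of its starting point from the sequence, so it moves the projection by at
  most \<open>C\<close>.\<close>

lemma far_geodesic_steps:
  assumes "unit_speed {s..t} \<gamma>" "s \<le> t" "t - s \<le> real (Suc n) * \<delta>" "\<delta> > 0"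
    and far: "\<And>r. r \<in> {s..t} \<Longrightarrow> \<delta> \<le> infdist (\<gamma> r) (range a)"
    and "i \<in> idx (\<gamma> s)" "j \<in> idx (\<gamma> t)"
  shows "dist (a i) (a j) \<le> real (Suc n) * C"
  using assms
proof (induction n arbitrary: t j)
  case 0
  then have "dist (\<gamma> s) (\<gamma> t) \<le> infdist (\<gamma> s) (range a)"
    unfolding unit_speed_def by fastforce
  then show ?case using idx_close 0 by (metis UnCI mult_1 of_nat_1 One_nat_def)
next
  case (Suc n)
  define t' where "t' = max s (t - \<delta>)"
  have t': "s \<le> t'" "t' \<le> t" "t - t' \<le> \<delta>" "t' - s \<le> real (Suc n) * \<delta>"
    using Suc.prems(2-4) by (auto simp: t'_def max_def algebra_simps)
  obtain m where m: "m \<in> idx (\<gamma> t')" using idx_nonempty by blast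
  have "dist (a i) (a m) \<le> real (Suc n) * C"
    using t' m Suc.prems by (intro Suc.IH[of t']) (auto intro: unit_speed_subset)
  moreover have "dist (\<gamma> t') (\<gamma> t) \<le> infdist (\<gamma> t') (range a)"
    using Suc.prems(1,2) Suc.prems(5)[of t'] t' unfolding unit_speed_def by fastforce
  then have "dist (a m) (a j) \<le> C"
    using idx_close m Suc.prems(7) by blast
  ultimately show ?case
    using dist_triangle[of "a i" "a j" "a m"] by (simp add: algebra_simps)
qed

text \<open>Before time \<open>infdist (\<gamma> s) (range a)\<close> the projection moves by at most \<open>C\<close>; the
  remaining part of the geodesic is too short for more than a few further steps, because otherwise
  the detour through the projections would be shorter.\<close>

lemma far_geodesic_to_closest:
  assumes "unit_speed {s..t} \<gamma>" "s \<le> t"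
    and far: "2 * C \<le> infdist (\<gamma> t) (range a)"
    and closest: "\<And>r. r \<in> {s..t} \<Longrightarrow> infdist (\<gamma> t) (range a) \<le> infdist (\<gamma> r) (range a)"
    and i: "i \<in> idx (\<gamma> s)" and j: "j \<in> idx (\<gamma> t)"
  shows "dist (a i) (a j) \<le> 6 * C"
proof -
  define h \<delta> where "h = infdist (\<gamma> s) (range a)" and "\<delta> = infdist (\<gamma> t) (range a)"
  have ts: "dist (\<gamma> s) (\<gamma> t) = t - s"
    using assms(1,2) unfolding unit_speed_def by fastforce
  have \<delta>: "\<delta> \<ge> 2 * C" "\<delta> > 0" "h \<ge> \<delta>" using far pos closest[of s] assms(2) by (auto simp: h_def \<delta>_def)
  show ?thesis
  proof (cases "t - s \<le> h")
    case True
    then show ?thesis using idx_close[of "\<gamma> s" "\<gamma> t" i j] i j ts pos by (auto simp: h_def)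
  next
    case False
    define l where "l = t - s - h"
    have l: "l > 0" using False by (simp add: l_def)
    have sh: "s + h \<in> {s..t}" using False \<delta> by auto
    obtain m where m: "m \<in> idx (\<gamma> (s + h))" using idx_nonempty by blast
    have "dist (\<gamma> s) (\<gamma> (s + h)) = h"
      using assms(1) sh unfolding unit_speed_def by fastforce
    then have 1: "dist (a i) (a m) \<le> C"
      using idx_close[of "\<gamma> s" "\<gamma> (s+h)" i m] i m by (auto simp: h_def)
    define n where "n = nat \<lfloor>l / \<delta>\<rfloor>"
    have n: "real n \<le> l / \<delta>" "l / \<delta> \<le> real (Suc n)"
      using l \<delta> by (auto simp: n_def of_nat_nat, linarith)
    have "l \<le> real (Suc n) * \<delta>" using n(2) \<delta> by (simp add: divide_simps mult.commute)
    then have 2: "dist (a m) (a j) \<le> real (Suc n) * C"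
      using sh closest m j \<delta>
      by (intro far_geodesic_steps[where \<gamma>=\<gamma> and s="s+h" and t=t and \<delta>=\<delta>] unit_speed_subset[OF assms(1)])
         (auto simp: l_def \<delta>_def)
    have 3: "real (Suc n) * C \<le> (l / \<delta> + 1) * C"
      using n pos by simp
    have 4: "dist (a i) (a j) \<le> 2 * C + l / \<delta> * C"
      using 1 2 3 dist_triangle[of "a i" "a j" "a m"] by (simp add: algebra_simps)
    have "t - s \<le> h + dist (a i) (a j) + \<delta>"
      using ts dist_triangle[of "\<gamma> s" "\<gamma> t" "a i"] dist_triangle[of "a i" "\<gamma> t" "a j"] i j
      by (simp add: idx_def h_def \<delta>_def dist_commute)
    then have 5: "l \<le> dist (a i) (a j) + \<delta>" by (simp add: l_def)
    \<comment> \<open>With \<open>C \<le> \<delta> / 2\<close> the bounds 4 and 5 give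
      \<open>q * \<delta> \<le> 2 * \<delta> + q * \<delta> / 2\<close>, that is,
      \<open>q \<le> 4\<close>.\<close>
    define q where "q = l / \<delta>"
    have q: "l = q * \<delta>" "q \<ge> 0" using \<delta> l by (auto simp: q_def)
    have "q * \<delta> \<le> 2 * C + q * C + \<delta>" using 4 5 q(1) unfolding q_def[symmetric] by linarith
    moreover have "q * C \<le> q * (\<delta> / 2)" using q \<delta> by (intro mult_left_mono) auto
    ultimately have "q * \<delta> \<le> 4 * \<delta>" using \<delta> by (simp only: times_divide_eq_right)
    then have "q \<le> 4" using \<delta> by simp
    then have "q * C \<le> 4 * C" using pos by simp
    then show ?thesis using 4 by (simp add: q_def)
  qed
qed

lemma unit_speed_reverse:
  "unit_speed {s..t} \<gamma> \<Longrightarrow> unit_speed {-t..-s} (\<lambda>r. \<gamma> (- r))"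
  unfolding unit_speed_def by fastforce

text \<open>Split at a point closest to the sequence and apply
  \<open>far_geodesic_to_closest\<close> to both halves, the second one traversed backwards.\<close>

lemma far_geodesic:
  assumes \<gamma>: "unit_speed {s..t} \<gamma>" and st: "s \<le> t"
    and far: "\<And>r. r \<in> {s..t} \<Longrightarrow> 2 * C \<le> infdist (\<gamma> r) (range a)"
    and i: "i \<in> idx (\<gamma> s)" and j: "j \<in> idx (\<gamma> t)"
  shows "dist (a i) (a j) \<le> 12 * C"
proof -
  obtain u where u: "u \<in> {s..t}" "\<And>r. r \<in> {s..t} \<Longrightarrow> infdist (\<gamma> u) (range a) \<le> infdist (\<gamma> r) (range a)"
    using continuous_attains_inf[OF _ _ unit_speed_continuous[OF \<gamma>, of "range a"]] st by fastforce
  obtain m where m: "m \<in> idx (\<gamma> u)" using idx_nonempty by blast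
  have 1: "dist (a i) (a m) \<le> 6 * C"
    using u far i m by (intro far_geodesic_to_closest[where \<gamma>=\<gamma> and s=s and t=u] unit_speed_subset[OF \<gamma>]) auto
  have 2: "dist (a j) (a m) \<le> 6 * C"
    using u far j m
    by (intro far_geodesic_to_closest[where \<gamma>="\<lambda>r. \<gamma> (-r)" and s="-t" and t="-u"]
        unit_speed_reverse unit_speed_subset[OF \<gamma>]) auto
  show ?thesis using 1 2 dist_triangle[of "a i" "a j" "a m"] by (simp add: dist_commute)
qed

text \<open>Let \<open>[s1, s2]\<close> be the excursion around \<open>r\<close> out of the
  \<open>2 * C\<close>-neighbourhood. The projection moves by at most \<open>12 * C\<close> on it,
  so its length is at most \<open>16 * C\<close>, and \<open>r\<close> is within
  \<open>8 * C\<close> of one of its ends.\<close>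

lemma geodesic_quasi_convex:
  assumes \<gamma>: "unit_speed {s..t} \<gamma>" and r: "r \<in> {s..t}"
    and near: "infdist (\<gamma> s) (range a) \<le> 2 * C" "infdist (\<gamma> t) (range a) \<le> 2 * C"
  shows "infdist (\<gamma> r) (range a) \<le> 10 * C"
proof (cases "infdist (\<gamma> r) (range a) \<le> 2 * C")
  case True
  then show ?thesis using pos by simp
next
  case False
  define f where "f = (\<lambda>t. infdist (\<gamma> t) (range a))"
  have cont: "continuous_on {s..t} f" unfolding f_def by (rule unit_speed_continuous[OF \<gamma>])
  have rf: "f r > 2 * C" using False by (simp add: f_def)
  have sub: "continuous_on {u..v} f" if "s \<le> u" "v \<le> t" for u v
    using that by (intro continuous_on_subset[OF cont]) auto
  have "\<exists>x\<in>{s..r}. f x = 2 * C"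
    using IVT'[of f s "2*C" r] sub[of s r] near rf r by (auto simp: f_def)
  moreover have "compact ({s..r} \<inter> f -` {2 * C})"
    using continuous_closed_preimage[OF sub[of s r] closed_atLeastAtMost closed_singleton, of "2 * C"] r
    by (auto simp: compact_eq_bounded_closed bounded_Int)
  ultimately obtain s1 where s1: "s1 \<in> {s..r}" "f s1 = 2 * C"
    and s1_max: "\<And>x. x \<in> {s..r} \<Longrightarrow> f x = 2 * C \<Longrightarrow> x \<le> s1"
    using compact_attains_sup[of "{s..r} \<inter> f -` {2 * C}"] by blast
  have "\<exists>x\<in>{r..t}. f x = 2 * C"
    using IVT2'[of f t "2*C" r] sub[of r t] near rf r by (auto simp: f_def)
  moreover have "compact ({r..t} \<inter> f -` {2 * C})"
    using continuous_closed_preimage[OF sub[of r t] closed_atLeastAtMost closed_singleton, of "2 * C"] r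
    by (auto simp: compact_eq_bounded_closed bounded_Int)
  ultimately obtain s2 where s2: "s2 \<in> {r..t}" "f s2 = 2 * C"
    and s2_min: "\<And>x. x \<in> {r..t} \<Longrightarrow> f x = 2 * C \<Longrightarrow> s2 \<le> x"
    using compact_attains_inf[of "{r..t} \<inter> f -` {2 * C}"] by blast
  have far: "2 * C \<le> f x" if x: "x \<in> {s1..s2}" for x
  proof (rule ccontr)
    assume *: "\<not> ?thesis"
    show False
    proof (cases "x \<le> r")
      case True
      then obtain y where y: "y \<in> {x..r}" "f y = 2 * C"
        using IVT'[of f x "2*C" r] sub[of x r] * rf r x s1 by auto
      then have "y = x" using s1_max[of y] x s1 by auto
      then show False using y * by simp
    next
      case False
      then obtain y where y: "y \<in> {r..x}" "f y = 2 * C"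
        using IVT2'[of f x "2*C" r] sub[of r x] * rf r x s2 by auto
      then have "y = x" using s2_min[of y] x s2 by auto
      then show False using y * by simp
    qed
  qed
  obtain i j where i: "i \<in> idx (\<gamma> s1)" and j: "j \<in> idx (\<gamma> s2)" using idx_nonempty by blast
  have "dist (a i) (a j) \<le> 12 * C"
    using far s1 s2 i j
    by (intro far_geodesic[where \<gamma>=\<gamma> and s=s1 and t=s2] unit_speed_subset[OF \<gamma>]) (auto simp: f_def)
  moreover have "dist (\<gamma> s1) (\<gamma> s2) = s2 - s1"
    using \<gamma> s1 s2 unfolding unit_speed_def by fastforce
  ultimately have "s2 - s1 \<le> 16 * C"
    using dist_triangle[of "\<gamma> s1" "\<gamma> s2" "a i"] dist_triangle[of "a i" "\<gamma> s2" "a j"] i j s1(2) s2(2)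
    by (simp add: idx_def f_def dist_commute)
  then have "r - s1 \<le> 8 * C \<or> s2 - r \<le> 8 * C" by linarith
  then show ?thesis
    using unit_speed_infdist[OF \<gamma> r, of s1 "range a"] unit_speed_infdist[OF \<gamma> r, of s2 "range a"]
      s1 s2 r by (auto simp: f_def)
qed

end

text \<open>A discrete intermediate value theorem: the first value that reaches \<open>m\<close>
  overshoots it by at most one step.\<close>

lemma discrete_crossing:
  fixes g :: "nat \<Rightarrow> int"
  assumes "g 0 < m" "m \<le> g n" and step: "\<And>r. r < n \<Longrightarrow> g (Suc r) - g r \<le> J"
  obtains r where "r \<le> n" "m \<le> g r" "g r \<le> m + J"
proof -
  define r where "r = (LEAST r. m \<le> g r)"
  have r: "m \<le> g r" "r \<le> n"
    unfolding r_def using assms(2) by (auto intro: LeastI Least_le)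
  then obtain r' where r': "r = Suc r'" using assms(1) by (cases r) auto
  then have "\<not> m \<le> g r'" using not_less_Least[of r' "\<lambda>r. m \<le> g r"] by (simp add: r_def)
  then show ?thesis using step[of r'] r r' by (intro that[of r]) auto
qed

context contracting_sequence
begin

text \<open>The constants of \<open>passes_between\<close>. \<open>jump\<close> bounds the index
  difference of terms at distance at most \<open>2 * C\<close>. \<open>gap\<close> exceeds the index
  difference of terms at distance at most \<open>12 * C\<close>, with \<open>jump\<close> added for
  an overshoot. \<open>thickness\<close> is the constant of quasi-convexity plus the length of an
  overshoot.\<close>

definition jump :: int where "jump = \<lceil>2 * k * C + c\<rceil>"

definition gap :: int where "gap = jump + \<lceil>12 * k * C + c\<rceil> + 1"

definition thickness :: real where "thickness = 10 * C + L * jump"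

lemma jump_gap_bounds: "jump \<ge> 0" "gap \<ge> 1" "thickness \<ge> 0"
proof -
  have "2 * k * C + c > 0" "12 * k * C + c > 0" using pos by (simp_all add: add_pos_nonneg)
  then show "jump \<ge> 0" "gap \<ge> 1" unfolding jump_def gap_def by linarith+
  then show "thickness \<ge> 0" unfolding thickness_def using pos by simp
qed

lemma idx_iff: "n \<in> idx x \<longleftrightarrow> (\<forall>m. dist x (a n) \<le> dist x (a m))"
proof
  assume "n \<in> idx x"
  then show "\<forall>m. dist x (a n) \<le> dist x (a m)" by (simp add: idx_def infdist_le)
next
  assume "\<forall>m. dist x (a n) \<le> dist x (a m)"
  then have "dist x (a n) \<le> infdist x (range a)" by (auto simp: infdist_def intro!: cINF_greatest)
  then show "n \<in> idx x" unfolding idx_def by (simp add: antisym infdist_le)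
qed

text \<open>Along the geodesic the projection moves in small steps from \<open>i\<close> to
  \<open>j\<close>, so at some time its index is just past \<open>m\<close>. It is then far from
  \<open>i\<close> and from \<open>j\<close>, so by \<open>far_geodesic\<close> the geodesic comes
  close to the sequence both before and after this time, and quasi-convexity applies.\<close>

lemma passes_between:
  assumes i: "i \<in> idx u" and j: "j \<in> idx v" and m: "i + gap \<le> m" "m + gap \<le> j"
  shows "passes u v (a m) thickness"
  unfolding passes_def
proof (intro allI impI)
  fix S assume S: "geodesic_segment u v S"
  obtain \<gamma> where \<gamma>: "\<And>s t. s \<in> {0..dist u v} \<Longrightarrow> t \<in> {0..dist u v} \<Longrightarrow> dist (\<gamma> s) (\<gamma> t) = \<bar>s - t\<bar>"
    "\<gamma> 0 = u" "\<gamma> (dist u v) = v" "S = \<gamma> ` {0..dist u v}"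
    by (rule geodesic_segmentE[OF S], rule that)
  define l where "l = dist u v"
  have us: "unit_speed {0..l} \<gamma>" using \<gamma>(1) by (auto simp: unit_speed_def l_def)
  \<comment> \<open>The sample points are at distance at most \<open>C / 4\<close>, so that by
    \<open>idx_lipschitz\<close> consecutive projections are at distance at most
    \<open>2 * C\<close>.\<close>
  define n where "n = nat \<lceil>4 * l / C\<rceil> + 1"
  have n: "n > 0" "l \<le> real n * (C / 4)"
  proof -
    have "4 * l / C \<le> real n" unfolding n_def by linarith
    then show "l \<le> real n * (C / 4)" using pos by (simp add: field_simps)
  qed (simp add: n_def)
  define \<tau> where "\<tau> r = real r * (l / real n)" for r :: nat
  have \<tau>0: "\<tau> 0 = 0" "\<tau> n = l"
    using n by (auto simp: \<tau>_def)
  have \<tau>: "\<tau> r \<in> {0..l}" if "r \<le> n" for r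
    using n that by (auto simp: \<tau>_def l_def field_simps mult_right_mono)
  \<comment> \<open>As projections are not unique, the given indices \<open>i\<close> and
    \<open>j\<close> are prescribed at the two ends.\<close>
  define g where "g r = (if r = 0 then i else if r = n then j else SOME x. x \<in> idx (\<gamma> (\<tau> r)))" for r
  have g: "g r \<in> idx (\<gamma> (\<tau> r))" if "r \<le> n" for r
    using i j \<gamma>(2,3) \<tau>0 n some_in_eq[of "idx (\<gamma> (\<tau> r))"] idx_nonempty
    by (auto simp: g_def l_def)
  have "g (Suc r) - g r \<le> jump" if "r < n" for r
  proof -
    have "\<tau> (Suc r) - \<tau> r = l / real n" by (simp add: \<tau>_def add_divide_distrib distrib_right)
    moreover have "l / real n \<le> C / 4" "l / real n \<ge> 0" using n by (simp_all add: field_simps l_def)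
    ultimately have "\<bar>\<tau> r - \<tau> (Suc r)\<bar> \<le> C / 4" by linarith
    moreover have "dist (\<gamma> (\<tau> r)) (\<gamma> (\<tau> (Suc r))) = \<bar>\<tau> r - \<tau> (Suc r)\<bar>"
      using us \<tau>[of r] \<tau>[of "Suc r"] that unfolding unit_speed_def by simp
    ultimately have "dist (\<gamma> (\<tau> r)) (\<gamma> (\<tau> (Suc r))) \<le> C / 4" by simp
    then have "dist (a (g r)) (a (g (Suc r))) \<le> 2 * C"
      using idx_lipschitz[OF g[of r] g[of "Suc r"]] that by simp
    then have "real_of_int (g (Suc r)) - real_of_int (g r) \<le> 2 * k * C + c"
      using idx_int_diff[of "g r" "g (Suc r)" "2 * C"] by (simp add: algebra_simps)
    then show ?thesis unfolding jump_def by linarith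
  qed
  then obtain r where r: "r \<le> n" "m \<le> g r" "g r \<le> m + jump"
    using discrete_crossing[of g m n jump] m jump_gap_bounds n by (auto simp: g_def)
  define t where "t = \<tau> r"
  have t: "t \<in> {0..l}" "g r \<in> idx (\<gamma> t)" using \<tau> g r by (auto simp: t_def)
  have far: "\<not> dist (a x) (a y) \<le> 12 * C" if "\<lceil>12 * k * C + c\<rceil> < \<bar>x - y\<bar>" for x y
    using idx_int_diff[of x y "12 * C"] that by (simp add: algebra_simps) linarith
  have "\<not> dist (a i) (a (g r)) \<le> 12 * C"
    using r m jump_gap_bounds by (intro far) (simp add: gap_def)
  then obtain p where p: "p \<in> {0..t}" "infdist (\<gamma> p) (range a) \<le> 2 * C"
    using far_geodesic[of 0 t \<gamma> i "g r"] unit_speed_subset[OF us] t i \<gamma>(2) by fastforce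
  have "\<not> dist (a (g r)) (a j) \<le> 12 * C"
    using r m jump_gap_bounds by (intro far) (simp add: gap_def)
  then obtain q where q: "q \<in> {t..l}" "infdist (\<gamma> q) (range a) \<le> 2 * C"
    using far_geodesic[of t l \<gamma> "g r" j] unit_speed_subset[OF us] t j \<gamma>(3) by (fastforce simp: l_def)
  have "infdist (\<gamma> t) (range a) \<le> 10 * C"
    using p q t by (intro geodesic_quasi_convex[of p q] unit_speed_subset[OF us]) auto
  then have "dist (\<gamma> t) (a (g r)) \<le> 10 * C" using idx_dist[OF t(2)] by simp
  moreover have "dist (a (g r)) (a m) \<le> L * jump"
    using upper[of "g r" m] r pos(4) by (smt (verit) mult_left_mono of_int_diff of_int_le_iff)
  ultimately have "dist (\<gamma> t) (a m) \<le> thickness"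
    unfolding thickness_def using dist_triangle[of "\<gamma> t" "a m" "a (g r)"] by linarith
  then show "\<exists>s\<in>S. dist s (a m) \<le> thickness" using t \<gamma>(4) by (auto simp: l_def)
qed

text \<open>Otherwise going from \<open>x\<close> through \<open>q\<close> to another term would be
  shorter than the distance from \<open>x\<close> to \<open>a n\<close>.\<close>

lemma idx_on_geodesic:
  assumes "n \<in> idx x" "geodesic_segment x (a n) S" "q \<in> S"
  shows "n \<in> idx q"
  unfolding idx_iff
proof
  fix m
  have "dist x (a n) \<le> dist x (a m)" using assms(1) by (simp add: idx_iff)
  then show "dist q (a n) \<le> dist q (a m)"
    using geodesic_segment_dist_sum[OF assms(2,3)] dist_triangle[of x "a m" q] by linarith
qed

end

section \<open>Powers of a contracting element and their commensurator\<close>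

locale contracting_action = contracting_sequence a C k c L + isometry_subgroup \<Gamma>
  for a :: "int \<Rightarrow> 'a::metric_space" and C k c L and \<Gamma> +
  fixes F :: "int \<Rightarrow> 'a \<Rightarrow> 'a"
  assumes F_mem: "\<And>n. F n \<in> \<Gamma>"
    and F_add: "\<And>m n. F (m + n) = F m \<circ> F n"
    and F_zero: "F 0 = id"
    and a_F: "\<And>n. a n = F n (a 0)"
    and finite_balls: "\<And>r. finite {g \<in> \<Gamma>. dist (a 0) (g (a 0)) \<le> r}"
begin

lemma F_a: "F m (a n) = a (m + n)"
  using a_F[of n] a_F[of "m + n"] by (simp add: F_add)

lemma F_F: "F m (F n x) = F (m + n) x"
  by (simp add: F_add)

lemma F_isometry: "F n \<in> carrier isometry_group"
  using F_mem isometry by blast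

lemma idx_shift: "n + m \<in> idx (F n x) \<longleftrightarrow> m \<in> idx x"
proof -
  have "dist (F n x) (a (n + l)) = dist x (a l)" for l
    using isometry_groupD(1)[OF F_isometry] by (simp flip: F_a)
  then show ?thesis unfolding idx_iff by (metis add_diff_cancel_left' add.commute diff_add_cancel)
qed

text \<open>A geodesic between two terms stays near the sequence by quasi-convexity, and its image
  under \<open>e\<close> passes near \<open>a m\<close> by \<open>passes_between\<close>. So a
  translate that projects to both sides of \<open>m\<close> runs close to
  \<open>a m\<close>.\<close>

lemma near_points:
  assumes e: "e \<in> carrier isometry_group"
    and "i1 \<in> idx (e (a n1))" "i2 \<in> idx (e (a n2))" "i1 + gap \<le> m" "m + gap \<le> i2"
  obtains j where "dist (a m) (e (a j)) \<le> thickness + 10 * C"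
proof -
  let ?x = "a n1" and ?y = "a n2"
  obtain S where S: "geodesic_segment ?x ?y S"
    using geodesic unfolding geodesic_space_def by blast
  obtain q where q: "q \<in> S" "dist (e q) (a m) \<le> thickness"
    using passes_between[OF assms(2-5)] geodesic_segment_image[OF e S] unfolding passes_def by blast
  obtain \<gamma> where \<gamma>: "\<And>s t. s \<in> {0..dist ?x ?y} \<Longrightarrow> t \<in> {0..dist ?x ?y} \<Longrightarrow> dist (\<gamma> s) (\<gamma> t) = \<bar>s - t\<bar>"
    "\<gamma> 0 = ?x" "\<gamma> (dist ?x ?y) = ?y" "S = \<gamma> ` {0..dist ?x ?y}"
    by (rule geodesic_segmentE[OF S], rule that)
  obtain t where t: "t \<in> {0..dist ?x ?y}" "q = \<gamma> t" using q \<gamma>(4) by blast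
  have "infdist (\<gamma> t) (range a) \<le> 10 * C"
    using t \<gamma> pos by (intro geodesic_quasi_convex[of 0 "dist ?x ?y"]) (auto simp: unit_speed_def)
  moreover obtain j where "j \<in> idx q" using idx_nonempty by blast
  ultimately have "dist q (a j) \<le> 10 * C" using t by (simp add: idx_dist)
  then have "dist (e q) (e (a j)) \<le> 10 * C" using isometry_groupD(1)[OF e] by simp
  then show ?thesis
    using q(2) dist_triangle[of "a m" "e (a j)" "e q"] by (intro that[of j]) (simp add: dist_commute)
qed

text \<open>The commensurator of the infinite cyclic group \<open>range F\<close> in
  \<open>\<Gamma>\<close>: for such a group, commensurability with a conjugate means a nontrivial
  intersection. It plays the role of the maximal elementary subgroup containing
  \<open>F 1\<close>.\<close>

definition commensurator :: "('a \<Rightarrow> 'a) set" where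
  "commensurator = {e \<in> \<Gamma>. \<exists>b d. b \<noteq> 0 \<and> e \<circ> F d = F b \<circ> e}"

lemma F_intertwine:
  assumes "e \<circ> F d = F b \<circ> e"
  shows "e \<circ> F (d * n) = F (b * n) \<circ> e"
proof -
  have pt: "e (F d x) = F b (e x)" for x using assms by (metis comp_apply)
  have neg: "e (F (- d) x) = F (- b) (e x)" for x
  proof -
    have "F b (e (F (- d) x)) = e x" by (simp add: F_F F_zero flip: pt)
    then have "F (- b) (F b (e (F (- d) x))) = F (- b) (e x)" by simp
    then show ?thesis by (simp add: F_F F_zero)
  qed
  have "e (F (d * n) x) = F (b * n) (e x)" for x
  proof (induction n arbitrary: x rule: int_induct[where k=0])
    case base
    then show ?case by (simp add: F_zero)
  next
    case (step1 i)
    have "e (F (d * (i + 1)) x) = e (F (d * i) (F d x))" by (simp add: F_F algebra_simps)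
    also have "\<dots> = F (b * i) (F b (e x))" by (simp only: step1 pt)
    finally show ?case by (simp add: F_F algebra_simps)
  next
    case (step2 i)
    have "e (F (d * (i - 1)) x) = e (F (d * i) (F (- d) x))" by (simp add: F_F algebra_simps)
    also have "\<dots> = F (b * i) (F (- b) (e x))" by (simp only: step2 neg)
    finally show ?case by (simp add: F_F algebra_simps)
  qed
  then show ?thesis by (simp add: fun_eq_iff)
qed

text \<open>Otherwise all \<open>a (b * n)\<close> would equal \<open>a 0\<close>, against
  \<open>lower\<close> for large \<open>n\<close>.\<close>

lemma F_eq_id: "F b = id \<Longrightarrow> b = 0"
proof (rule ccontr)
  assume b: "F b = id" "b \<noteq> 0"
  define n where "n = \<lceil>c\<rceil> + 1"
  have "F (b * n) = id" using F_intertwine[of id 0 b n] b by (simp add: F_zero)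
  then have "a (b * n) = a 0" using a_F[of "b * n"] by simp
  then have "\<bar>real_of_int (b * n)\<bar> \<le> c" using lower[of "b * n" 0] by simp
  moreover have "n \<ge> 1" using pos unfolding n_def by linarith
  then have "\<bar>b * n\<bar> \<ge> n" using b(2) by (simp add: abs_mult)
  ultimately show False unfolding n_def by linarith
qed

lemma inj_F: "inj F"
proof (rule injI)
  fix m n assume "F m = F n"
  then have "F (m - n) = F (n - n)" using F_add[of m "- n"] F_add[of n "- n"] by simp
  then show "m = n" using F_eq_id[of "m - n"] by (simp add: F_zero)
qed

text \<open>If the translate by \<open>e\<close> had an unbounded projection, it would stay close to
  the sequence for a long time. The elements \<open>F (- m) \<circ> e \<circ> F (f m)\<close> would
  then lie in a finite ball of \<open>\<Gamma>\<close>, and a coincidence of two of them is an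
  intertwining relation for \<open>e\<close>.\<close>

lemma bounded_projection:
  assumes e: "e \<in> \<Gamma>" "e \<notin> commensurator"
  shows "\<exists>M. \<forall>n. \<forall>i\<in>idx (e (a n)). \<bar>i\<bar> \<le> M"
proof (rule ccontr)
  assume *: "\<not> ?thesis"
  define B where "B = {g \<in> \<Gamma>. dist (a 0) (g (a 0)) \<le> thickness + 10 * C}"
  define s where "s = int (card B)"
  obtain i0 where i0: "i0 \<in> idx (e (a 0))" using idx_nonempty by blast
  \<comment> \<open>The bound leaves room for \<open>card B + 1\<close> consecutive indices at
    distance at least \<open>gap\<close> from both \<open>i0\<close> and \<open>i1\<close>, enough
    for the pigeonhole principle.\<close>
  obtain n i1 where i1: "i1 \<in> idx (e (a n))" "\<bar>i1\<bar> > \<bar>i0\<bar> + 2 * gap + s + 1"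
    using * by (metis linorder_not_le)
  have s: "s \<ge> 0" by (simp add: s_def)
  obtain m0 where m0: "\<forall>m\<in>{m0..m0 + s}. \<exists>j. dist (a m) (e (a j)) \<le> thickness + 10 * C"
  proof (cases "i1 \<ge> 0")
    case True
    have "\<exists>j. dist (a m) (e (a j)) \<le> thickness + 10 * C" if "m \<in> {i0 + gap..i0 + gap + s}" for m
      by (rule near_points[OF isometry[OF e(1)] i0 i1(1), of m]) (use that i1 s True in auto)
    then show ?thesis using that by blast
  next
    case False
    have "\<exists>j. dist (a m) (e (a j)) \<le> thickness + 10 * C" if "m \<in> {i0 - gap - s..i0 - gap - s + s}" for m
      by (rule near_points[OF isometry[OF e(1)] i1(1) i0, of m]) (use that i1 s False in auto)
    then show ?thesis using that by blast
  qed
  then obtain f where f: "\<And>m. m \<in> {m0..m0 + s} \<Longrightarrow> dist (a m) (e (a (f m))) \<le> thickness + 10 * C"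
    by metis
  define \<phi> where "\<phi> m = F (- m) \<circ> (e \<circ> F (f m))" for m
  have "dist (a 0) (\<phi> m (a 0)) = dist (a m) (e (a (f m)))" for m
    using isometry_groupD(1)[OF F_isometry, of m "a 0" "\<phi> m (a 0)"]
    by (simp add: \<phi>_def F_F F_a F_zero)
  then have "\<phi> ` {m0..m0 + s} \<subseteq> B"
    using f e by (auto simp: B_def \<phi>_def intro!: comp_mem F_mem)
  moreover have "finite B" using finite_balls by (simp add: B_def)
  moreover have "card {m0..m0 + s} > card B" using s by (simp add: s_def)
  ultimately have "\<not> inj_on \<phi> {m0..m0 + s}"
    by (metis card_inj_on_le linorder_not_le)
  then obtain m m' where m: "m \<noteq> m'" "\<phi> m = \<phi> m'" unfolding inj_on_def by blast
  have "F m \<circ> \<phi> m \<circ> F (- f m') = e \<circ> F (f m - f m')"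
    by (simp add: fun_eq_iff \<phi>_def F_F F_zero)
  moreover have "F m \<circ> \<phi> m' \<circ> F (- f m') = F (m - m') \<circ> e"
    by (simp add: fun_eq_iff \<phi>_def F_F F_zero)
  ultimately have "e \<circ> F (f m - f m') = F (m - m') \<circ> e" using m(2) by simp
  moreover have "m - m' \<noteq> 0" using m(1) by simp
  ultimately show False
    using e unfolding commensurator_def by blast
qed

lemma commensurator_power:
  assumes "e \<in> commensurator"
  obtains b d where "d > 0" "b \<noteq> 0" "e \<circ> F d = F b \<circ> e"
proof -
  obtain b d where bd: "b \<noteq> 0" "e \<circ> F d = F b \<circ> e" and e: "e \<in> \<Gamma>"
    using assms unfolding commensurator_def by auto
  have "d \<noteq> 0"
  proof
    assume "d = 0"
    then have "F b (e (inv_into UNIV e x)) = e (inv_into UNIV e x)" for x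
      using bd(2) by (simp add: F_zero fun_eq_iff)
    then have "F b = id" using isometry_inverse[OF isometry[OF e]] by (simp add: fun_eq_iff)
    then show False using F_eq_id bd by blast
  qed
  then show ?thesis
    using that[of d b] that[of "- d" "- b"] bd F_intertwine[OF bd(2), of "-1"] by fastforce
qed

text \<open>The relation \<open>e \<circ> F d = F b \<circ> e\<close> makes the projection of the
  translate by \<open>e\<close> unbounded, so \<open>near_points\<close> applies. Hence finitely
  many double cosets of \<open>range F\<close> cover the commensurator.\<close>

lemma commensurator_near:
  assumes "e \<in> commensurator"
  obtains i j where "dist (a 0) ((F i \<circ> e \<circ> F j) (a 0)) \<le> thickness + 10 * C"
proof -
  obtain b d where bd: "b \<noteq> 0" "e \<circ> F d = F b \<circ> e" and e: "e \<in> \<Gamma>"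
    using assms unfolding commensurator_def by auto
  define n where "n = 2 * gap * sgn b"
  have n: "b * n \<ge> 2 * gap"
    using bd(1) jump_gap_bounds by (simp add: n_def mult.assoc mult.left_commute[of b] abs_sgn[symmetric])
  obtain i0 where i0: "i0 \<in> idx (e (a 0))" using idx_nonempty by blast
  have "e (a (d * n)) = F (b * n) (e (a 0))"
    using F_intertwine[OF bd(2), of n] a_F[of "d * n"] by (metis comp_apply)
  then have "b * n + i0 \<in> idx (e (a (d * n)))" using i0 idx_shift by simp
  then obtain j where "dist (a (i0 + gap)) (e (a j)) \<le> thickness + 10 * C"
    using n by (elim near_points[OF isometry[OF e] i0, of _ _ "i0 + gap"]) auto
  moreover have "dist (a 0) ((F (- (i0 + gap)) \<circ> e \<circ> F j) (a 0)) = dist (a (i0 + gap)) (e (a j))"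
  proof -
    let ?m = "i0 + gap"
    have "dist (a 0) (F (- ?m) (e (a j))) = dist (F ?m (a 0)) (F ?m (F (- ?m) (e (a j))))"
      by (simp only: isometry_groupD(1)[OF F_isometry])
    also have "\<dots> = dist (a ?m) (e (a j))"
      by (simp add: F_F F_zero) (simp add: F_a)
    finally show ?thesis by (simp add: F_a)
  qed
  ultimately show ?thesis using that by metis
qed

end

section \<open>Subgroups of infinite index\<close>

context group
begin

definition finite_index :: "'a set \<Rightarrow> bool" where
  "finite_index C \<longleftrightarrow>
     (\<exists>T. finite T \<and> T \<subseteq> carrier G \<and> (\<forall>x\<in>carrier G. \<exists>t\<in>T. inv t \<otimes> x \<in> C))"

text \<open>B. H. Neumann's lemma.\<close>

lemma finite_index_of_coset_cover:
  assumes "finite \<C>" "\<And>C. C \<in> \<C> \<Longrightarrow> subgroup C G" "finite T" "T \<subseteq> carrier G"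
    and "\<And>x. x \<in> carrier G \<Longrightarrow> \<exists>t\<in>T. \<exists>C\<in>\<C>. inv t \<otimes> x \<in> C"
  shows "\<exists>C\<in>\<C>. finite_index C"
  using assms
proof (induction \<C> arbitrary: T rule: finite_induct)
  case empty
  then show ?case using one_closed by blast
next
  case (insert C \<C>)
  interpret C: subgroup C G using insert.prems(1) by blast
  show ?case
  proof (cases "\<forall>x\<in>carrier G. \<exists>t\<in>T. inv t \<otimes> x \<in> C")
    case True
    then show ?thesis using insert.prems(2,3) unfolding finite_index_def by blast
  next
    case False
    then obtain a where a: "a \<in> carrier G" "\<And>t. t \<in> T \<Longrightarrow> inv t \<otimes> a \<notin> C" by blast
    \<comment> \<open>The coset \<open>a C\<close> meets no coset \<open>t' C\<close> with
      \<open>t'\<close> in \<open>T\<close>, so it is covered by cosets \<open>t' D\<close> of the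
      remaining subgroups. Multiplying by \<open>t \<otimes> inv a\<close> covers each
      \<open>t C\<close> by cosets of those subgroups.\<close>
    let ?T = "T \<union> (\<lambda>(t, t'). t \<otimes> inv a \<otimes> t') ` (T \<times> T)"
    have "\<exists>D\<in>\<C>. finite_index D"
    proof (rule insert.IH)
      show "finite ?T" "?T \<subseteq> carrier G" using insert.prems(2,3) a(1) by auto
      fix x assume x: "x \<in> carrier G"
      obtain t D where t: "t \<in> T" "D \<in> insert C \<C>" "inv t \<otimes> x \<in> D"
        using insert.prems(4)[OF x] by blast
      show "\<exists>t\<in>?T. \<exists>C\<in>\<C>. inv t \<otimes> x \<in> C"
      proof (cases "D = C")
        case False
        then show ?thesis using t by blast
      next
        case True
        have tc: "t \<in> carrier G" using t insert.prems(3) by blast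
        let ?y = "a \<otimes> (inv t \<otimes> x)"
        have y: "?y \<in> carrier G" using a(1) tc x by simp
        obtain t' D' where t': "t' \<in> T" "D' \<in> insert C \<C>" "inv t' \<otimes> ?y \<in> D'"
          using insert.prems(4)[OF y] by blast
        have tc': "t' \<in> carrier G" using t' insert.prems(3) by blast
        have "D' \<noteq> C"
        proof
          assume "D' = C"
          then have "(inv t' \<otimes> ?y) \<otimes> inv (inv t \<otimes> x) \<in> C"
            using t t' True C.m_closed C.m_inv_closed by blast
          also have "(inv t' \<otimes> (a \<otimes> z)) \<otimes> inv z = inv t' \<otimes> a" if "z \<in> carrier G" for z
            using a(1) tc' that by (simp add: m_assoc)
          then have "(inv t' \<otimes> ?y) \<otimes> inv (inv t \<otimes> x) = inv t' \<otimes> a" using tc x by simp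
          finally show False using a(2) t' by blast
        qed
        moreover have "inv (t \<otimes> inv a \<otimes> t') \<otimes> x = inv t' \<otimes> ?y"
          using a(1) tc tc' x by (simp add: m_assoc inv_mult_group)
        ultimately show ?thesis
          using t t' by (intro bexI[of _ "t \<otimes> inv a \<otimes> t'"] bexI[of _ D']) auto
      qed
    qed (use insert.prems in blast)
    then show ?thesis by blast
  qed
qed

text \<open>A greedy choice: by \<open>finite_index_of_coset_cover\<close> the cosets of the
  elements chosen so far do not cover the group. Closure of each \<open>C\<close> under inverses
  gives the condition for the exchanged pair.\<close>

lemma pairwise_inequivalent_elements:
  assumes "finite \<C>" "\<And>C. C \<in> \<C> \<Longrightarrow> subgroup C G" "\<And>C. C \<in> \<C> \<Longrightarrow> \<not> finite_index C"
  shows "\<exists>e::nat \<Rightarrow> 'a. (\<forall>i<n. e i \<in> carrier G) \<and>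
           (\<forall>i<n. \<forall>j<n. i \<noteq> j \<longrightarrow> (\<forall>C\<in>\<C>. inv (e i) \<otimes> e j \<notin> C))"
proof (induction n)
  case (Suc n)
  then obtain e where e: "\<And>i. i < n \<Longrightarrow> e i \<in> carrier G"
    "\<And>i j C. i < n \<Longrightarrow> j < n \<Longrightarrow> i \<noteq> j \<Longrightarrow> C \<in> \<C> \<Longrightarrow> inv (e i) \<otimes> e j \<notin> C"
    by metis
  have "\<exists>x\<in>carrier G. \<forall>i<n. \<forall>C\<in>\<C>. inv (e i) \<otimes> x \<notin> C"
  proof (rule ccontr)
    assume *: "\<not> ?thesis"
    have cover: "\<exists>t\<in>e ` {..<n}. \<exists>C\<in>\<C>. inv t \<otimes> x \<in> C" if x: "x \<in> carrier G" for x
    proof -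
      have "\<not> (\<forall>i<n. \<forall>C\<in>\<C>. inv (e i) \<otimes> x \<notin> C)" using * x by metis
      then obtain i C where "i < n" "C \<in> \<C>" "inv (e i) \<otimes> x \<in> C" by auto
      then show ?thesis by (intro bexI[of _ "e i"] bexI[of _ C]) auto
    qed
    have "\<exists>C\<in>\<C>. finite_index C"
    proof (rule finite_index_of_coset_cover[OF assms(1,2)])
      show "finite (e ` {..<n})" "e ` {..<n} \<subseteq> carrier G" using e(1) by auto
    qed (use cover in auto)
    then show False using assms(3) by blast
  qed
  then obtain x where x: "x \<in> carrier G" "\<And>i C. i < n \<Longrightarrow> C \<in> \<C> \<Longrightarrow> inv (e i) \<otimes> x \<notin> C"
    by blast
  have x': "inv x \<otimes> e i \<notin> C" if iC: "i < n" "C \<in> \<C>" for i C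
  proof
    assume "inv x \<otimes> e i \<in> C"
    then have "inv (inv x \<otimes> e i) \<in> C"
      using subgroup.m_inv_closed[OF assms(2)[OF iC(2)]] by simp
    then show False using x(1) x(2)[OF iC] e(1)[OF iC(1)] by (simp add: inv_mult_group)
  qed
  have "(e(n := x)) i \<in> carrier G" if "i < Suc n" for i
    using e(1)[of i] x(1) that by (cases "i = n") auto
  moreover have "inv ((e(n := x)) i) \<otimes> (e(n := x)) j \<notin> C"
    if "i < Suc n" "j < Suc n" "i \<noteq> j" "C \<in> \<C>" for i j C
    using e(2)[of i j C] x(2)[of i C] x'[of j C] that by (cases "i = n"; cases "j = n") auto
  ultimately show ?case by blast
qed simp

end

lemma (in isometry_subgroup) group_carrier: "group (isometry_group\<lparr>carrier := \<Gamma>\<rparr>)"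
  using subgroup.subgroup_is_group[OF is_subgroup group_isometry_group] .

lemma (in isometry_subgroup) inv_carrier:
  "g \<in> \<Gamma> \<Longrightarrow> m_inv (isometry_group\<lparr>carrier := \<Gamma>\<rparr>) g = inv_into UNIV g"
  using group.m_inv_consistent[OF group_isometry_group is_subgroup] m_inv_isometry_group isometry
  by metis

lemma subgroup_isometryI:
  assumes "C \<subseteq> carrier isometry_group" "id \<in> C" "\<And>g h. g \<in> C \<Longrightarrow> h \<in> C \<Longrightarrow> g \<circ> h \<in> C"
    "\<And>g. g \<in> C \<Longrightarrow> inv_into UNIV g \<in> C"
  shows "subgroup C isometry_group"
proof (rule group.subgroupI[OF group_isometry_group])
  show "m_inv isometry_group g \<in> C" if "g \<in> C" for g
    using assms(1,4) that m_inv_isometry_group by (metis subsetD)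
qed (use assms in \<open>auto simp: isometry_group_simps\<close>)

lemma (in isometry_subgroup) pairwise_inequivalent_isometries:
  assumes "finite \<C>" "\<And>C. C \<in> \<C> \<Longrightarrow> subgroup C isometry_group \<and> C \<subseteq> \<Gamma>"
    and "\<And>C T. C \<in> \<C> \<Longrightarrow> finite T \<Longrightarrow> T \<subseteq> \<Gamma> \<Longrightarrow> \<exists>x\<in>\<Gamma>. \<forall>t\<in>T. inv_into UNIV t \<circ> x \<notin> C"
  obtains e :: "nat \<Rightarrow> 'a \<Rightarrow> 'a" where "\<And>i. i < n \<Longrightarrow> e i \<in> \<Gamma>"
    "\<And>i j C. i < n \<Longrightarrow> j < n \<Longrightarrow> i \<noteq> j \<Longrightarrow> C \<in> \<C> \<Longrightarrow> inv_into UNIV (e i) \<circ> e j \<notin> C"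
proof -
  let ?G = "isometry_group\<lparr>carrier := \<Gamma>\<rparr>"
  interpret \<Gamma>: group ?G by (rule group_carrier)
  have 1: "subgroup C ?G" if "C \<in> \<C>" for C
    using group.subgroup_incl[OF group_isometry_group _ is_subgroup] assms(2)[OF that] by blast
  have 2: "\<not> \<Gamma>.finite_index C" if C: "C \<in> \<C>" for C
  proof
    assume "\<Gamma>.finite_index C"
    then obtain T where T: "finite T" "T \<subseteq> \<Gamma>" "\<forall>x\<in>\<Gamma>. \<exists>t\<in>T. m_inv ?G t \<circ> x \<in> C"
      unfolding \<Gamma>.finite_index_def by (auto simp: isometry_group_simps)
    have "\<forall>x\<in>\<Gamma>. \<exists>t\<in>T. inv_into UNIV t \<circ> x \<in> C"
      using T(2,3) inv_carrier by (metis subsetD)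
    then show False using assms(3)[OF C T(1,2)] by blast
  qed
  obtain e where e: "\<forall>i<n. e i \<in> \<Gamma>"
    "\<forall>i<n. \<forall>j<n. i \<noteq> j \<longrightarrow> (\<forall>C\<in>\<C>. m_inv ?G (e i) \<circ> e j \<notin> C)"
    using \<Gamma>.pairwise_inequivalent_elements[OF assms(1) 1 2, of n]
    by (auto simp: isometry_group_simps)
  show ?thesis
  proof (rule that[of e])
    show "e i \<in> \<Gamma>" if "i < n" for i using e(1) that by blast
    then show "inv_into UNIV (e i) \<circ> e j \<notin> C" if "i < n" "j < n" "i \<noteq> j" "C \<in> \<C>" for i j C
      using e(2) that inv_carrier by metis
  qed
qed

section \<open>Ping-pong\<close>

context contracting_action
begin

text \<open>Intertwining relations compose after passing to common powers. Inversion exchanges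
  \<open>b\<close> and \<open>d\<close>, which is possible because \<open>d\<close> is nonzero by
  \<open>commensurator_power\<close>.\<close>

lemma commensurator_subgroup: "subgroup commensurator isometry_group"
proof (rule subgroup_isometryI)
  show "commensurator \<subseteq> carrier isometry_group"
    using isometry unfolding commensurator_def by blast
  show "id \<in> commensurator"
    unfolding commensurator_def by (rule CollectI, rule conjI[OF id_mem], rule exI[of _ 1], rule exI[of _ 1]) simp
next
  fix g h assume g: "g \<in> commensurator" and h: "h \<in> commensurator"
  obtain b' d' where 2: "b' \<noteq> 0" "d' > 0" "h \<circ> F d' = F b' \<circ> h" by (rule commensurator_power[OF h], rule that)
  obtain b d where 3: "b \<noteq> 0" "g \<circ> F d = F b \<circ> g" by (rule commensurator_power[OF g], rule that)
  have "(g \<circ> h) \<circ> F (d' * d) = g \<circ> (F (b' * d) \<circ> h)"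
    using F_intertwine[OF 2(3), of d] by (simp add: comp_assoc)
  also have "\<dots> = (g \<circ> F (d * b')) \<circ> h" by (simp add: comp_assoc mult.commute)
  also have "\<dots> = F (b * b') \<circ> (g \<circ> h)" by (simp add: F_intertwine[OF 3(2)] comp_assoc)
  finally have "(g \<circ> h) \<circ> F (d' * d) = F (b * b') \<circ> (g \<circ> h)" .
  moreover have "b * b' \<noteq> 0" using 2 3 by simp
  moreover have "g \<circ> h \<in> \<Gamma>" using g h comp_mem unfolding commensurator_def by blast
  ultimately show "g \<circ> h \<in> commensurator" unfolding commensurator_def by blast
next
  fix g assume g: "g \<in> commensurator"
  obtain b d where 1: "d > 0" "g \<circ> F d = F b \<circ> g" by (rule commensurator_power[OF g], rule that)
  have g': "g \<in> \<Gamma>" using g unfolding commensurator_def by blast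
  note i = isometry_inverse[OF isometry[OF g']]
  have "inv_into UNIV g (F b x) = F d (inv_into UNIV g x)" for x
    using 1(2) i by (metis comp_apply)
  then have "inv_into UNIV g \<circ> F b = F d \<circ> inv_into UNIV g" by (simp add: fun_eq_iff)
  then show "inv_into UNIV g \<in> commensurator"
    unfolding commensurator_def
    by (rule_tac CollectI, rule_tac conjI[OF inv_mem[OF g']], rule_tac exI[of _ d], rule_tac exI[of _ b]) (use 1(1) in simp)
qed

text \<open>By \<open>commensurator_near\<close> each element of the commensurator is
  \<open>F (- i) \<circ> s \<circ> F (- j)\<close> with \<open>s\<close> in a finite set. All but a
  bounded part of the right-hand power can be moved to the left of \<open>s\<close>.\<close>

lemma commensurator_cosets:
  assumes T: "finite T" "T \<subseteq> \<Gamma>" "\<And>x. x \<in> \<Gamma> \<Longrightarrow> \<exists>t\<in>T. inv_into UNIV t \<circ> x \<in> commensurator"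
  obtains U where "finite U" "U \<subseteq> \<Gamma>" "\<And>x. x \<in> \<Gamma> \<Longrightarrow> \<exists>u\<in>U. \<exists>n. x = F n \<circ> u"
proof -
  interpret E: isometry_subgroup commensurator
    by (rule isometry_subgroup.intro) (rule commensurator_subgroup)
  define B where "B = {g \<in> \<Gamma>. dist (a 0) (g (a 0)) \<le> thickness + 10 * C} \<inter> commensurator"
  have "finite B" using finite_balls by (simp add: B_def)
  have F_E: "F n \<in> commensurator" for n
  proof -
    have "F n \<circ> F 1 = F 1 \<circ> F n" by (simp add: fun_eq_iff F_F add.commute)
    then show ?thesis unfolding commensurator_def by (intro CollectI conjI[OF F_mem], intro exI[of _ 1]) simp
  qed
  have "\<exists>d. d > 0 \<and> (\<exists>b. s \<circ> F d = F b \<circ> s)" if "s \<in> B" for s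
  proof -
    have "s \<in> commensurator" using that unfolding B_def by blast
    then show ?thesis by (rule commensurator_power) blast
  qed
  then obtain d where d: "\<And>s. s \<in> B \<Longrightarrow> d s > 0" "\<And>s. s \<in> B \<Longrightarrow> \<exists>b. s \<circ> F (d s) = F b \<circ> s"
    by metis
  define U where "U = (\<Union>s\<in>B. \<Union>t\<in>T. (\<lambda>r. s \<circ> F r \<circ> inv_into UNIV t) ` {0..<d s})"
  show ?thesis
  proof (rule that[of U])
    show "finite U" unfolding U_def using \<open>finite B\<close> T(1) by auto
    show "U \<subseteq> \<Gamma>"
      unfolding U_def B_def using T(2) by (auto intro!: comp_mem F_mem inv_mem)
  next
    fix x assume x: "x \<in> \<Gamma>"
    \<comment> \<open>The covering by left cosets is applied to the inverse of \<open>x\<close>,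
      because this puts the representative on the right: \<open>x\<close> is
      \<open>e \<circ> inv t\<close>.\<close>
    obtain t where t: "t \<in> T" "inv_into UNIV t \<circ> inv_into UNIV x \<in> commensurator"
      using T(3)[OF inv_mem[OF x]] by blast
    define e where "e = x \<circ> t"
    have tG: "t \<in> \<Gamma>" using t T by blast
    note ti = isometry_inverse[OF isometry[OF tG]] and xi = isometry_inverse[OF isometry[OF x]]
    note ei = isometry_inverse[OF E.isometry[OF t(2)]]
    have "inv_into UNIV (inv_into UNIV t \<circ> inv_into UNIV x) y = e y" for y
    proof -
      have "(inv_into UNIV t \<circ> inv_into UNIV x) (e y) = y" by (simp add: e_def ti xi)
      then show ?thesis using ei(2) by metis
    qed
    then have e: "e \<in> commensurator" using E.inv_mem[OF t(2)] by (metis ext)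
    obtain i j where ij: "dist (a 0) ((F i \<circ> e \<circ> F j) (a 0)) \<le> thickness + 10 * C"
      using commensurator_near[OF e] .
    define s where "s = F i \<circ> e \<circ> F j"
    have "s \<in> commensurator" unfolding s_def using E.comp_mem F_E e by blast
    then have s: "s \<in> B" using ij unfolding B_def s_def commensurator_def by blast
    obtain b where b: "s \<circ> F (d s) = F b \<circ> s" using d(2)[OF s] by blast
    define q r where "q = (- j) div d s" and "r = (- j) mod d s"
    have r: "r \<in> {0..<d s}" "- j = d s * q + r" using d(1)[OF s] by (auto simp: q_def r_def)
    have "x y = (F (- i + b * q) \<circ> (s \<circ> F r \<circ> inv_into UNIV t)) y" for y
    proof -
      let ?z = "inv_into UNIV t y"
      have "x y = e ?z" by (simp add: e_def ti)
      also have "\<dots> = F (- i) (s (F (- j) ?z))" by (simp add: s_def F_F F_zero)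
      also have "s (F (- j) ?z) = (s \<circ> F (d s * q)) (F r ?z)" by (simp add: r(2) F_F)
      also have "\<dots> = F (b * q) (s (F r ?z))" by (simp add: F_intertwine[OF b])
      finally show ?thesis by (simp add: F_F)
    qed
    then have "x = F (- i + b * q) \<circ> (s \<circ> F r \<circ> inv_into UNIV t)" by blast
    moreover have "s \<circ> F r \<circ> inv_into UNIV t \<in> U" unfolding U_def using s t r by blast
    ultimately show "\<exists>u\<in>U. \<exists>n. x = F n \<circ> u" by blast
  qed
qed

text \<open>The elements of \<open>U\<close> represent all right cosets of \<open>range F\<close>,
  and \<open>range F\<close> is isomorphic to the integers by \<open>inj_F\<close>.\<close>

lemma elementary_of_finite_cosets:
  assumes "finite U" "U \<subseteq> \<Gamma>" "\<And>x. x \<in> \<Gamma> \<Longrightarrow> \<exists>u\<in>U. \<exists>n. x = F n \<circ> u"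
  shows "elementary_group (isometry_group\<lparr>carrier := \<Gamma>\<rparr>)"
proof -
  let ?G = "isometry_group\<lparr>carrier := \<Gamma>\<rparr>"
  let ?K = "range F"
  have inv_F: "inv_into UNIV (F n) = F (- n)" for n
  proof
    fix y
    have "F n (F (- n) y) = y" by (simp add: F_F F_zero)
    then show "inv_into UNIV (F n) y = F (- n) y"
      using isometry_inverse(2)[OF F_isometry, of n "F (- n) y"] by simp
  qed
  have K: "subgroup ?K isometry_group"
    by (rule subgroup_isometryI) (auto simp: F_isometry inv_F F_zero[symmetric] F_add[symmetric])
  have KG: "subgroup ?K ?G"
    using group.subgroup_incl[OF group_isometry_group K is_subgroup] F_mem by blast
  have coset: "r_coset ?G ?K x = {F m \<circ> x | m. True}" for x
    by (auto simp: r_coset_def isometry_group_simps)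
  have sub: "r_coset ?G ?K x \<in> r_coset ?G ?K ` U" if x: "x \<in> \<Gamma>" for x
  proof -
    obtain u n where u: "u \<in> U" "x = F n \<circ> u" using assms(3)[OF x] by blast
    have "F m \<circ> x = F (m + n) \<circ> u" "F m \<circ> u = F (m - n) \<circ> x" for m
      by (simp_all add: u(2) fun_eq_iff F_F)
    then have "r_coset ?G ?K x = r_coset ?G ?K u" unfolding coset by blast
    then show ?thesis using u by blast
  qed
  have "r_coset ?G ?K ` \<Gamma> \<subseteq> r_coset ?G ?K ` U"
    by (rule image_subsetI) (rule sub)
  then have "finite (r_coset ?G ?K ` \<Gamma>)"
    by (rule finite_subset) (simp add: assms(1))
  moreover have "RCOSETS ?G ?K = r_coset ?G ?K ` \<Gamma>"
    unfolding RCOSETS_def by auto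
  ultimately have fin: "finite (RCOSETS ?G ?K)"
    by simp
  have "F \<in> iso integer_group (?G\<lparr>carrier := ?K\<rparr>)"
    unfolding iso_def hom_def bij_betw_def
    by (auto simp: inj_F isometry_group_simps F_add)
  then have "integer_group \<cong> ?G\<lparr>carrier := ?K\<rparr>" unfolding is_iso_def by blast
  then have "?G\<lparr>carrier := ?K\<rparr> \<cong> integer_group"
    using group.iso_sym[OF group_integer_group] by blast
  then show ?thesis
    unfolding elementary_group_def using KG fin by blast
qed

section \<open>Points that project far along a translate of the axis\<close>

definition far :: "int \<Rightarrow> 'a \<Rightarrow> bool" where
  "far M x \<longleftrightarrow> (\<exists>n\<in>idx x. M \<le> \<bar>n\<bar>)"

lemma far_antimono: "far M x \<Longrightarrow> M' \<le> M \<Longrightarrow> far M' x"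
  unfolding far_def by (meson order_trans)

text \<open>If \<open>x\<close> projects far out, a geodesic from \<open>x\<close> to
  \<open>e (a n2)\<close> passes near some \<open>a m\<close>, because \<open>e (a n2)\<close> has a
  bounded projection. Applying the inverse of \<open>e\<close> gives a point \<open>q\<close> on a
  geodesic from \<open>inv e x\<close> to its nearest point \<open>a n2\<close>, close to the
  inverse image of \<open>a m\<close>. The latter also has a bounded projection, so
  \<open>n2\<close> is bounded.\<close>

lemma not_far_both:
  assumes e: "e \<in> \<Gamma>" "e \<notin> commensurator"
  shows "\<exists>M. \<forall>x. \<not> (far M x \<and> far M (inv_into UNIV e x))"
proof -
  note eI = isometry[OF e(1)]
  have "inv_into UNIV e \<notin> commensurator"
  proof
    assume "inv_into UNIV e \<in> commensurator"
    then have "inv_into UNIV (inv_into UNIV e) \<in> commensurator"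
      using isometry_subgroup.inv_mem[OF isometry_subgroup.intro[OF commensurator_subgroup]] by blast
    then show False using e(2) isometry_groupD(2)[OF eI] by (simp add: inv_inv_eq)
  qed
  then obtain M1 M2 where M1: "\<And>n i. i \<in> idx (e (a n)) \<Longrightarrow> \<bar>i\<bar> \<le> M1"
    and M2: "\<And>n i. i \<in> idx (inv_into UNIV e (a n)) \<Longrightarrow> \<bar>i\<bar> \<le> M2"
    using bounded_projection[OF e] bounded_projection[OF inv_mem[OF e(1)]] by blast
  define M where "M = max M1 M2"
  define M0 where "M0 = M + 2 * gap + \<lceil>k * (C + 4 * thickness) + c\<rceil> + 1"
  have False if x: "far M0 x" "far M0 (inv_into UNIV e x)" for x
  proof -
    obtain n1 n2 where n1: "n1 \<in> idx x" "M0 \<le> \<bar>n1\<bar>" and n2: "n2 \<in> idx (inv_into UNIV e x)" "M0 \<le> \<bar>n2\<bar>"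
      using x unfolding far_def by blast
    have "k * (C + 4 * thickness) + c \<ge> 0" using pos jump_gap_bounds by simp
    then have M0: "M0 \<ge> M + 2 * gap" unfolding M0_def by linarith
    obtain i where i: "i \<in> idx (e (a n2))" using idx_nonempty by blast
    have "\<bar>i\<bar> \<le> M" using M1[OF i] by (simp add: M_def)
    have "\<exists>m. passes x (e (a n2)) (a m) thickness"
    proof (cases "n1 \<ge> 0")
      case True
      then show ?thesis
        using n1 i M0 \<open>\<bar>i\<bar> \<le> M\<close> by (intro exI[of _ "M + gap"] passes_sym[OF passes_between[of i]]) auto
    next
      case False
      then show ?thesis
        using n1 i M0 \<open>\<bar>i\<bar> \<le> M\<close> by (intro exI[of _ "- M - gap"] passes_between[of n1 _ i]) auto
    qed
    then obtain m where m: "passes x (e (a n2)) (a m) thickness" by blast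
    obtain S where S: "geodesic_segment (inv_into UNIV e x) (a n2) S"
      using geodesic unfolding geodesic_space_def by blast
    then have "geodesic_segment x (e (a n2)) (e ` S)"
      using geodesic_segment_image[OF eI S] isometry_inverse[OF eI] by simp
    then obtain q where q: "q \<in> S" "dist (e q) (a m) \<le> thickness"
      using m unfolding passes_def by blast
    have "n2 \<in> idx q" using idx_on_geodesic[OF n2(1) S q(1)] .
    moreover obtain i' where i': "i' \<in> idx (inv_into UNIV e (a m))" using idx_nonempty by blast
    ultimately have "dist (a n2) (a i') \<le> C + 4 * thickness"
      using idx_lipschitz[of n2 q i' "inv_into UNIV e (a m)"] q(2) dist_inverse_isometry(2)[OF eI, of q "a m"]
      by simp
    then have "\<bar>real_of_int n2 - real_of_int i'\<bar> \<le> k * (C + 4 * thickness) + c"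
      by (rule idx_int_diff)
    moreover have "\<bar>i'\<bar> \<le> M" using M2[OF i'] by (simp add: M_def)
    ultimately show False using n2(2) jump_gap_bounds(2) unfolding M0_def by linarith
  qed
  then show ?thesis by blast
qed

end

lemma exists_avoiding_index:
  assumes Q: "finite Q" "card Q < n"
    and disjoint: "\<And>q i j. q \<in> Q \<Longrightarrow> i < n \<Longrightarrow> j < n \<Longrightarrow> i \<noteq> j \<Longrightarrow> \<not> (B i q \<and> B j q)"
  shows "\<exists>i<n::nat. \<forall>q\<in>Q. \<not> B i q"
proof (rule ccontr)
  assume "\<not> ?thesis"
  then obtain f where f: "\<And>i. i < n \<Longrightarrow> f i \<in> Q \<and> B i (f i)" by metis
  have "inj_on f {..<n}"
  proof (rule inj_onI)
    fix i j assume "i \<in> {..<n}" "j \<in> {..<n}" "f i = f j"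
    then show "i = j" using f[of i] f[of j] disjoint[of "f i" i j] by auto
  qed
  moreover have "f ` {..<n} \<subseteq> Q" using f by auto
  ultimately have "card {..<n} \<le> card Q" using Q(1) by (rule card_inj_on_le)
  then show False using Q(2) by simp
qed

locale nonelementary_action = contracting_action +
  assumes nonelementary: "\<not> elementary_group (isometry_group\<lparr>carrier := \<Gamma>\<rparr>)"
begin

text \<open>Not being elementary gives the commensurator infinite index, so
  \<open>not_far_both\<close> applies to all \<open>inv (e i) \<circ> e j\<close>. Any point is then
  far for at most one of the four translates, which leaves a free one whenever at most three points
  are to be avoided.\<close>

lemma four_independent_translates:
  obtains e :: "nat \<Rightarrow> 'a \<Rightarrow> 'a" and M :: int where "\<And>i. i < 4 \<Longrightarrow> e i \<in> \<Gamma>" "M \<ge> 0"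
    "\<And>x i j. i < 4 \<Longrightarrow> j < 4 \<Longrightarrow> i \<noteq> j \<Longrightarrow>
       \<not> (far M (inv_into UNIV (e i) x) \<and> far M (inv_into UNIV (e j) x))"
proof -
  have "\<exists>x\<in>\<Gamma>. \<forall>t\<in>T. inv_into UNIV t \<circ> x \<notin> commensurator" if T: "finite T" "T \<subseteq> \<Gamma>" for T
  proof (rule ccontr)
    assume *: "\<not> ?thesis"
    have cover: "\<exists>t\<in>T. inv_into UNIV t \<circ> x \<in> commensurator" if "x \<in> \<Gamma>" for x using * that by metis
    obtain U where "finite U" "U \<subseteq> \<Gamma>" "\<And>x. x \<in> \<Gamma> \<Longrightarrow> \<exists>u\<in>U. \<exists>n. x = F n \<circ> u"
      by (rule commensurator_cosets[OF T cover], assumption, rule that)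
    then show False using elementary_of_finite_cosets nonelementary by metis
  qed
  moreover have "commensurator \<subseteq> \<Gamma>" unfolding commensurator_def by (rule Collect_restrict)
  ultimately obtain e where e: "\<And>i. i < (4::nat) \<Longrightarrow> e i \<in> \<Gamma>"
    and ne: "\<And>i j C. i < 4 \<Longrightarrow> j < 4 \<Longrightarrow> i \<noteq> j \<Longrightarrow> C \<in> {commensurator} \<Longrightarrow> inv_into UNIV (e i) \<circ> e j \<notin> C"
    using commensurator_subgroup
    by (rule_tac pairwise_inequivalent_isometries[of "{commensurator}" 4]) auto
  have "\<exists>M. \<forall>x. \<not> (far M (inv_into UNIV (e i) x) \<and> far M (inv_into UNIV (e j) x))"
    if ij: "i < 4" "j < 4" "i \<noteq> j" for i j
  proof -
    let ?h = "inv_into UNIV (e i) \<circ> e j"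
    have h: "?h \<in> \<Gamma>" using e ij comp_mem inv_mem by blast
    note ii = isometry_inverse[OF isometry[OF e[OF ij(1)]]]
    note jj = isometry_inverse[OF isometry[OF e[OF ij(2)]]]
    obtain M where M: "\<And>x. \<not> (far M x \<and> far M (inv_into UNIV ?h x))"
      using not_far_both[OF h] ne[OF ij] by blast
    have "inv_into UNIV ?h (inv_into UNIV (e i) x) = inv_into UNIV (e j) x" for x
      using isometry_inverse(2)[OF isometry[OF h], of "inv_into UNIV (e j) x"] jj by simp
    then show ?thesis using M[of "inv_into UNIV (e i) _"] by metis
  qed
  then obtain M where M: "\<And>i j x. i < 4 \<Longrightarrow> j < 4 \<Longrightarrow> i \<noteq> j \<Longrightarrow>
       \<not> (far (M i j) (inv_into UNIV (e i) x) \<and> far (M i j) (inv_into UNIV (e j) x))"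
    by metis
  define M0 where "M0 = Max (insert 0 ((\<lambda>(i, j). M i j) ` ({..<4} \<times> {..<4})))"
  have "0 \<le> M0" unfolding M0_def by (intro Max_ge) auto
  moreover have "M i j \<le> M0" if "i < 4" "j < 4" for i j
    unfolding M0_def using that by (intro Max_ge) auto
  ultimately show ?thesis using e M far_antimono by (intro that[of e M0]) blast+
qed

section \<open>Shadows and how isometries move them\<close>

definition shadow :: "int \<Rightarrow> 'a set" where
  "shadow m = {x. \<forall>n\<in>idx x. m \<le> n}"

lemma shadow_antimono: "m \<le> m' \<Longrightarrow> shadow m' \<subseteq> shadow m"
  unfolding shadow_def by force

lemma F_shadow: "F n x \<in> shadow m \<longleftrightarrow> x \<in> shadow (m - n)"
proof
  assume *: "F n x \<in> shadow m"
  have "m - n \<le> i" if "i \<in> idx x" for i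
  proof -
    have "n + i \<in> idx (F n x)" using that idx_shift by blast
    then show ?thesis using * unfolding shadow_def by fastforce
  qed
  then show "x \<in> shadow (m - n)" unfolding shadow_def by blast
next
  assume *: "x \<in> shadow (m - n)"
  have "m \<le> i" if "i \<in> idx (F n x)" for i
    using that idx_shift[of n "i - n" x] * unfolding shadow_def by fastforce
  then show "F n x \<in> shadow m" unfolding shadow_def by blast
qed

lemma not_far_imp_shadow: "\<not> far M x \<Longrightarrow> x \<in> shadow (- M)"
  unfolding far_def shadow_def by force

text \<open>Each of the two points is far for at most one of four translates. For one of the others
  both points lie in \<open>shadow (- M)\<close>, and \<open>F M\<close> shifts this into
  \<open>shadow 0\<close>.\<close>

lemma two_points_into_shadow:
  obtains T where "finite T" "T \<subseteq> \<Gamma>" "\<And>w z. \<exists>t\<in>T. t w \<in> shadow 0 \<and> t z \<in> shadow 0"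
proof -
  obtain e :: "nat \<Rightarrow> 'a \<Rightarrow> 'a" and M :: int where e: "\<And>i. i < 4 \<Longrightarrow> e i \<in> \<Gamma>"
    and M: "\<And>x i j. i < 4 \<Longrightarrow> j < 4 \<Longrightarrow> i \<noteq> j \<Longrightarrow>
       \<not> (far M (inv_into UNIV (e i) x) \<and> far M (inv_into UNIV (e j) x))"
    by (rule four_independent_translates, rule that)
  let ?t = "\<lambda>i. F M \<circ> inv_into UNIV (e i)"
  show ?thesis
  proof (rule that[of "?t ` {..<4}"])
    show "?t ` {..<4} \<subseteq> \<Gamma>" using e by (auto intro!: comp_mem F_mem inv_mem)
  next
    fix w z :: 'a
    have "card {w, z} < 4" by (simp add: card_insert_if)
    then have "\<exists>i<4. \<forall>q\<in>{w, z}. \<not> far M (inv_into UNIV (e i) q)"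
      using M by (intro exists_avoiding_index) auto
    then obtain i where i: "i < 4" "\<not> far M (inv_into UNIV (e i) w)" "\<not> far M (inv_into UNIV (e i) z)"
      by auto
    then have "?t i w \<in> shadow 0 \<and> ?t i z \<in> shadow 0"
      using not_far_imp_shadow by (simp add: F_shadow)
    then show "\<exists>t\<in>?t ` {..<4}. t w \<in> shadow 0 \<and> t z \<in> shadow 0" using i(1) by blast
  qed simp
qed

text \<open>A point \<open>y\<close> of the orbit deep in the shadow is moved far by \<open>p\<close>. Among four
  independent directions at \<open>y\<close> there is one that does not point to \<open>a 0\<close> and such that
  neither \<open>p y\<close> lies in this direction from \<open>y\<close> nor \<open>y\<close> in the translated
  direction from \<open>p y\<close>. Then a geodesic between a point in this direction and the translate by
  \<open>p\<close> of another one passes near \<open>y\<close>.\<close>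

lemma moved_subshadow:
  obtains D N where "\<And>p l. \<lbrakk>p \<in> carrier isometry_group; l \<in> \<Gamma>; l (a 0) \<in> shadow N;
      dist (p (l (a 0))) (l (a 0)) > D\<rbrakk> \<Longrightarrow>
    \<exists>g\<in>\<Gamma>. g ` shadow 0 \<subseteq> shadow 0 \<and>
      (\<exists>r. \<forall>u\<in>g ` shadow 0. \<forall>v\<in>g ` shadow 0. passes u (p v) (l (a 0)) r)" "N \<ge> 0"
proof -
  obtain e :: "nat \<Rightarrow> 'a \<Rightarrow> 'a" and M :: int where e: "\<And>i. i < 4 \<Longrightarrow> e i \<in> \<Gamma>" and M0: "M \<ge> 0"
    and M: "\<And>x i j. i < 4 \<Longrightarrow> j < 4 \<Longrightarrow> i \<noteq> j \<Longrightarrow>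
       \<not> (far M (inv_into UNIV (e i) x) \<and> far M (inv_into UNIV (e j) x))"
    by (rule four_independent_translates, rule that)
  define \<kappa> where "\<kappa> = Max ((\<lambda>i. dist (e i (a 0)) (a 0)) ` {..<4})"
  have \<kappa>: "dist (e i (a 0)) (a 0) \<le> \<kappa>" if "i < 4" for i
    unfolding \<kappa>_def using that by (intro Max_ge) auto
  \<comment> \<open>\<open>R1\<close> and \<open>R2\<close> are the errors when a geodesic near the
    turning point \<open>z\<close>, respectively near \<open>a gap\<close>, is regarded as passing
    \<open>y\<close>, respectively \<open>a 0\<close>. \<open>N\<close> is so large that a point of
    \<open>shadow N\<close> is farther than \<open>R1 + R2\<close> from \<open>a 0\<close>.\<close>
  define R1 where "R1 = thickness + L * (M + gap) + \<kappa>"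
  define R2 where "R2 = thickness + L * gap"
  define N where "N = max (2 * gap) (\<lceil>k * (C + 4 * (R1 + R2)) + c\<rceil> + 1)"
  have N: "N \<ge> 2 * gap" "real_of_int N > k * (C + 4 * (R1 + R2)) + c"
    unfolding N_def by linarith+
  show ?thesis
  proof (rule that[of N "2 * R1"])
    show "N \<ge> 0" using N(1) jump_gap_bounds by linarith
  next
    fix p l
    assume p: "p \<in> carrier isometry_group" and l: "l \<in> \<Gamma>" and y_deep: "l (a 0) \<in> shadow N"
      and moved: "dist (p (l (a 0))) (l (a 0)) > 2 * R1"
    define y where "y = l (a 0)"
    \<comment> \<open>The third point is needed because the position of \<open>y\<close> relative to
      \<open>p \<circ> h\<close> is that of \<open>inv p y\<close> relative to
      \<open>h\<close>.\<close>
    let ?Q = "inv_into UNIV l ` {a 0, p y, inv_into UNIV p y}"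
    have "card ?Q \<le> card {a 0, p y, inv_into UNIV p y}" by (rule card_image_le) simp
    also have "\<dots> \<le> 3" by (simp add: card_insert_if)
    finally have "card ?Q < 4" by simp
    then have "\<exists>i<4. \<forall>q\<in>?Q. \<not> far M (inv_into UNIV (e i) q)"
      using M by (intro exists_avoiding_index) auto
    then obtain i where i: "i < 4" "\<And>q. q \<in> ?Q \<Longrightarrow> \<not> far M (inv_into UNIV (e i) q)" by blast
    define h where "h = l \<circ> e i"
    have hG: "h \<in> \<Gamma>" unfolding h_def using l e i(1) comp_mem by blast
    note hI = isometry[OF hG]
    have inv_h: "inv_into UNIV h x = inv_into UNIV (e i) (inv_into UNIV l x)" for x
      using isometry_inverse(2)[OF hI, of "inv_into UNIV (e i) (inv_into UNIV l x)"]
        isometry_inverse(1)[OF isometry[OF l]] isometry_inverse(1)[OF isometry[OF e[OF i(1)]]]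
      by (simp add: h_def)
    have low: "\<exists>n\<in>idx (inv_into UNIV h x). n < M" if "x \<in> {a 0, p y, inv_into UNIV p y}" for x
    proof -
      have "inv_into UNIV l x \<in> ?Q" using that by (rule imageI)
      then have nf: "\<not> far M (inv_into UNIV h x)" using i(2) unfolding inv_h by blast
      obtain n where n: "n \<in> idx (inv_into UNIV h x)" using idx_nonempty by blast
      then have "\<bar>n\<bar> < M" using nf unfolding far_def by force
      then show ?thesis using n by (intro bexI[of _ n]) auto
    qed
    define z where "z = h (a (M + gap))"
    have z: "dist z y \<le> L * (M + gap) + \<kappa>"
    proof -
      have "dist z (h (a 0)) \<le> L * (M + gap)"
        using upper[of "M + gap" 0] M0 jump_gap_bounds isometry_groupD(1)[OF hI] by (simp add: z_def)
      moreover have "dist (h (a 0)) y \<le> \<kappa>"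
        using \<kappa>[OF i(1)] isometry_groupD(1)[OF isometry[OF l]] by (simp add: h_def y_def)
      ultimately show ?thesis using dist_triangle[of z y "h (a 0)"] by linarith
    qed
    have zR: "thickness + dist z y \<le> R1" using z by (simp add: R1_def)
    define m where "m = M + 4 * gap"
    define g where "g = h \<circ> F m"
    have gG: "g \<in> \<Gamma>" unfolding g_def using hG F_mem comp_mem by blast
    have deep: "inv_into UNIV h u \<in> shadow m" if "u \<in> g ` shadow 0" for u
      using that isometry_inverse(2)[OF hI] by (auto simp: g_def F_shadow)
    have between: "passes x u (\<phi> (h (a (M + gap)))) thickness"
      if \<phi>: "\<phi> \<in> carrier isometry_group" and n: "n \<in> idx (inv_into UNIV h (inv_into UNIV \<phi> x))" "n < M"
        and n': "n' \<in> idx (inv_into UNIV h (inv_into UNIV \<phi> u))" "n' \<ge> M + 2 * gap" for \<phi> x u n n'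
    proof -
      have "passes (inv_into UNIV h (inv_into UNIV \<phi> x)) (inv_into UNIV h (inv_into UNIV \<phi> u)) (a (M + gap)) thickness"
        using n n' by (intro passes_between) auto
      then have "passes (\<phi> (h (inv_into UNIV h (inv_into UNIV \<phi> x)))) (\<phi> (h (inv_into UNIV h (inv_into UNIV \<phi> u))))
        (\<phi> (h (a (M + gap)))) thickness"
        by (intro passes_image[OF \<phi>] passes_image[OF hI])
      then show ?thesis using isometry_inverse(1)[OF hI] isometry_inverse(1)[OF \<phi>] by simp
    qed
    have idI: "id \<in> carrier isometry_group" by (rule isometries.id_mem)
    have gap1: "gap \<ge> 1" by (rule jump_gap_bounds)

    \<comment> \<open>If \<open>u\<close> were outside, \<open>y\<close> would be coarsely between
      \<open>a 0\<close> and \<open>u\<close>, and \<open>a 0\<close> between \<open>u\<close> and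
      \<open>y\<close>, so \<open>y\<close> would be too close to \<open>a 0\<close>.\<close>
    have "u \<in> shadow 0" if u: "u \<in> g ` shadow 0" for u
    proof (rule ccontr)
      assume "u \<notin> shadow 0"
      then obtain j where j: "j \<in> idx u" "j < 0" unfolding shadow_def by auto
      obtain n where n: "n \<in> idx y" using idx_nonempty by blast
      then have nN: "N \<le> n" using y_deep unfolding shadow_def y_def by blast
      obtain n1 where n1: "n1 \<in> idx (inv_into UNIV h (a 0))" "n1 < M" using low by blast
      obtain n2 where n2: "n2 \<in> idx (inv_into UNIV h u)" using idx_nonempty by blast
      have "n2 \<ge> M + 2 * gap" using deep[OF u] n2 gap1 unfolding shadow_def m_def by force
      then have "passes (a 0) u z thickness"
        using between[OF idI, of n1 "a 0" n2 u] n1 n2 by (simp add: z_def)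
      then have 1: "passes (a 0) u y R1" by (rule passes_weaken) (rule zR)
      have "passes u y (a gap) thickness"
        using j n nN N(1) gap1 by (intro passes_between[of j u n y]) auto
      then have 2: "passes u y (a 0) R2"
        by (rule passes_weaken) (use upper[of gap 0] gap1 in \<open>simp add: R2_def\<close>)
      have d: "dist (a 0) y \<le> R1 + R2"
        using passes_dist_sum[OF geodesic 1] passes_dist_sum[OF geodesic 2] by (simp add: dist_commute)
      have "dist (a 0) (a n) \<le> C + 4 * dist (a 0) y" using idx_lipschitz[OF idx_self n] .
      also have "\<dots> \<le> C + 4 * (R1 + R2)" using d by (intro add_left_mono mult_left_mono) simp_all
      finally have "dist (a 0) (a n) \<le> C + 4 * (R1 + R2)" .
      then have "\<bar>real_of_int 0 - real_of_int n\<bar> \<le> k * (C + 4 * (R1 + R2)) + c" by (rule idx_int_diff)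
      then show False using nN N(2) by linarith
    qed
    moreover have "passes u (p v) y (thickness + dist (h (a (M + 3 * gap))) y)"
      if u: "u \<in> g ` shadow 0" and v: "v \<in> g ` shadow 0" for u v
    proof -
      obtain j where j: "j \<in> idx (inv_into UNIV h (p v))" using idx_nonempty by blast
      \<comment> \<open>If \<open>p v\<close> lay in the chosen direction, \<open>y\<close> would be
        coarsely between \<open>p y\<close> and \<open>p v\<close>, and \<open>p y\<close> between
        \<open>y\<close> and \<open>p v\<close>. This bounds the displacement of \<open>y\<close> by
        \<open>2 * R1\<close>.\<close>
      have "j < M + 2 * gap"
      proof (rule ccontr)
        assume "\<not> ?thesis"
        then have j': "j \<ge> M + 2 * gap" by simp
        obtain n2 where n2: "n2 \<in> idx (inv_into UNIV h (p y))" "n2 < M" using low by blast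
        obtain n3 where n3: "n3 \<in> idx (inv_into UNIV h (inv_into UNIV p y))" "n3 < M" using low by blast
        have "passes (p y) (p v) z thickness"
          using between[OF idI, of n2 "p y" j "p v"] n2 j j' by (simp add: z_def)
        then have 1: "passes (p y) (p v) y R1" by (rule passes_weaken) (rule zR)
        obtain n4 where n4: "n4 \<in> idx (inv_into UNIV h v)" using idx_nonempty by blast
        have "n4 \<ge> M + 2 * gap" using deep[OF v] n4 gap1 unfolding shadow_def m_def by force
        then have "passes y (p v) (p z) thickness"
          using between[OF p, of n3 y n4 "p v"] n3 n4 by (simp add: z_def isometry_inverse[OF p])
        then have 2: "passes y (p v) (p y) R1"
          by (rule passes_weaken) (use zR isometry_groupD(1)[OF p] in simp)
        show False
          using passes_dist_sum[OF geodesic 1] passes_dist_sum[OF geodesic 2] moved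
          by (simp add: dist_commute y_def)
      qed
      obtain n where n: "n \<in> idx (inv_into UNIV h u)" using idx_nonempty by blast
      then have "n \<ge> m" using deep[OF u] unfolding shadow_def by blast
      then have "passes (inv_into UNIV h (p v)) (inv_into UNIV h u) (a (M + 3 * gap)) thickness"
        using j n \<open>j < M + 2 * gap\<close> by (intro passes_between) (auto simp: m_def)
      then have "passes (h (inv_into UNIV h (p v))) (h (inv_into UNIV h u)) (h (a (M + 3 * gap))) thickness"
        by (rule passes_image[OF hI])
      then have "passes u (p v) (h (a (M + 3 * gap))) thickness"
        using isometry_inverse(1)[OF hI] passes_sym by simp
      then show ?thesis by (rule passes_weaken) simp
    qed
    ultimately show "\<exists>g\<in>\<Gamma>. g ` shadow 0 \<subseteq> shadow 0 \<and>
      (\<exists>r. \<forall>u\<in>g ` shadow 0. \<forall>v\<in>g ` shadow 0. passes u (p v) (l (a 0)) r)"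
      using gG unfolding y_def by blast
  qed
qed

text \<open>Moving \<open>W\<close> off itself is expressed by geodesics from \<open>W\<close> to
  its image passing near the base point, as the turning argument requires. Both alternatives are
  inherited by subsets, so that several isometries can be treated in turn.\<close>

definition moves_or_fixes :: "('a \<Rightarrow> 'a) \<Rightarrow> 'a set \<Rightarrow> real \<Rightarrow> bool" where
  "moves_or_fixes p W r \<longleftrightarrow> (\<forall>u\<in>W. \<forall>v\<in>W. passes u (p v) (a 0) r) \<or>
     (\<forall>h\<in>\<Gamma>. h (a 0) \<in> W \<longrightarrow> dist (p (h (a 0))) (h (a 0)) \<le> r)"

lemma moves_or_fixes_weaken:
  assumes "moves_or_fixes p W r" "W' \<subseteq> W" "r \<le> r'"
  shows "moves_or_fixes p W' r'"
proof -
  have "passes u (p v) (a 0) r'" if "passes u (p v) (a 0) r" for u v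
    by (rule passes_weaken[OF that]) (use assms(3) in simp)
  then show ?thesis
    using assms unfolding moves_or_fixes_def by (meson order_trans subsetD)
qed

text \<open>If \<open>p\<close> displaces some orbit point in \<open>shadow N\<close> by more than
  \<open>D\<close>, then \<open>moved_subshadow\<close> gives the first alternative; if not, the
  second one holds on a translate inside \<open>shadow N\<close>.\<close>

lemma moves_or_fixes_subshadow:
  assumes p: "p \<in> carrier isometry_group"
  shows "\<exists>g\<in>\<Gamma>. g ` shadow 0 \<subseteq> shadow 0 \<and> (\<exists>r. moves_or_fixes p (g ` shadow 0) r)"
proof -
  obtain D N where D: "\<And>p l. \<lbrakk>p \<in> carrier isometry_group; l \<in> \<Gamma>; l (a 0) \<in> shadow N;
      dist (p (l (a 0))) (l (a 0)) > D\<rbrakk> \<Longrightarrow>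
    \<exists>g\<in>\<Gamma>. g ` shadow 0 \<subseteq> shadow 0 \<and>
      (\<exists>r. \<forall>u\<in>g ` shadow 0. \<forall>v\<in>g ` shadow 0. passes u (p v) (l (a 0)) r)" and N: "N \<ge> 0"
    by (rule moved_subshadow, rule that)
  show ?thesis
  proof (cases "\<forall>l\<in>\<Gamma>. l (a 0) \<in> shadow N \<longrightarrow> dist (p (l (a 0))) (l (a 0)) \<le> D")
    case True
    have FN: "F N ` shadow 0 \<subseteq> shadow N" by (auto simp: F_shadow)
    then have "moves_or_fixes p (F N ` shadow 0) D"
      using True unfolding moves_or_fixes_def by blast
    then show ?thesis using F_mem FN shadow_antimono[OF N] by blast
  next
    case False
    then obtain l where l: "l \<in> \<Gamma>" "l (a 0) \<in> shadow N" "dist (p (l (a 0))) (l (a 0)) > D"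
      by (meson not_le)
    then obtain g r where g: "g \<in> \<Gamma>" "g ` shadow 0 \<subseteq> shadow 0"
      and r: "\<And>u v. u \<in> g ` shadow 0 \<Longrightarrow> v \<in> g ` shadow 0 \<Longrightarrow> passes u (p v) (l (a 0)) r"
      using D[OF p l] by blast
    have "passes u (p v) (a 0) (r + dist (l (a 0)) (a 0))"
      if "u \<in> g ` shadow 0" "v \<in> g ` shadow 0" for u v
      by (rule passes_weaken[OF r[OF that]]) simp
    then show ?thesis using g unfolding moves_or_fixes_def by blast
  qed
qed

lemma moves_or_fixes_translate:
  assumes g: "g \<in> \<Gamma>" and p: "p \<in> carrier isometry_group"
    and r: "moves_or_fixes (inv_into UNIV g \<circ> p \<circ> g) W r"
  shows "moves_or_fixes p (g ` W) (r + dist (g (a 0)) (a 0))"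
proof -
  note gI = isometry[OF g] and gi = isometry_inverse[OF isometry[OF g]]
  let ?q = "inv_into UNIV g \<circ> p \<circ> g"
  from r consider "\<forall>u\<in>W. \<forall>v\<in>W. passes u (?q v) (a 0) r"
    | "\<forall>h\<in>\<Gamma>. h (a 0) \<in> W \<longrightarrow> dist (?q (h (a 0))) (h (a 0)) \<le> r"
    unfolding moves_or_fixes_def by blast
  then show ?thesis
  proof cases
    case 1
    have "passes (g u) (p (g v)) (a 0) (r + dist (g (a 0)) (a 0))" if "u \<in> W" "v \<in> W" for u v
    proof -
      have "passes (g u) (g (?q v)) (g (a 0)) r"
        by (rule passes_image[OF gI]) (use 1 that in blast)
      then have "passes (g u) (p (g v)) (g (a 0)) r" by (simp add: gi)
      then show ?thesis by (rule passes_weaken) simp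
    qed
    then show ?thesis unfolding moves_or_fixes_def by blast
  next
    case 2
    have "dist (p (h (a 0))) (h (a 0)) \<le> r" if h: "h \<in> \<Gamma>" "h (a 0) \<in> g ` W" for h
    proof -
      let ?h = "inv_into UNIV g \<circ> h"
      have "?h \<in> \<Gamma>" using g h comp_mem inv_mem by blast
      moreover have "?h (a 0) \<in> W" using h(2) gi by auto
      ultimately have "dist (?q (?h (a 0))) (?h (a 0)) \<le> r" using 2 by blast
      then show ?thesis
        by (simp add: gi isometry_groupD(1)[OF isometries.inv_mem[OF gI]])
    qed
    then show ?thesis unfolding moves_or_fixes_def
      by (metis add_increasing2 zero_le_dist)
  qed
qed

text \<open>By induction: for a new \<open>p\<close>, the conjugate
  \<open>inv g \<circ> p \<circ> g\<close> is treated inside \<open>shadow 0\<close>, and applying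
  \<open>g\<close> gives a smaller shadow inside the previous one.\<close>

lemma common_shadow:
  assumes "finite P" "P \<subseteq> carrier isometry_group"
  shows "\<exists>g\<in>\<Gamma>. \<exists>r. \<forall>p\<in>P. moves_or_fixes p (g ` shadow 0) r"
  using assms
proof (induction P rule: finite_induct)
  case empty
  then show ?case using id_mem by blast
next
  case (insert p P)
  obtain g r where g: "g \<in> \<Gamma>" and r: "\<And>q. q \<in> P \<Longrightarrow> moves_or_fixes q (g ` shadow 0) r"
    using insert by auto
  have p: "p \<in> carrier isometry_group" using insert.prems by blast
  have "inv_into UNIV g \<circ> p \<circ> g \<in> carrier isometry_group"
    by (intro isometries.comp_mem isometries.inv_mem isometry[OF g] p)
  then obtain g' r' where g': "g' \<in> \<Gamma>" "g' ` shadow 0 \<subseteq> shadow 0"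
    and r': "moves_or_fixes (inv_into UNIV g \<circ> p \<circ> g) (g' ` shadow 0) r'"
    using moves_or_fixes_subshadow by blast
  have eq: "(g \<circ> g') ` shadow 0 = g ` g' ` shadow 0" by (simp add: image_comp)
  define r'' where "r'' = max r (r' + dist (g (a 0)) (a 0))"
  have "moves_or_fixes q ((g \<circ> g') ` shadow 0) r''" if "q \<in> insert p P" for q
  proof (cases "q = p")
    case True
    show ?thesis
      unfolding True eq using moves_or_fixes_translate[OF g p r']
      by (rule moves_or_fixes_weaken) (simp_all add: r''_def)
  next
    case False
    then have "q \<in> P" using that by blast
    then show ?thesis
      unfolding eq using g'(2) by (intro moves_or_fixes_weaken[OF r]) (auto simp: r''_def)
  qed
  then show ?case using comp_mem[OF g g'(1)] by blast
qed

end

section \<open>Discrete groups of isometries\<close>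

text \<open>By induction over the generation of the topology. For a subbasic set containing
  \<open>id\<close>, the compact set \<open>K\<close> lies in \<open>U\<close> together with a
  uniform neighbourhood.\<close>

lemma compact_open_neighbourhood_id:
  assumes "openin (compact_open_topology :: ('a::metric_space \<Rightarrow> 'a) topology) T" "id \<in> T"
  shows "\<exists>K \<epsilon>. compact K \<and> \<epsilon> > 0 \<and> (\<forall>g. (\<forall>x\<in>K. dist (g x) x < \<epsilon>) \<longrightarrow> g \<in> T)"
proof -
  have "generate_topology_on {{f :: 'a \<Rightarrow> 'a. f ` K \<subseteq> U} | K U. compact K \<and> open U} T"
    using assms(1) unfolding compact_open_topology_def openin_topology_generated_by_iff .
  then show ?thesis using assms(2)
  proof induction
    case (Int S T)
    then obtain K \<epsilon> K' \<epsilon>' where "compact K" "\<epsilon> > 0" "\<And>g. (\<forall>x\<in>K. dist (g x) x < \<epsilon>) \<Longrightarrow> g \<in> S"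
      "compact K'" "\<epsilon>' > 0" "\<And>g. (\<forall>x\<in>K'. dist (g x) x < \<epsilon>') \<Longrightarrow> g \<in> T"
      by auto
    then show ?case
      by (intro exI[of _ "K \<union> K'"] exI[of _ "min \<epsilon> \<epsilon>'"]) (simp add: compact_Un)
  next
    case (UN \<K>)
    then obtain S where S: "S \<in> \<K>" "id \<in> S" by blast
    then obtain K \<epsilon> where "compact K" "\<epsilon> > 0" "\<And>g. (\<forall>x\<in>K. dist (g x) x < \<epsilon>) \<Longrightarrow> g \<in> S"
      using UN.IH[OF S] by blast
    then show ?case using S(1) by (intro exI[of _ K] exI[of _ \<epsilon>]) auto
  next
    case (Basis T)
    then obtain K U where T: "T = {f. f ` K \<subseteq> U}" "compact K" "open U" by blast
    then have "K \<subseteq> U" using Basis.prems by auto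
    then obtain \<epsilon> where \<epsilon>: "\<epsilon> > 0" "(\<Union>x\<in>K. ball x \<epsilon>) \<subseteq> U"
      using compact_subset_open_imp_ball_epsilon_subset[OF T(2,3)] by blast
    have "g \<in> T" if g: "\<forall>x\<in>K. dist (g x) x < \<epsilon>" for g
    proof -
      have "g x \<in> U" if "x \<in> K" for x
        using \<epsilon>(2) g that by (force simp: dist_commute)
      then show ?thesis unfolding T(1) by blast
    qed
    then show ?case using T(2) \<epsilon>(1) by blast
  qed simp
qed

text \<open>Two elements of the group that move the points of a sufficiently fine net almost in the
  same way coincide by discreteness.\<close>

lemma discrete_subgroup_finite_balls:
  fixes x :: "'a::metric_space"
  assumes proper: "proper_space TYPE('a)" and H: "discrete_subgroup H"
  shows "finite {h \<in> H. dist x (h x) \<le> r}"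
proof -
  interpret isometry_subgroup H
    using H by (intro isometry_subgroup.intro) (simp add: discrete_subgroup_def)
  have "openin (subtopology compact_open_topology H) {id}"
    using H id_mem by (simp add: discrete_subgroup_def)
  then obtain T where openT: "openin compact_open_topology T" and T: "{id} = T \<inter> H"
    unfolding openin_subtopology by blast
  have "id \<in> T" using T by blast
  with openT obtain K \<epsilon> where K: "compact K" "\<epsilon> > 0" "\<And>g. (\<forall>x\<in>K. dist (g x) x < \<epsilon>) \<Longrightarrow> g \<in> T"
    using compact_open_neighbourhood_id[OF openT] by auto
  have net: "\<exists>k. finite k \<and> S \<subseteq> (\<Union>x\<in>k. ball x \<delta>)" if "compact S" "\<delta> > 0" for S :: "'a set" and \<delta>
    using that unfolding compact_eq_totally_bounded by blast
  obtain N where N: "finite N" "K \<subseteq> (\<Union>y\<in>N. ball y (\<epsilon> / 4))"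
    using net[OF K(1), of "\<epsilon> / 4"] K(2) by auto
  have "\<exists>M. finite M \<and> cball x (r + 2 * dist x y) \<subseteq> (\<Union>z\<in>M. ball z (\<epsilon> / 8))" for y
  proof (rule net)
    show "compact (cball x (r + 2 * dist x y))" using proper by (simp add: proper_space_def)
  qed (use K(2) in simp)
  then obtain M where M: "\<And>y. finite (M y)" "\<And>y. cball x (r + 2 * dist x y) \<subseteq> (\<Union>z\<in>M y. ball z (\<epsilon> / 8))"
    by metis
  let ?B = "{h \<in> H. dist x (h x) \<le> r}"
  have "\<exists>z\<in>M y. dist (h y) z < \<epsilon> / 8" if h: "h \<in> ?B" for h y
  proof -
    have "dist (h x) (h y) = dist x y" using h isometry isometry_groupD(1) by blast
    then have "h y \<in> cball x (r + 2 * dist x y)"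
      using h dist_triangle[of x "h y" "h x"] zero_le_dist[of x y] by (simp del: zero_le_dist)
    then have "h y \<in> (\<Union>z\<in>M y. ball z (\<epsilon> / 8))" using M(2)[of y] by blast
    then show ?thesis by (auto simp: dist_commute)
  qed
  then have ex: "\<exists>z. z \<in> M y \<and> dist (h y) z < \<epsilon> / 8" if "h \<in> ?B" for h y
    using that by blast
  \<comment> \<open>\<open>m h y\<close> rounds \<open>h y\<close> to a point of the finite net
    \<open>M y\<close>, so its restriction to \<open>N\<close> takes finitely many values. Elements
    with the same restriction differ by less than \<open>\<epsilon>\<close> on \<open>K\<close>:
    \<open>\<epsilon> / 4\<close> at a net point \<open>y\<close> and twice
    \<open>\<epsilon> / 4\<close> for passing to \<open>y\<close>.\<close>
  define m where "m h y = (SOME z. z \<in> M y \<and> dist (h y) z < \<epsilon> / 8)" for h y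
  have m: "m h y \<in> M y" "dist (h y) (m h y) < \<epsilon> / 8" if "h \<in> ?B" for h y
    using someI_ex[OF ex[OF that, of y]] unfolding m_def by auto
  have "inj_on (\<lambda>h. restrict (m h) N) ?B"
  proof (rule inj_onI)
    fix g h assume g: "g \<in> ?B" and h: "h \<in> ?B" and eq: "restrict (m g) N = restrict (m h) N"
    have gI: "g \<in> carrier isometry_group" and hI: "h \<in> carrier isometry_group"
      using g h isometry by auto
    have "dist ((inv_into UNIV g \<circ> h) z) z < \<epsilon>" if "z \<in> K" for z
    proof -
      obtain y where y: "y \<in> N" "dist y z < \<epsilon> / 4" using N(2) \<open>z \<in> K\<close> by auto
      have "m g y = m h y" using eq y(1) by (metis restrict_apply')
      then have "dist (g y) (h y) < \<epsilon> / 4"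
        using m(2)[OF g, of y] m(2)[OF h, of y] dist_triangle2[of "g y" "h y" "m h y"] by simp
      moreover have "dist (h z) (h y) < \<epsilon> / 4" "dist (g z) (g y) < \<epsilon> / 4"
        using y(2) by (simp_all add: isometry_groupD(1)[OF gI] isometry_groupD(1)[OF hI] dist_commute)
      ultimately have "dist (h z) (g z) < \<epsilon>"
        using dist_triangle[of "h z" "g z" "h y"] dist_triangle[of "h y" "g z" "g y"] K(2)
        by (simp add: dist_commute)
      then show ?thesis by (simp add: dist_inverse_isometry(1)[OF gI])
    qed
    then have "inv_into UNIV g \<circ> h \<in> T \<inter> H" using K(3) g h comp_mem inv_mem by blast
    then have "inv_into UNIV g \<circ> h = id" using T by blast
    then have "inv_into UNIV g (h y) = y" for y by (metis comp_apply id_apply)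
    then have "h y = g y" for y using isometry_inverse(1)[OF gI] by metis
    then show "g = h" by auto
  qed
  moreover have "(\<lambda>h. restrict (m h) N) ` ?B \<subseteq> PiE N M" using m(1) by auto
  moreover have "finite (PiE N M)" using N(1) M(1) by (intro finite_PiE) auto
  ultimately show ?thesis by (meson finite_imageD finite_subset)
qed

section \<open>Isometries with bounded displacement on the orbit\<close>

context convergence_boundary
begin

lemma embedding_continuous: "continuous_on UNIV \<iota>"
  using embedding homeomorphism_cont1 by blast

lemma act_continuous: "g \<in> carrier isometry_group \<Longrightarrow> continuous_on UNIV (act g)"
  using act_homeomorphism homeomorphism_cont1 by blast

lemma act_tendsto:
  assumes "g \<in> carrier isometry_group" "u \<longlonglongrightarrow> \<xi>"
  shows "(\<lambda>n. act g (u n)) \<longlonglongrightarrow> act g \<xi>"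
  using act_continuous[OF assms(1)] assms(2)
  by (simp add: continuous_on_eq_continuous_at continuous_at_sequentially isCont_tendsto_compose)

text \<open>The identity holds on the image of \<open>\<iota>\<close>, which is dense, and both
  sides are continuous.\<close>

lemma act_inverse:
  assumes g: "g \<in> carrier isometry_group"
  shows "act g (act (inv_into UNIV g) b) = b"
proof -
  note g' = isometries.inv_mem[OF g]
  have "closed {b. act g (act (inv_into UNIV g) b) = b}"
    by (intro closed_Collect_eq continuous_on_compose2[OF act_continuous[OF g] act_continuous[OF g']]
        continuous_on_id) auto
  moreover have "range \<iota> \<subseteq> {b. act g (act (inv_into UNIV g) b) = b}"
    using g g' by (auto simp: act_extends isometry_inverse[OF g])
  ultimately have "closure (range \<iota>) \<subseteq> {b. act g (act (inv_into UNIV g) b) = b}"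
    by (rule closure_minimal[rotated])
  then show ?thesis using dense_image by auto
qed

text \<open>Otherwise a subsequence would stay in a compact ball and have a limit in the space
  itself.\<close>

lemma boundary_limit_at_infinity:
  assumes proper: "proper_space TYPE('a)"
    and lim: "(\<lambda>n. \<iota> (y n)) \<longlonglongrightarrow> \<xi>" "\<xi> \<in> boundary \<iota>"
  shows "filterlim (\<lambda>n. dist x (y n)) at_top sequentially"
proof (rule ccontr)
  assume "\<not> ?thesis"
  then obtain Z where "\<not> eventually (\<lambda>n. Z \<le> dist x (y n)) sequentially"
    unfolding filterlim_at_top by blast
  then have inf: "infinite {n. dist x (y n) < Z}"
    by (auto simp: eventually_sequentially infinite_nat_iff_unbounded_le not_le)
  then obtain r where r: "strict_mono r" "\<And>n::nat. r n \<in> {n. dist x (y n) < Z}"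
    using infinite_enumerate by blast
  have "compact (cball x Z)" using proper by (simp add: proper_space_def)
  moreover have "\<forall>n. (y \<circ> r) n \<in> cball x Z" using r(2) by (auto intro: less_imp_le)
  ultimately obtain l s where s: "strict_mono s" "((y \<circ> r) \<circ> s) \<longlonglongrightarrow> l"
    unfolding compact_eq_seq_compact_metric by (rule seq_compactE)
  have "(\<lambda>n. \<iota> (((y \<circ> r) \<circ> s) n)) \<longlonglongrightarrow> \<iota> l"
    using isCont_tendsto_compose[OF _ s(2), of \<iota>] embedding_continuous
    by (simp add: continuous_on_eq_continuous_at)
  moreover have "((\<lambda>n. \<iota> (y n)) \<circ> (r \<circ> s)) \<longlonglongrightarrow> \<xi>"
    using lim(1) strict_mono_o[OF r(1) s(1)] by (rule LIMSEQ_subseq_LIMSEQ)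
  ultimately have "\<xi> = \<iota> l" by (intro LIMSEQ_unique[of _ \<xi>]) (simp_all add: comp_def)
  then show False using lim(2) by (simp add: boundary_def)
qed

text \<open>The pairs \<open>{y n, p (y n)}\<close> are uniformly contracting quasi-geodesics that
  escape, and each lies in its own cone. So both of its points tend to the same class along a
  subsequence.\<close>

lemma bounded_displacement_limit:
  assumes proper: "proper_space TYPE('a)" and geodesic: "geodesic_space TYPE('a)"
    and p: "p \<in> carrier isometry_group" and D: "\<And>n. dist (p (y n)) (y n) \<le> D"
    and lim: "(\<lambda>n. \<iota> (y n)) \<longlonglongrightarrow> \<xi>" "\<xi> \<in> boundary \<iota>"
  shows "(\<xi>, act p \<xi>) \<in> R"
proof -
  define Z where "Z n = {y n, p (y n)}" for n
  have D0: "D \<ge> 0" using D[of 0] zero_le_dist order_trans by blast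
  have qg: "quasi_geodesic (Z n)" for n
  proof -
    \<comment> \<open>A discontinuous parametrization by an interval is allowed, since the additive
      constant absorbs the jump.\<close>
    define q where "q t = (if t = (0::real) then y n else p (y n))" for t
    have "\<bar>s - t\<bar> / 1 - (D + 1) \<le> dist (q s) (q t) \<and> dist (q s) (q t) \<le> 1 * \<bar>s - t\<bar> + (D + 1)"
      if "s \<in> {0..1}" "t \<in> {0..1}" for s t
    proof -
      have "0 \<le> dist (q s) (q t)" "dist (q s) (q t) \<le> D" "\<bar>s - t\<bar> \<le> 1"
        using D[of n] D0 that by (auto simp: q_def dist_commute)
      then show ?thesis using D0 unfolding div_by_1 mult_1 by linarith
    qed
    then have "quasi_isometric_embedding_on {0..1} q"
      unfolding quasi_isometric_embedding_on_def
      by (rule_tac exI[of _ 1], rule_tac conjI[OF order_refl], rule_tac exI[of _ "D + 1"]) (use D0 in simp)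
    moreover have "Z n = q ` {0..1}" by (force simp: Z_def q_def image_iff)
    ultimately show ?thesis
      unfolding quasi_geodesic_def by (intro exI[of _ "{0..1}"] exI[of _ q]) (simp add: is_interval_cc)
  qed
  \<comment> \<open>A closed set in which all distances are at most \<open>D\<close> is
    \<open>D\<close>-contracting, whatever the projections are.\<close>
  have ct: "contracting D (Z n)" for n
    unfolding contracting_def
  proof (intro conjI allI impI)
    show "closed (Z n)" by (simp add: Z_def)
    fix u v
    show "diameter (nearest_point_proj (Z n) u \<union> nearest_point_proj (Z n) v) \<le> D"
    proof (cases "nearest_point_proj (Z n) u \<union> nearest_point_proj (Z n) v = {}")
      case False
      have "dist z z' \<le> D" if "z \<in> Z n" "z' \<in> Z n" for z z'
        using that D[of n] D0 by (auto simp: Z_def dist_commute)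
      then show ?thesis
        using False unfolding diameter_def by (auto intro!: cSUP_least simp: nearest_point_proj_def)
    qed (simp add: diameter_def D0)
  qed
  have esc: "escaping Z"
    unfolding escaping_def
  proof
    fix x
    have "filterlim (\<lambda>n. - D + dist x (y n)) at_top sequentially"
      by (intro filterlim_tendsto_add_at_top[OF tendsto_const] boundary_limit_at_infinity[OF proper lim])
    moreover have "- D + dist x (y n) \<le> infdist x (Z n)" for n
    proof -
      have "- D + dist x (y n) \<le> dist x z" if "z \<in> Z n" for z
        using that D[of n] D0 dist_triangle[of x "y n" "p (y n)"] by (auto simp: Z_def)
      moreover have "Z n \<noteq> {}" by (simp add: Z_def)
      ultimately have "- D + dist x (y n) \<le> (INF z\<in>Z n. dist x z)" by (intro cINF_greatest)
      then show ?thesis using \<open>Z n \<noteq> {}\<close> by (simp add: infdist_def)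
    qed
    ultimately show "filterlim (\<lambda>n. infdist x (Z n)) at_top sequentially"
      by (elim filterlim_at_top_mono) (simp add: always_eventually)
  qed
  have "\<exists>r. strict_mono r \<and> (\<exists>\<eta>\<in>boundary \<iota>. \<forall>z. (\<forall>n. z n \<in> cone (y 0) (Z (r n))) \<longrightarrow>
      accumulation_points (\<lambda>n. \<iota> (z n)) \<subseteq> R `` {\<eta>})"
    by (rule escaping_cones[OF conjI[OF qg ct] esc])
  then obtain r \<eta> where r: "strict_mono r" and \<eta>: "\<eta> \<in> boundary \<iota>"
    and acc: "\<forall>z. (\<forall>n. z n \<in> cone (y 0) (Z (r n))) \<longrightarrow> accumulation_points (\<lambda>n. \<iota> (z n)) \<subseteq> R `` {\<eta>}"
    by (elim exE conjE bexE) (rule that)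
  have cone: "z \<in> cone (y 0) (Z n)" if z: "z \<in> Z n" for z n
  proof -
    obtain S where S: "geodesic_segment (y 0) z S" using geodesic unfolding geodesic_space_def by blast
    then obtain \<gamma> where "\<gamma> (dist (y 0) z) = z" "S = \<gamma> ` {0..dist (y 0) z}"
      unfolding geodesic_segment_def by (elim exE conjE) (rule that)
    then have "z \<in> S" by (metis atLeastAtMost_iff image_eqI order_refl zero_le_dist)
    then show ?thesis using S z unfolding cone_def by blast
  qed
  have acc_lim: "l \<in> R `` {\<eta>}" if "(\<lambda>n. \<iota> (z n)) \<longlonglongrightarrow> l" "\<And>n. z n \<in> Z (r n)" for z l
  proof -
    have "l \<in> accumulation_points (\<lambda>n. \<iota> (z n))"
      unfolding accumulation_points_def using that(1)
      by (intro CollectI exI[of _ id]) (simp add: strict_mono_id)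
    then show ?thesis using acc[rule_format, of z] cone that(2) by blast
  qed
  have 1: "(\<lambda>n. \<iota> (y (r n))) \<longlonglongrightarrow> \<xi>"
    using LIMSEQ_subseq_LIMSEQ[OF lim(1) r] by (simp add: comp_def)
  then have 2: "(\<lambda>n. \<iota> (p (y (r n)))) \<longlonglongrightarrow> act p \<xi>"
    using act_tendsto[OF p 1] by (simp add: act_extends[OF p])
  have "(\<eta>, \<xi>) \<in> R" "(\<eta>, act p \<xi>) \<in> R"
    using acc_lim[OF 1] acc_lim[OF 2] by (auto simp: Z_def)
  then show ?thesis
    using partition by (meson equivE symE transE)
qed

text \<open>\<open>bounded_displacement_limit\<close> handles limit points of the orbit, and
  invariance of the partition the rest of their classes. The inverse of \<open>p\<close> has the
  same displacement bound, which turns the inclusion of classes into equality.\<close>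

lemma bounded_displacement_elliptic_radical:
  assumes proper: "proper_space TYPE('a)" and geodesic: "geodesic_space TYPE('a)"
    and p: "p \<in> carrier isometry_group"
    and D: "\<And>g. g \<in> G \<Longrightarrow> dist (p (g x)) (g x) \<le> D"
  shows "p \<in> elliptic_radical \<iota> act R G x"
proof -
  have fixes_class: "(\<xi>, act q \<xi>) \<in> R"
    if q: "q \<in> carrier isometry_group" "\<forall>g\<in>G. dist (q (g x)) (g x) \<le> D"
      and \<xi>: "\<xi> \<in> R `` limit_set \<iota> G x" for q \<xi>
  proof -
    obtain \<eta> where \<eta>: "\<eta> \<in> limit_set \<iota> G x" "(\<eta>, \<xi>) \<in> R" using \<xi> by blast
    then obtain f where f: "\<And>n. f n \<in> \<iota> ` orbit_of G x - {\<eta>}" "f \<longlonglongrightarrow> \<eta>"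
      unfolding limit_set_def islimpt_sequential by auto
    have "\<exists>g\<in>G. f n = \<iota> (g x)" for n using f(1)[of n] unfolding orbit_of_def by blast
    then obtain g where g: "\<And>n. g n \<in> G" "\<And>n. f n = \<iota> (g n x)" by metis
    have "(\<lambda>n. \<iota> (g n x)) \<longlonglongrightarrow> \<eta>" using f(2) g(2) by (metis (no_types, lifting) ext)
    moreover have "\<eta> \<in> boundary \<iota>" using \<eta>(1) by (simp add: limit_set_def)
    ultimately have "(\<eta>, act q \<eta>) \<in> R"
      using q(2) g(1) by (intro bounded_displacement_limit[OF proper geodesic q(1)]) auto
    moreover have "(act q \<eta>, act q \<xi>) \<in> R" using partition_invariant[OF q(1) \<eta>(2)] .
    ultimately show ?thesis using \<eta>(2) partition by (meson equivE symE transE)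
  qed
  let ?p' = "inv_into UNIV p"
  have p': "?p' \<in> carrier isometry_group" using isometries.inv_mem[OF p] .
  have D': "\<forall>g\<in>G. dist (?p' (g x)) (g x) \<le> D"
    using D by (simp only: dist_inverse_isometry(1)[OF p] dist_commute[of "_ x" "p (_ x)"]) blast
  have "act p ` (R `` {\<xi>}) = R `` {\<xi>}" if \<xi>: "R `` {\<xi>} \<subseteq> R `` limit_set \<iota> G x" "\<xi> \<in> boundary \<iota>" for \<xi>
  proof -
    have \<xi>R: "\<xi> \<in> R `` limit_set \<iota> G x"
      using \<xi> partition by (meson Image_singleton_iff equivE refl_onD subsetD)
    have stable: "act q \<zeta> \<in> R `` {\<xi>}"
      if q: "q \<in> carrier isometry_group" "\<forall>g\<in>G. dist (q (g x)) (g x) \<le> D"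
        and \<zeta>: "\<zeta> \<in> R `` {\<xi>}" for q \<zeta>
    proof -
      have "\<zeta> \<in> R `` limit_set \<iota> G x" using \<zeta> \<xi>(1) by blast
      then have "(\<zeta>, act q \<zeta>) \<in> R" by (rule fixes_class[OF q])
      then show ?thesis using \<zeta> partition by (meson Image_singleton_iff equivE transE)
    qed
    show ?thesis
    proof
      show "act p ` (R `` {\<xi>}) \<subseteq> R `` {\<xi>}" using stable[OF p] D by blast
      show "R `` {\<xi>} \<subseteq> act p ` (R `` {\<xi>})"
        using stable[OF p' D'] act_inverse[OF p] by (metis image_eqI subsetI)
    qed
  qed
  then show ?thesis unfolding elliptic_radical_def using p by blast
qed

end

section \<open>Turning at a confining element\<close>

lemma confined_conjugate:
  assumes "confined \<Gamma> H P" "\<Gamma> \<subseteq> carrier isometry_group" "H \<subseteq> carrier isometry_group" "g \<in> \<Gamma>"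
  obtains p where "p \<in> P - {id}" "g \<circ> p \<circ> inv_into UNIV g \<in> H"
proof -
  have g: "g \<in> carrier isometry_group" using assms by blast
  note gi = isometry_inverse[OF g]
  obtain h where h: "h \<in> H" "inv_into UNIV g \<circ> h \<circ> g \<in> P - {id}"
    using assms(1,4) m_inv_isometry_group[OF g] unfolding confined_def isometry_group_simps by fastforce
  have "g \<circ> (inv_into UNIV g \<circ> h \<circ> g) \<circ> inv_into UNIV g = h"
    by (simp add: fun_eq_iff gi)
  then show ?thesis using h by (intro that[of "inv_into UNIV g \<circ> h \<circ> g"]) simp_all
qed

context isometry_subgroup
begin

definition centralizer :: "('a \<Rightarrow> 'a) \<Rightarrow> ('a \<Rightarrow> 'a) set" where
  "centralizer q = {g \<in> \<Gamma>. g \<circ> q = q \<circ> g}"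

lemma centralizer_subgroup: "subgroup (centralizer q) isometry_group"
proof (rule subgroup_isometryI)
  show "centralizer q \<subseteq> carrier isometry_group" unfolding centralizer_def using isometry by blast
  show "id \<in> centralizer q" unfolding centralizer_def using id_mem by simp
next
  fix g h assume "g \<in> centralizer q" "h \<in> centralizer q"
  then have "g \<in> \<Gamma>" "h \<in> \<Gamma>" "g (q x) = q (g x)" "h (q x) = q (h x)" for x
    unfolding centralizer_def by (auto simp: fun_eq_iff)
  then show "g \<circ> h \<in> centralizer q" unfolding centralizer_def using comp_mem by (auto simp: fun_eq_iff)
next
  fix g assume "g \<in> centralizer q"
  then have g: "g \<in> \<Gamma>" "\<And>x. g (q x) = q (g x)"
    unfolding centralizer_def by (auto simp: fun_eq_iff)
  note gi = isometry_inverse[OF isometry[OF g(1)]]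
  have "inv_into UNIV g (q x) = q (inv_into UNIV g x)" for x
    using gi(2)[of "q (inv_into UNIV g x)"] by (simp add: g(2) gi(1))
  then show "inv_into UNIV g \<in> centralizer q"
    unfolding centralizer_def using inv_mem[OF g(1)] by (simp add: fun_eq_iff)
qed

text \<open>An isometry that commutes with \<open>q\<close> preserves its displacement. So the
  displacement at \<open>g x\<close> equals that at \<open>inv t x\<close> for one of finitely many
  \<open>t\<close>.\<close>

lemma finite_index_centralizer_displacement:
  assumes "finite T" "T \<subseteq> \<Gamma>" "\<And>x. x \<in> \<Gamma> \<Longrightarrow> \<exists>t\<in>T. inv_into UNIV t \<circ> x \<in> centralizer q"
  shows "\<exists>D. \<forall>g\<in>\<Gamma>. dist (q (g x)) (g x) \<le> D"
proof -
  define f where "f t = dist (q (inv_into UNIV t x)) (inv_into UNIV t x)" for t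
  have "dist (q (g x)) (g x) \<le> Max (f ` T)" if g: "g \<in> \<Gamma>" for g
  proof -
    obtain t where t: "t \<in> T" "inv_into UNIV t \<circ> inv_into UNIV g \<in> centralizer q"
      using assms(3)[OF inv_mem[OF g]] by blast
    note gI = isometry[OF g] and tI = subsetD[OF assms(2) t(1), THEN isometry]
    let ?c = "inv_into UNIV t \<circ> inv_into UNIV g"
    have "dist (q (g x)) (g x) = dist (?c (q (g x))) (?c (g x))"
      by (simp add: isometry_groupD(1)[OF isometries.inv_mem[OF gI]] isometry_groupD(1)[OF isometries.inv_mem[OF tI]])
    also have "?c (q (g x)) = q (?c (g x))"
      using t(2) unfolding centralizer_def by (metis (mono_tags, lifting) comp_apply mem_Collect_eq)
    also have "?c (g x) = inv_into UNIV t x" by (simp add: isometry_inverse[OF gI])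
    finally have "dist (q (g x)) (g x) = f t" by (simp add: f_def)
    then show ?thesis using t(1) assms(1) by simp
  qed
  then show ?thesis by blast
qed

end

context nonelementary_action
begin

text \<open>If the confining element at \<open>x \<circ> e i \<circ> inv t\<close> fixes the shadow coarsely for all \<open>i\<close>,
  then the corresponding elements of \<open>H\<close> move the base point by a bounded amount, so two of them
  coincide by discreteness of \<open>H\<close>. Hence \<open>inv (e i) \<circ> e j\<close> centralizes a conjugate of an
  element of \<open>P\<close>, which is excluded by the choice of the sequence \<open>e\<close>.\<close>

lemma confined_turn:
  assumes H: "subgroup H isometry_group" "\<And>r. finite {h \<in> H. dist (a 0) (h (a 0)) \<le> r}"
    and P: "confined \<Gamma> H P"
    and unbounded: "\<And>p D. p \<in> P - {id} \<Longrightarrow> \<exists>g\<in>\<Gamma>. dist (p (g (a 0))) (g (a 0)) > D"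
  shows "\<exists>Q r. finite Q \<and> Q \<subseteq> carrier isometry_group \<and>
    (\<forall>x\<in>\<Gamma>. \<forall>z. \<exists>q\<in>Q. x \<circ> q \<circ> inv_into UNIV x \<in> H \<and>
       passes (a 0) (x (q (inv_into UNIV x z))) (x (a 0)) r)"
proof -
  let ?P = "P - {id}"
  have finP: "finite ?P" and PI: "?P \<subseteq> carrier isometry_group"
    using P unfolding confined_def by auto
  have \<Gamma>I: "\<Gamma> \<subseteq> carrier isometry_group" and HI: "H \<subseteq> carrier isometry_group"
    using isometry subgroup.subset[OF H(1)] by auto
  obtain g0 r where g0: "g0 \<in> \<Gamma>" and mf: "\<And>p. p \<in> ?P \<Longrightarrow> moves_or_fixes p (g0 ` shadow 0) r"
    using common_shadow[OF finP PI] by blast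
  define V where "V = g0 ` shadow 0"
  obtain T0 where T0: "finite T0" "T0 \<subseteq> \<Gamma>" "\<And>w z. \<exists>t\<in>T0. t w \<in> shadow 0 \<and> t z \<in> shadow 0"
    by (rule two_points_into_shadow, rule that)
  define T where "T = (\<lambda>t. g0 \<circ> t) ` T0"
  have finT: "finite T" and T\<Gamma>: "T \<subseteq> \<Gamma>"
    using T0(1,2) g0 comp_mem by (auto simp: T_def)
  have TV: "\<exists>t\<in>T. t w \<in> V \<and> t z \<in> V" for w z
    using T0(3)[of w z] unfolding T_def V_def by auto
  define S where "S = {h \<in> H. dist (a 0) (h (a 0)) \<le> r}"
  have finS: "finite S" unfolding S_def by (rule H(2))
  \<comment> \<open>One more than the number of possible triples \<open>(h i, p i, t i)\<close>, for
    the pigeonhole principle.\<close>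
  define N where "N = Suc (card (S \<times> ?P \<times> T))"
  define conj :: "('a \<Rightarrow> 'a) \<times> ('a \<Rightarrow> 'a) \<Rightarrow> 'a \<Rightarrow> 'a"
    where "conj = (\<lambda>(t, p). inv_into UNIV t \<circ> p \<circ> t)"
  have "\<exists>x\<in>\<Gamma>. \<forall>u\<in>U. inv_into UNIV u \<circ> x \<notin> C"
    if C: "C \<in> (\<lambda>tp. centralizer (conj tp)) ` (T \<times> ?P)" and U: "finite U" "U \<subseteq> \<Gamma>" for C U
  proof (rule ccontr)
    assume neg: "\<not> ?thesis"
    obtain t p where tp: "t \<in> T" "p \<in> ?P" and C': "C = centralizer (conj (t, p))" using C by blast
    have cover: "\<exists>u\<in>U. inv_into UNIV u \<circ> x \<in> centralizer (conj (t, p))" if "x \<in> \<Gamma>" for x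
      using neg that unfolding C' by metis
    obtain D where D: "\<forall>g\<in>\<Gamma>. dist (conj (t, p) (g (a 0))) (g (a 0)) \<le> D"
      using finite_index_centralizer_displacement[OF U cover] by blast
    have t\<Gamma>: "t \<in> \<Gamma>" using tp T\<Gamma> by blast
    note tI = isometry[OF t\<Gamma>]
    obtain g where g: "g \<in> \<Gamma>" "dist (p (g (a 0))) (g (a 0)) > D" using unbounded[OF tp(2)] by blast
    have "inv_into UNIV t \<circ> g \<in> \<Gamma>" using t\<Gamma> g(1) comp_mem inv_mem by blast
    then have "dist (conj (t, p) ((inv_into UNIV t \<circ> g) (a 0))) ((inv_into UNIV t \<circ> g) (a 0)) \<le> D"
      using D by blast
    then show False
      using g(2) by (simp add: conj_def isometry_inverse[OF tI] isometry_groupD(1)[OF isometries.inv_mem[OF tI]])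
  qed
  moreover have "finite ((\<lambda>tp. centralizer (conj tp)) ` (T \<times> ?P))" using finT finP by simp
  moreover have "subgroup C isometry_group \<and> C \<subseteq> \<Gamma>" if "C \<in> (\<lambda>tp. centralizer (conj tp)) ` (T \<times> ?P)" for C
  proof -
    obtain tp where "C = centralizer (conj tp)" using \<open>C \<in> _\<close> by blast
    then show ?thesis using centralizer_subgroup unfolding centralizer_def by blast
  qed
  ultimately obtain e :: "nat \<Rightarrow> 'a \<Rightarrow> 'a" where e: "\<And>i. i < N \<Longrightarrow> e i \<in> \<Gamma>"
    and ne: "\<And>i j C. i < N \<Longrightarrow> j < N \<Longrightarrow> i \<noteq> j \<Longrightarrow> C \<in> (\<lambda>tp. centralizer (conj tp)) ` (T \<times> ?P) \<Longrightarrow>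
      inv_into UNIV (e i) \<circ> e j \<notin> C"
    by (rule_tac pairwise_inequivalent_isometries[of "(\<lambda>tp. centralizer (conj tp)) ` (T \<times> ?P)" N]) auto
  \<comment> \<open>\<open>G\<close> and hence \<open>Q\<close> and \<open>r'\<close> do not depend
    on \<open>x\<close> and \<open>z\<close>.\<close>
  define G where "G = (\<lambda>(i, t). e i \<circ> inv_into UNIV t) ` ({..<N} \<times> T)"
  have finG: "finite G" unfolding G_def using finT by simp
  define Q where "Q = (\<lambda>(g, p). g \<circ> p \<circ> inv_into UNIV g) ` (G \<times> ?P)"
  have G\<Gamma>: "G \<subseteq> \<Gamma>" unfolding G_def using e T\<Gamma> comp_mem inv_mem by auto
  define r' where "r' = r + Max (insert 0 ((\<lambda>g. dist (g (a 0)) (a 0)) ` G))"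
  have r': "r + dist (g (a 0)) (a 0) \<le> r'" if "g \<in> G" for g
    unfolding r'_def using finG that by (intro add_left_mono Max_ge) auto
  have turn: "\<exists>q\<in>Q. x \<circ> q \<circ> inv_into UNIV x \<in> H \<and> passes (a 0) (x (q (inv_into UNIV x z))) (x (a 0)) r'"
    if x: "x \<in> \<Gamma>" for x z
  proof (rule ccontr)
    assume neg: "\<not> ?thesis"
    note xI = isometry[OF x] and xi = isometry_inverse[OF isometry[OF x]]
    define w where "w = inv_into UNIV x (a 0)"
    have "\<exists>t\<in>T. t (inv_into UNIV (e i) w) \<in> V \<and> t (inv_into UNIV (e i) (inv_into UNIV x z)) \<in> V" for i
      by (rule TV)
    then obtain t where t: "\<And>i. t i \<in> T" "\<And>i. t i (inv_into UNIV (e i) w) \<in> V"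
      "\<And>i. t i (inv_into UNIV (e i) (inv_into UNIV x z)) \<in> V"
      by metis
    define g where "g i = e i \<circ> inv_into UNIV (t i)" for i
    have gG: "g i \<in> G" if "i < N" for i unfolding g_def G_def using that t(1) by auto
    have g\<Gamma>: "g i \<in> \<Gamma>" if "i < N" for i using gG[OF that] G\<Gamma> by blast
    have inv_g: "inv_into UNIV (g i) y = t i (inv_into UNIV (e i) y)" if "i < N" for i y
    proof -
      have "g i (t i (inv_into UNIV (e i) y)) = y"
        using isometry_inverse[OF isometry[OF subsetD[OF T\<Gamma> t(1)]]] isometry_inverse[OF isometry[OF e[OF that]]]
        by (simp add: g_def)
      then show ?thesis
        using isometry_inverse(2)[OF isometry[OF g\<Gamma>[OF that]], of "t i (inv_into UNIV (e i) y)"] by simp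
    qed
    have "\<exists>p\<in>?P. (x \<circ> g i) \<circ> p \<circ> inv_into UNIV (x \<circ> g i) \<in> H" if "i < N" for i
      using confined_conjugate[OF P \<Gamma>I HI comp_mem[OF x g\<Gamma>[OF that]]] by blast
    then obtain p where p: "\<And>i. i < N \<Longrightarrow> p i \<in> ?P"
      and pH: "\<And>i. i < N \<Longrightarrow> (x \<circ> g i) \<circ> p i \<circ> inv_into UNIV (x \<circ> g i) \<in> H"
      by metis
    have inv_xg: "inv_into UNIV (x \<circ> g i) y = inv_into UNIV (g i) (inv_into UNIV x y)" if "i < N" for i y
      using isometry_inverse(2)[OF isometry[OF comp_mem[OF x g\<Gamma>[OF that]]], of "inv_into UNIV (g i) (inv_into UNIV x y)"]
        isometry_inverse(1)[OF isometry[OF g\<Gamma>[OF that]]] xi by simp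
    define h where "h i = (x \<circ> g i) \<circ> p i \<circ> inv_into UNIV (x \<circ> g i)" for i
    have h_eq: "h i y = x (g i (p i (inv_into UNIV (g i) (inv_into UNIV x y))))" if "i < N" for i y
      unfolding h_def using inv_xg[OF that] by simp
    \<comment> \<open>As no \<open>q\<close> in \<open>Q\<close> works, the first alternative of
      \<open>moves_or_fixes\<close> fails for \<open>p i\<close>. The second one applies because
      \<open>inv (g i) w\<close> is an orbit point in the shadow.\<close>
    have hS: "h i \<in> S" if i: "i < N" for i
    proof -
      note gI = isometry[OF g\<Gamma>[OF i]] and gi = isometry_inverse[OF isometry[OF g\<Gamma>[OF i]]]
      have Vw: "inv_into UNIV (g i) w \<in> V" and Vz: "inv_into UNIV (g i) (inv_into UNIV x z) \<in> V"
        using t i by (simp_all add: inv_g)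
      let ?q = "g i \<circ> p i \<circ> inv_into UNIV (g i)"
      have "?q \<in> Q" unfolding Q_def using gG[OF i] p[OF i] by force
      moreover have "x \<circ> ?q \<circ> inv_into UNIV x = h i" using h_eq[OF i] by (simp add: fun_eq_iff)
      ultimately have "\<not> passes (a 0) (x (?q (inv_into UNIV x z))) (x (a 0)) r'"
        using neg pH[OF i] h_def by metis
      moreover have "passes (a 0) (x (?q (inv_into UNIV x z))) (x (a 0)) r'"
        if "\<forall>u\<in>V. \<forall>v\<in>V. passes u (p i v) (a 0) r"
      proof -
        have "passes (inv_into UNIV (g i) w) (p i (inv_into UNIV (g i) (inv_into UNIV x z))) (a 0) r"
          using that Vw Vz by blast
        then have "passes (x (g i (inv_into UNIV (g i) w)))
          (x (g i (p i (inv_into UNIV (g i) (inv_into UNIV x z))))) (x (g i (a 0))) r"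
          by (intro passes_image[OF xI] passes_image[OF gI])
        then have "passes (a 0) (x (?q (inv_into UNIV x z))) (x (g i (a 0))) r"
          by (simp add: gi xi w_def)
        then show ?thesis
          by (rule passes_weaken) (use r'[OF gG[OF i]] isometry_groupD(1)[OF xI] in simp)
      qed
      ultimately have fixing: "\<forall>h\<in>\<Gamma>. h (a 0) \<in> V \<longrightarrow> dist (p i (h (a 0))) (h (a 0)) \<le> r"
        using mf[OF p[OF i]] unfolding moves_or_fixes_def V_def by blast
      let ?y = "inv_into UNIV (g i) w"
      have "(inv_into UNIV (g i) \<circ> inv_into UNIV x) \<in> \<Gamma>"
        using comp_mem inv_mem g\<Gamma>[OF i] x by blast
      then have "dist (p i ?y) ?y \<le> r"
        using fixing Vw by (metis comp_apply w_def)
      moreover have "dist (h i (a 0)) (a 0) = dist (x (g i (p i ?y))) (x (g i ?y))"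
        by (simp add: h_eq[OF i] gi xi w_def)
      ultimately have "dist (a 0) (h i (a 0)) \<le> r"
        by (simp add: isometry_groupD(1)[OF xI] isometry_groupD(1)[OF gI] dist_commute)
      then show ?thesis using pH[OF i] unfolding S_def h_def by blast
    qed
    have sub: "(\<lambda>i. (h i, p i, t i)) ` {..<N} \<subseteq> S \<times> ?P \<times> T" using hS p t(1) by auto
    have "\<not> inj_on (\<lambda>i. (h i, p i, t i)) {..<N}"
    proof
      assume "inj_on (\<lambda>i. (h i, p i, t i)) {..<N}"
      from card_inj_on_le[OF this sub] show False using finS finP finT by (simp add: N_def)
    qed
    then obtain i j where ij: "i < N" "j < N" "i \<noteq> j" "h i = h j" "p i = p j" "t i = t j"
      unfolding inj_on_def by auto
    define q where "q = conj (t i, p i)"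
    \<comment> \<open>Thus \<open>h l\<close> is the conjugate of \<open>q\<close> by
      \<open>x \<circ> e l\<close>. Equality of these conjugates for \<open>i\<close> and
      \<open>j\<close> means that \<open>inv (e i) \<circ> e j\<close> commutes with
      \<open>q\<close>.\<close>
    have h_e: "h l (x (e l y)) = x (e l (q y))" if l: "l \<in> {i, j}" for l y
    proof -
      have l': "l < N" "t l = t i" "p l = p i" using l ij by auto
      have "inv_into UNIV (g l) (e l y) = t i y"
        using isometry_inverse(2)[OF isometry[OF e[OF l'(1)]]] by (simp add: inv_g[OF l'(1)] l')
      then show ?thesis
        unfolding h_eq[OF l'(1)] xi(2) by (simp add: l' g_def q_def conj_def)
    qed
    have eq: "h i (x (e i y)) = x (e i (q y))" "h i (x (e j y)) = x (e j (q y))" for y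
      using h_e[of i y] h_e[of j y] ij(4) by simp_all
    note ei = isometry_inverse[OF isometry[OF e[OF ij(1)]]]
    have com: "inv_into UNIV (e i) (e j (q y)) = q (inv_into UNIV (e i) (e j y))" for y
    proof -
      have "x (e j (q y)) = x (e i (q (inv_into UNIV (e i) (e j y))))"
        using eq(1)[of "inv_into UNIV (e i) (e j y)"] eq(2)[of y] by (simp add: ei)
      then have "e j (q y) = e i (q (inv_into UNIV (e i) (e j y)))" using xi(2) by metis
      then show ?thesis by (simp add: ei)
    qed
    then have "inv_into UNIV (e i) \<circ> e j \<in> centralizer q"
      unfolding centralizer_def using comp_mem[OF inv_mem[OF e[OF ij(1)]] e[OF ij(2)]]
      by (simp add: fun_eq_iff)
    moreover have "centralizer q \<in> (\<lambda>tp. centralizer (conj tp)) ` (T \<times> ?P)"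
      unfolding q_def using t(1) p[OF ij(1)] by blast
    ultimately show False using ne[OF ij(1-3)] by blast
  qed
  have "Q \<subseteq> carrier isometry_group"
    unfolding Q_def using G\<Gamma> PI \<Gamma>I by (auto intro!: isometries.comp_mem isometries.inv_mem)
  moreover have "finite Q" unfolding Q_def using finG finP by simp
  ultimately show ?thesis using turn by blast
qed

end

section \<open>Counting\<close>

text \<open>Cauchy--Schwarz for the sizes of the fibres of \<open>f\<close>: their sum is
  \<open>card Y\<close>, and the sum of their squares counts the pairs.\<close>

lemma card_squared_le_card_image_times_pairs:
  assumes "finite Y"
  shows "(card Y)\<^sup>2 \<le> card (f ` Y) * card {(y, y'). y \<in> Y \<and> y' \<in> Y \<and> f y = f y'}"
proof -
  define fib where "fib c = {y \<in> Y. f y = c}" for c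
  have "real (card Y) = (\<Sum>c\<in>f ` Y. real (card (fib c)))"
    using sum.image_gen[OF assms, of "\<lambda>_. 1::real" f] by (simp add: fib_def)
  also have "\<dots> = (\<Sum>c\<in>f ` Y. \<bar>1\<bar> * \<bar>real (card (fib c))\<bar>)" by simp
  also have "\<dots> \<le> L2_set (\<lambda>_. 1) (f ` Y) * L2_set (\<lambda>c. real (card (fib c))) (f ` Y)"
    by (rule L2_set_mult_ineq)
  finally have "(real (card Y))\<^sup>2 \<le> (L2_set (\<lambda>_. 1) (f ` Y) * L2_set (\<lambda>c. real (card (fib c))) (f ` Y))\<^sup>2"
    by (intro power_mono) simp_all
  also have "\<dots> = real (card (f ` Y)) * (\<Sum>c\<in>f ` Y. (real (card (fib c)))\<^sup>2)"
    by (simp add: L2_set_def power_mult_distrib sum_nonneg)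
  also have "(\<Sum>c\<in>f ` Y. (real (card (fib c)))\<^sup>2) = (\<Sum>c\<in>f ` Y. \<Sum>y\<in>{y. y \<in> Y \<and> f y = c}. real (card (fib (f y))))"
    by (intro sum.cong refl) (simp add: fib_def power2_eq_square)
  also have "\<dots> = (\<Sum>y\<in>Y. real (card (fib (f y))))"
    using sum.image_gen[OF assms, of "\<lambda>y. real (card (fib (f y)))" f] by simp
  also have "\<dots> = real (card (SIGMA y:Y. fib (f y)))"
    using assms by (simp add: fib_def)
  also have "(SIGMA y:Y. fib (f y)) = {(y, y'). y \<in> Y \<and> y' \<in> Y \<and> f y = f y'}"
    by (auto simp: fib_def)
  finally have "real ((card Y)\<^sup>2) \<le> real (card (f ` Y) * card {(y, y'). y \<in> Y \<and> y' \<in> Y \<and> f y = f y'})"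
    by simp
  then show ?thesis by (simp only: of_nat_le_iff)
qed

context isometry_subgroup
begin

text \<open>If the ball contains an orbit point \<open>g x\<close>, the inverse of \<open>g\<close>
  moves its orbit points into the ball of twice the radius about \<open>x\<close>. The bound is
  therefore independent of the centre.\<close>

lemma card_orbit_ball:
  assumes "\<And>r. finite {g \<in> \<Gamma>. dist x (g x) \<le> r}"
  shows "finite {y \<in> orbit_of \<Gamma> x. dist c y \<le> r} \<and>
    card {y \<in> orbit_of \<Gamma> x. dist c y \<le> r} \<le> card {g \<in> \<Gamma>. dist x (g x) \<le> 2 * r}"
proof (cases "{y \<in> orbit_of \<Gamma> x. dist c y \<le> r} = {}")
  case True
  show ?thesis unfolding True by simp
next
  case False
  then obtain g where g: "g \<in> \<Gamma>" "dist c (g x) \<le> r" unfolding orbit_of_def by auto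
  let ?B = "{g \<in> \<Gamma>. dist x (g x) \<le> 2 * r}"
  note gI = isometry[OF g(1)]
  have "{y \<in> orbit_of \<Gamma> x. dist c y \<le> r} \<subseteq> (\<lambda>h. g (h x)) ` ?B"
  proof
    fix y assume "y \<in> {y \<in> orbit_of \<Gamma> x. dist c y \<le> r}"
    then obtain h where h: "h \<in> \<Gamma>" "y = h x" "dist c (h x) \<le> r" unfolding orbit_of_def by auto
    have "dist x ((inv_into UNIV g \<circ> h) x) = dist (g x) (h x)"
      by (simp add: dist_inverse_isometry(2)[OF gI])
    also have "\<dots> \<le> 2 * r" using dist_triangle3[of "g x" "h x" c] g(2) h(3) by simp
    finally have "inv_into UNIV g \<circ> h \<in> ?B" using g h comp_mem inv_mem by blast
    moreover have "y = g ((inv_into UNIV g \<circ> h) x)" by (simp add: h(2) isometry_inverse[OF gI])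
    ultimately show "y \<in> (\<lambda>h. g (h x)) ` ?B" by blast
  qed
  then show ?thesis
    using assms by (meson card_image_le card_mono finite_imageI finite_subset order_trans)
qed

text \<open>The segment is covered by unit balls about its points at integer times, so the bound is
  linear in its length.\<close>

lemma card_orbit_near_segment:
  assumes fin: "\<And>r. finite {g \<in> \<Gamma>. dist x (g x) \<le> r}"
    and S: "geodesic_segment u v S" "dist u v \<le> real m"
  shows "finite {y \<in> orbit_of \<Gamma> x. \<exists>s\<in>S. dist s y \<le> r} \<and>
    card {y \<in> orbit_of \<Gamma> x. \<exists>s\<in>S. dist s y \<le> r} \<le> Suc m * card {g \<in> \<Gamma>. dist x (g x) \<le> 2 * (r + 1)}"
proof -
  obtain \<gamma> where \<gamma>: "\<And>s t. s \<in> {0..dist u v} \<Longrightarrow> t \<in> {0..dist u v} \<Longrightarrow> dist (\<gamma> s) (\<gamma> t) = \<bar>s - t\<bar>"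
    "\<gamma> 0 = u" "\<gamma> (dist u v) = v" "S = \<gamma> ` {0..dist u v}"
    by (rule geodesic_segmentE[OF S(1)], rule that)
  let ?A = "\<lambda>j. {y \<in> orbit_of \<Gamma> x. dist (\<gamma> (real j)) y \<le> r + 1}"
  have sub: "{y \<in> orbit_of \<Gamma> x. \<exists>s\<in>S. dist s y \<le> r} \<subseteq> (\<Union>j\<in>{..m}. ?A j)"
  proof
    fix y assume "y \<in> {y \<in> orbit_of \<Gamma> x. \<exists>s\<in>S. dist s y \<le> r}"
    then obtain t where y: "y \<in> orbit_of \<Gamma> x" "t \<in> {0..dist u v}" "dist (\<gamma> t) y \<le> r"
      unfolding \<gamma>(4) by blast
    define j where "j = nat \<lfloor>t\<rfloor>"
    have j: "real j \<le> t" "t \<le> real j + 1" using y(2) by (auto simp: j_def)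
    then have "dist (\<gamma> (real j)) (\<gamma> t) \<le> 1" using \<gamma>(1)[of "real j" t] y(2) by auto
    then have "dist (\<gamma> (real j)) y \<le> r + 1"
      using dist_triangle[of "\<gamma> (real j)" y "\<gamma> t"] y(3) by linarith
    moreover have "real j \<le> real m" using j y(2) S(2) by auto
    then have "j \<le> m" by simp
    ultimately show "y \<in> (\<Union>j\<in>{..m}. ?A j)" using y(1) by blast
  qed
  have A: "finite (?A j)" "card (?A j) \<le> card {g \<in> \<Gamma>. dist x (g x) \<le> 2 * (r + 1)}" for j
    using card_orbit_ball[OF fin] by blast+
  have finU: "finite (\<Union>j\<in>{..m}. ?A j)" using A(1) by blast
  have "card {y \<in> orbit_of \<Gamma> x. \<exists>s\<in>S. dist s y \<le> r} \<le> card (\<Union>j\<in>{..m}. ?A j)"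
    by (rule card_mono[OF finU sub])
  also have "\<dots> \<le> (\<Sum>j\<le>m. card (?A j))" by (rule card_UN_le) simp
  also have "\<dots> \<le> (\<Sum>j\<le>m. card {g \<in> \<Gamma>. dist x (g x) \<le> 2 * (r + 1)})" by (intro sum_mono A(2))
  also have "\<dots> = Suc m * card {g \<in> \<Gamma>. dist x (g x) \<le> 2 * (r + 1)}" by simp
  finally show ?thesis using finite_subset[OF sub finU] by blast
qed

text \<open>An isometry is determined by the image of \<open>x\<close> and an element of the
  stabilizer of \<open>x\<close>, which is the ball of radius 0. This converts the count of elements
  into one of orbit points, as used by \<open>growth_rate\<close>.\<close>

lemma card_ball_le_card_orbit:
  assumes fin: "\<And>r. finite {g \<in> \<Gamma>. dist x (g x) \<le> r}"
  shows "card {g \<in> \<Gamma>. dist x (g x) \<le> r} \<le>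
    card {g x | g. g \<in> \<Gamma> \<and> dist x (g x) \<le> r} * card {g \<in> \<Gamma>. dist x (g x) \<le> 0}"
proof -
  let ?B = "{g \<in> \<Gamma>. dist x (g x) \<le> r}" and ?Y = "{g x | g. g \<in> \<Gamma> \<and> dist x (g x) \<le> r}"
    and ?S = "{g \<in> \<Gamma>. dist x (g x) \<le> 0}"
  define rep where "rep y = (SOME g. g \<in> \<Gamma> \<and> g x = y)" for y
  have rep: "rep (g x) \<in> \<Gamma>" "rep (g x) x = g x" if "g \<in> \<Gamma>" for g
    using someI[of "\<lambda>h. h \<in> \<Gamma> \<and> h x = g x" g] that unfolding rep_def by auto
  define \<Phi> where "\<Phi> g = (g x, inv_into UNIV (rep (g x)) \<circ> g)" for g
  have "\<Phi> ` ?B \<subseteq> ?Y \<times> ?S"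
  proof (rule image_subsetI)
    fix g assume g: "g \<in> ?B"
    then have g': "g \<in> \<Gamma>" by blast
    have "inv_into UNIV (rep (g x)) (g x) = x"
      using isometry_inverse(2)[OF isometry[OF rep(1)[OF g']], of x] rep(2)[OF g'] by simp
    then show "\<Phi> g \<in> ?Y \<times> ?S"
      using g comp_mem[OF inv_mem[OF rep(1)[OF g']] g'] by (auto simp: \<Phi>_def)
  qed
  moreover have "inj_on \<Phi> ?B"
  proof (rule inj_onI)
    fix g h assume gh: "g \<in> ?B" "h \<in> ?B" "\<Phi> g = \<Phi> h"
    then have g: "g \<in> \<Gamma>" by blast
    have "inv_into UNIV (rep (g x)) (g y) = inv_into UNIV (rep (g x)) (h y)" for y
      using gh(3) unfolding \<Phi>_def by (metis comp_apply prod.inject)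
    then have "g y = h y" for y
      using isometry_inverse(1)[OF isometry[OF rep(1)[OF g]]] by metis
    then show "g = h" by blast
  qed
  moreover have "?Y = (\<lambda>g. g x) ` ?B" by blast
  then have "finite ?Y" using fin[of r] by simp
  ultimately have "card ?B \<le> card (?Y \<times> ?S)" using fin[of 0] by (intro card_inj_on_le) auto
  then show ?thesis by (simp add: card_cartesian_product)
qed

end

text \<open>A pair of orbit points \<open>y = x z\<close> and \<open>y'\<close> with \<open>h' y' = y\<close> yields the element
  \<open>x \<circ> q \<circ> inv x \<circ> h'\<close> of \<open>H\<close>. Up to the choice of \<open>q\<close>, the pair is recovered from it and from
  \<open>y\<close>, which lies near a geodesic from the base point to its image under this element.\<close>

lemma count_pairs:
  fixes z :: "'a::metric_space"
  assumes geodesic: "geodesic_space TYPE('a)"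
    and \<Gamma>: "subgroup \<Gamma> isometry_group" "\<And>r. finite {g \<in> \<Gamma>. dist z (g z) \<le> r}"
    and H: "subgroup H isometry_group" "\<And>r. finite {h \<in> H. dist z (h z) \<le> r}"
    and Q: "finite Q" "Q \<subseteq> carrier isometry_group" "\<And>q. q \<in> Q \<Longrightarrow> dist z (q z) \<le> real c"
    and turn: "\<And>x w. x \<in> \<Gamma> \<Longrightarrow> \<exists>q\<in>Q. x \<circ> q \<circ> inv_into UNIV x \<in> H \<and>
       passes z (x (q (inv_into UNIV x w))) (x z) r"
  defines "Y \<equiv> \<lambda>n::nat. {g z | g. g \<in> \<Gamma> \<and> dist z (g z) \<le> real n}"
  shows "card {(y, y'). y \<in> Y n \<and> y' \<in> Y n \<and> orbit_of H y = orbit_of H y'} \<le>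
    card {h \<in> H. dist z (h z) \<le> real (2 * n + c)} *
      (card Q * (Suc (2 * n + c) * card {g \<in> \<Gamma>. dist z (g z) \<le> 2 * (r + 1)}))"
proof -
  interpret \<Gamma>: isometry_subgroup \<Gamma> by (rule isometry_subgroup.intro[OF \<Gamma>(1)])
  interpret H: isometry_subgroup H by (rule isometry_subgroup.intro[OF H(1)])
  let ?m = "2 * n + c"
  let ?B = "{h \<in> H. dist z (h z) \<le> real ?m}"
  let ?M = "card {g \<in> \<Gamma>. dist z (g z) \<le> 2 * (r + 1)}"
  let ?P = "{(y, y'). y \<in> Y n \<and> y' \<in> Y n \<and> orbit_of H y = orbit_of H y'}"
  have "\<forall>b. \<exists>S. geodesic_segment z b S" using geodesic unfolding geodesic_space_def by blast
  then obtain S where S: "\<And>b. geodesic_segment z b (S b)" by metis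
  define N where "N b = {y \<in> orbit_of \<Gamma> z. \<exists>s\<in>S b. dist s y \<le> r}" for b
  have N: "finite (N b)" "card (N b) \<le> Suc m * ?M" if "dist z b \<le> real m" for b m
    using \<Gamma>.card_orbit_near_segment[OF \<Gamma>(2) S that, of r] by (auto simp: N_def)
  have "\<forall>y\<in>Y n. \<exists>g. g \<in> \<Gamma> \<and> g z = y" unfolding Y_def by blast
  then obtain x where x: "\<And>y. y \<in> Y n \<Longrightarrow> x y \<in> \<Gamma>" "\<And>y. y \<in> Y n \<Longrightarrow> x y z = y" by metis
  have "\<forall>y y'. orbit_of H y = orbit_of H y' \<longrightarrow> (\<exists>h. h \<in> H \<and> h y' = y)"
  proof (intro allI impI)
    fix y y' assume eq: "orbit_of H y = orbit_of H y'"
    have "y \<in> orbit_of H y"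
      unfolding orbit_of_def by (rule image_eqI[OF _ H.id_mem]) simp
    then show "\<exists>h. h \<in> H \<and> h y' = y" unfolding eq by (auto simp: orbit_of_def)
  qed
  then have ex_k: "\<exists>h. h \<in> H \<and> h y' = y" if "orbit_of H y = orbit_of H y'" for y y'
    using that by simp
  define k where "k y y' = (SOME h. h \<in> H \<and> h y' = y)" for y y'
  have k: "k y y' \<in> H" "k y y' y' = y" if "orbit_of H y = orbit_of H y'" for y y'
    using someI_ex[OF ex_k[OF that]] by (simp_all add: k_def)
  have ex_q: "\<exists>q. q \<in> Q \<and> x y \<circ> q \<circ> inv_into UNIV (x y) \<in> H \<and>
       passes z (x y (q (inv_into UNIV (x y) w))) y r" if "y \<in> Y n" for y w
    using turn[OF x(1)[OF that], of w] unfolding x(2)[OF that] by blast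
  define q where "q y w = (SOME q. q \<in> Q \<and> x y \<circ> q \<circ> inv_into UNIV (x y) \<in> H \<and>
       passes z (x y (q (inv_into UNIV (x y) w))) y r)" for y w
  have q: "q y w \<in> Q" "x y \<circ> q y w \<circ> inv_into UNIV (x y) \<in> H"
    "passes z (x y (q y w (inv_into UNIV (x y) w))) y r" if "y \<in> Y n" for y w
    using someI_ex[OF ex_q[OF that, of w]] unfolding q_def by blast+
  define p where "p y y' = q y (k y y' z)" for y y'
  define h where "h y y' = x y \<circ> p y y' \<circ> inv_into UNIV (x y) \<circ> k y y'" for y y'
  define \<Phi> where "\<Phi> = (\<lambda>(y, y'). (h y y', p y y', y))"
  have \<Phi>_mem: "\<Phi> (y, y') \<in> (SIGMA h:?B. Q \<times> N (h z))" if y: "y \<in> Y n" "y' \<in> Y n" "orbit_of H y = orbit_of H y'" for y y'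
  proof -
    note xI = \<Gamma>.isometry[OF x(1)[OF y(1)]] and kI = H.isometry[OF k(1)[OF y(3)]]
    have pQ: "p y y' \<in> Q" unfolding p_def by (rule q(1)[OF y(1)])
    then have pI: "p y y' \<in> carrier isometry_group" using Q(2) by blast
    have hH: "h y y' \<in> H" unfolding h_def p_def by (intro H.comp_mem[OF q(2)[OF y(1)] k(1)[OF y(3)]])
    let ?u = "inv_into UNIV (x y) (k y y' z)"
    have hz: "h y y' z = x y (p y y' ?u)" by (simp add: h_def)
    \<comment> \<open>The isometry \<open>h y y'\<close> goes out to \<open>y\<close>, turns by an
      element of \<open>Q\<close> and returns along a copy of the way from \<open>z\<close> to
      \<open>y'\<close>; this gives the length \<open>2 * n + c\<close>.\<close>
    have "dist y (h y y' z) = dist z (p y y' ?u)"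
      using isometry_groupD(1)[OF xI, of z "p y y' ?u"] x(2)[OF y(1)] hz by simp
    also have "\<dots> \<le> dist z (p y y' z) + dist (p y y' z) (p y y' ?u)" by (rule dist_triangle)
    also have "dist (p y y' z) (p y y' ?u) = dist z ?u" by (rule isometry_groupD(1)[OF pI])
    also have "\<dots> = dist (k y y' y') (k y y' z)"
      using x(2)[OF y(1)] k(2)[OF y(3)] by (simp add: dist_inverse_isometry(2)[OF xI])
    also have "\<dots> = dist y' z" by (rule isometry_groupD(1)[OF kI])
    finally have "dist y (h y y' z) \<le> real c + dist y' z" using Q(3)[OF pQ] by linarith
    moreover have "dist z y \<le> real n" "dist y' z \<le> real n"
      using y(1,2) unfolding Y_def by (auto simp: dist_commute)
    ultimately have "dist z (h y y' z) \<le> real ?m"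
      using dist_triangle[of z "h y y' z" y] by simp
    moreover have "y \<in> N (h y y' z)"
    proof -
      have "passes z (h y y' z) y r" using q(3)[OF y(1), of "k y y' z"] by (simp add: hz p_def)
      moreover have "y \<in> orbit_of \<Gamma> z" unfolding orbit_of_def using x[OF y(1)] by (metis imageI)
      ultimately show ?thesis using S unfolding N_def passes_def by blast
    qed
    ultimately show ?thesis using hH pQ by (simp add: \<Phi>_def)
  qed
  have sub: "\<Phi> ` ?P \<subseteq> (SIGMA h:?B. Q \<times> N (h z))"
  proof (rule image_subsetI)
    fix a assume "a \<in> ?P"
    then show "\<Phi> a \<in> (SIGMA h:?B. Q \<times> N (h z))"
      using \<Phi>_mem[of "fst a" "snd a"] by (simp add: case_prod_beta)
  qed
  have inj: "inj_on \<Phi> ?P"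
  proof (rule inj_onI)
    fix a b assume a: "a \<in> ?P" and b: "b \<in> ?P" and eq: "\<Phi> a = \<Phi> b"
    obtain y y' where ay: "a = (y, y')" by (cases a)
    obtain v' where bv: "b = (y, v')" using eq ay unfolding \<Phi>_def by (cases b) auto
    have y: "y \<in> Y n" "orbit_of H y = orbit_of H y'" "orbit_of H y = orbit_of H v'"
      using a b by (auto simp: ay bv)
    have p: "p y y' = p y v'" and h: "h y y' = h y v'" using eq by (simp_all add: \<Phi>_def ay bv)
    note xI = \<Gamma>.isometry[OF x(1)[OF y(1)]]
    have pI: "p y v' \<in> carrier isometry_group" unfolding p_def using q(1)[OF y(1)] Q(2) by blast
    \<comment> \<open>The isometry \<open>x y\<close> depends on \<open>y\<close> alone, so it and
      the common \<open>p\<close> can be cancelled from \<open>h\<close>. Then \<open>y'\<close> and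
      \<open>v'\<close> are both the preimage of \<open>y\<close> under the same element of
      \<open>H\<close>.\<close>
    have "k y y' u = k y v' u" for u
    proof -
      have "h y y' u = h y v' u" by (simp add: h)
      then have "x y (p y v' (inv_into UNIV (x y) (k y y' u))) = x y (p y v' (inv_into UNIV (x y) (k y v' u)))"
        by (simp add: h_def p)
      then show ?thesis using isometry_inverse[OF xI] isometry_inverse[OF pI] by metis
    qed
    then have "k y v' y' = k y v' v'" using k(2)[OF y(2)] k(2)[OF y(3)] by metis
    then have "y' = v'" using isometry_inverse(2)[OF H.isometry[OF k(1)[OF y(3)]]] by metis
    then show "a = b" by (simp add: ay bv)
  qed
  have finB: "finite ?B" by (rule H(2))
  have finN: "\<forall>h\<in>?B. finite (Q \<times> N (h z))" using N(1) Q(1) by blast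
  have "finite (SIGMA h:?B. Q \<times> N (h z))" by (rule finite_SigmaI[OF finB]) (use finN in blast)
  then have "card ?P \<le> card (SIGMA h:?B. Q \<times> N (h z))" by (rule card_inj_on_le[OF inj sub])
  also have "\<dots> = (\<Sum>h\<in>?B. card (Q \<times> N (h z)))" using finB finN by (rule card_SigmaI)
  also have "\<dots> \<le> (\<Sum>h\<in>?B. card Q * (Suc ?m * ?M))"
    using N(2) by (intro sum_mono) (auto simp: card_cartesian_product intro!: mult_le_mono2)
  also have "\<dots> = card ?B * (card Q * (Suc ?m * ?M))" by simp
  finally show ?thesis .
qed

section \<open>Growth rates\<close>

lemma exponential_growth_nonneg:
  assumes "\<And>n. A n \<noteq> {}"
  shows "exponential_growth A \<ge> 0"
proof -
  have "0 \<le> ereal (1 / real n) * log_card (A n)" for n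
  proof -
    have "0 \<le> log_card (A n)"
      using assms[of n] by (auto simp: log_card_def Suc_le_eq card_gt_0_iff intro!: ln_ge_zero)
    then show ?thesis by simp
  qed
  then show ?thesis
    unfolding exponential_growth_def by (intro le_Limsup) (auto simp: always_eventually)
qed

lemma exponential_growth_less:
  assumes "exponential_growth A < ereal \<alpha>"
  shows "\<forall>\<^sub>F n in sequentially. finite (A n) \<and> ln (real (card (A n))) \<le> \<alpha> * real n"
proof -
  have "\<forall>\<^sub>F n in sequentially. ereal (1 / real n) * log_card (A n) < ereal \<alpha>"
    using assms unfolding exponential_growth_def by (rule Limsup_lessD)
  then show ?thesis using eventually_gt_at_top[of 0]
  proof eventually_elim
    case (elim n)
    have "finite (A n)"
    proof (rule ccontr)
      assume "infinite (A n)"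
      then show False using elim by (simp add: log_card_def)
    qed
    then show ?case using elim by (simp add: log_card_def field_simps)
  qed
qed

text \<open>In the logarithm of \<open>le\<close> divided by \<open>2 * n\<close>, the constant, the
  linear factor and the shift by \<open>c\<close> vanish in the limit. The radius
  \<open>2 * n\<close> gives \<open>B\<close> its full rate, while \<open>Z\<close> contributes half
  of its rate.\<close>

lemma exponential_growth_le:
  assumes Y: "\<And>n. finite (Y n)" "\<And>n. Y n \<noteq> {}" and B: "\<And>n. finite (B n)" "\<And>n. B n \<noteq> {}"
    and Z: "\<And>n. Z n \<noteq> {}"
    and le: "\<And>n. finite (Z n) \<Longrightarrow> (card (Y n))\<^sup>2 \<le> card (Z n) * (A * Suc (2 * n + c) * card (B (2 * n + c)))"
  shows "exponential_growth Y \<le> exponential_growth B + exponential_growth Z / 2"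
proof -
  have real_bound: "exponential_growth Y \<le> ereal (\<alpha> + \<beta> / 2)"
    if \<alpha>: "exponential_growth B < ereal \<alpha>" and \<beta>: "exponential_growth Z < ereal \<beta>" for \<alpha> \<beta>
  proof -
    define u where "u n = (\<beta> * real n + ln (real A) + ln (2 * real n + real c + 1) + \<alpha> * (2 * real n + real c)) / (2 * real n)" for n
    have "filterlim (\<lambda>n. 2 * n + c) at_top sequentially"
      by (rule filterlim_subseq) (simp add: strict_mono_def)
    then have "\<forall>\<^sub>F n in sequentially. ln (real (card (B (2 * n + c)))) \<le> \<alpha> * real (2 * n + c)"
      using exponential_growth_less[OF \<alpha>] by (auto simp: filterlim_iff eventually_conj_iff)
    then have "\<forall>\<^sub>F n in sequentially. ereal (1 / real n) * log_card (Y n) \<le> ereal (u n)"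
      using exponential_growth_less[OF \<beta>] eventually_gt_at_top[of 0]
    proof eventually_elim
      case (elim n)
      have pos: "card (Y n) > 0" "card (B (2 * n + c)) > 0" "card (Z n) > 0"
        using Y B Z elim by (simp_all add: card_gt_0_iff)
      have "A > 0" using le[of n] elim pos by (cases "A = 0") auto
      have "(real (card (Y n)))\<^sup>2 \<le> real (card (Z n)) * (real A * (2 * real n + real c + 1) * real (card (B (2 * n + c))))"
        using le[of n, THEN of_nat_mono[where 'a = real]] elim by (simp add: algebra_simps)
      then have "ln ((real (card (Y n)))\<^sup>2) \<le> ln (real (card (Z n)) * (real A * (2 * real n + real c + 1) * real (card (B (2 * n + c)))))"
        using pos \<open>A > 0\<close> by (subst ln_le_cancel_iff) auto
      then have "2 * ln (real (card (Y n))) \<le> ln (real (card (Z n))) + (ln (real A) + ln (2 * real n + real c + 1) + ln (real (card (B (2 * n + c)))))"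
        using pos \<open>A > 0\<close> by (simp add: ln_mult ln_realpow add_pos_nonneg)
      also have "\<dots> \<le> \<beta> * real n + (ln (real A) + ln (2 * real n + real c + 1) + \<alpha> * (2 * real n + real c))"
        using elim by (intro add_mono) simp_all
      finally have "ln (real (card (Y n))) / real n \<le> u n"
        using elim unfolding u_def by (simp add: field_simps)
      then show ?case using Y(1) by (simp add: log_card_def)
    qed
    then have "exponential_growth Y \<le> limsup (\<lambda>n. ereal (u n))"
      unfolding exponential_growth_def by (rule Limsup_mono)
    also have "u \<longlonglongrightarrow> \<alpha> + \<beta> / 2" unfolding u_def by real_asymp
    then have "limsup (\<lambda>n. ereal (u n)) = ereal (\<alpha> + \<beta> / 2)"
      by (intro lim_imp_Limsup) auto
    finally show ?thesis .
  qed
  have nonneg: "exponential_growth B \<ge> 0" "exponential_growth Z \<ge> 0"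
    using exponential_growth_nonneg B(2) Z by blast+
  show ?thesis
  proof (cases "exponential_growth B = \<infinity> \<or> exponential_growth Z = \<infinity>")
    case True
    then show ?thesis using nonneg by auto
  next
    case False
    then obtain b z where bz: "exponential_growth B = ereal b" "exponential_growth Z = ereal z"
      using nonneg by (cases "exponential_growth B"; cases "exponential_growth Z") auto
    \<comment> \<open>Both rates are finite here; raising \<open>b\<close> by \<open>e / 2\<close>
      and \<open>z\<close> by \<open>e\<close> gives the strict inequalities of
      \<open>real_bound\<close>.\<close>
    have "exponential_growth Y \<le> ereal (b + z / 2) + ereal e" if "e > 0" for e :: real
    proof -
      have "b + e / 2 + (z + e) / 2 = b + z / 2 + e" by (simp add: field_simps)
      moreover have "exponential_growth Y \<le> ereal (b + e / 2 + (z + e) / 2)"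
        by (rule real_bound) (use that in \<open>simp_all add: bz\<close>)
      ultimately show ?thesis by (simp only: plus_ereal.simps)
    qed
    then have "exponential_growth Y \<le> ereal (b + z / 2)" by (rule ereal_le_epsilon2)
    then show ?thesis by (simp add: bz)
  qed
qed

text \<open>Cauchy--Schwarz is applied to the map from orbit points of \<open>\<Gamma>\<close> to
  their \<open>H\<close>-orbits, and the pairs are counted by \<open>count_pairs\<close>.\<close>

lemma growth_rate_le:
  fixes z :: "'a::metric_space"
  assumes geodesic: "geodesic_space TYPE('a)"
    and \<Gamma>: "subgroup \<Gamma> isometry_group" "\<And>r. finite {g \<in> \<Gamma>. dist z (g z) \<le> r}"
    and H: "subgroup H isometry_group" "\<And>r. finite {h \<in> H. dist z (h z) \<le> r}"
    and Q: "finite Q" "Q \<subseteq> carrier isometry_group"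
    and turn: "\<And>x w. x \<in> \<Gamma> \<Longrightarrow> \<exists>q\<in>Q. x \<circ> q \<circ> inv_into UNIV x \<in> H \<and>
       passes z (x (q (inv_into UNIV x w))) (x z) r"
  shows "growth_rate \<Gamma> z \<le> growth_rate H z + quotient_growth_rate \<Gamma> H z / 2"
proof -
  interpret \<Gamma>: isometry_subgroup \<Gamma> by (rule isometry_subgroup.intro[OF \<Gamma>(1)])
  interpret H: isometry_subgroup H by (rule isometry_subgroup.intro[OF H(1)])
  define c where "c = nat \<lceil>Max (insert 0 ((\<lambda>q. dist z (q z)) ` Q))\<rceil>"
  have c: "dist z (q z) \<le> real c" if "q \<in> Q" for q
  proof -
    have "dist z (q z) \<le> Max (insert 0 ((\<lambda>q. dist z (q z)) ` Q))" using Q(1) that by (intro Max_ge) auto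
    then show ?thesis unfolding c_def by linarith
  qed
  let ?Y = "\<lambda>n::nat. {g z | g. g \<in> \<Gamma> \<and> dist z (g z) \<le> real n}"
    and ?B = "\<lambda>n::nat. {h z | h. h \<in> H \<and> dist z (h z) \<le> real n}"
    and ?Z = "\<lambda>n::nat. {orbit_of H (g z) | g. g \<in> \<Gamma> \<and> quotient_dist H z (g z) \<le> real n}"
  let ?A = "card {h \<in> H. dist z (h z) \<le> 0} * card Q * card {g \<in> \<Gamma>. dist z (g z) \<le> 2 * (r + 1)}"
  have Y_eq: "?Y n = (\<lambda>g. g z) ` {g \<in> \<Gamma>. dist z (g z) \<le> real n}" for n by blast
  have B_eq: "?B n = (\<lambda>g. g z) ` {g \<in> H. dist z (g z) \<le> real n}" for n by blast
  have finY: "finite (?Y n)" for n unfolding Y_eq using \<Gamma>(2) by simp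
  have finB: "finite (?B n)" for n unfolding B_eq using H(2) by simp
  have zY: "z \<in> ?Y n" for n using \<Gamma>.id_mem by (intro CollectI exI[of _ id]) simp
  have zB: "z \<in> ?B n" for n using H.id_mem by (intro CollectI exI[of _ id]) simp
  have qd: "quotient_dist H z y \<le> dist z y" for y
  proof -
    have "bdd_below ((\<lambda>h. dist z (h y)) ` H)" by (rule bdd_belowI[of _ 0]) auto
    then have "quotient_dist H z y \<le> dist z (id y)"
      unfolding quotient_dist_def by (rule cINF_lower[OF _ H.id_mem])
    then show ?thesis by simp
  qed
  have sub: "orbit_of H ` ?Y n \<subseteq> ?Z n" for n
    using qd order_trans by blast
  have "exponential_growth ?Y \<le> exponential_growth ?B + exponential_growth ?Z / 2"
  proof (rule exponential_growth_le)
    fix n assume fin: "finite (?Z n)"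
    have "(card (?Y n))\<^sup>2 \<le> card (orbit_of H ` ?Y n) *
        card {(y, y'). y \<in> ?Y n \<and> y' \<in> ?Y n \<and> orbit_of H y = orbit_of H y'}"
      by (rule card_squared_le_card_image_times_pairs[OF finY])
    also have "\<dots> \<le> card (?Z n) * (card {h \<in> H. dist z (h z) \<le> real (2 * n + c)} *
      (card Q * (Suc (2 * n + c) * card {g \<in> \<Gamma>. dist z (g z) \<le> 2 * (r + 1)})))"
      by (intro mult_le_mono card_mono[OF fin sub] 
          count_pairs[where Q = Q and c = c and r = r, OF geodesic \<Gamma> H Q])
        (use c turn in blast)+
    also have "\<dots> \<le> card (?Z n) * ((card (?B (2 * n + c)) * card {h \<in> H. dist z (h z) \<le> 0}) *
      (card Q * (Suc (2 * n + c) * card {g \<in> \<Gamma>. dist z (g z) \<le> 2 * (r + 1)})))"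
      by (intro mult_le_mono order_refl H.card_ball_le_card_orbit[OF H(2)])
    also have "\<dots> = card (?Z n) * (?A * Suc (2 * n + c) * card (?B (2 * n + c)))"
      by (simp only: mult_ac)
    finally show "(card (?Y n))\<^sup>2 \<le> card (?Z n) * (?A * Suc (2 * n + c) * card (?B (2 * n + c)))" .
  next
    show "?Z n \<noteq> {}" for n using sub[of n] zY[of n] by blast
    show "?Y n \<noteq> {}" for n using zY[of n] by blast
    show "?B n \<noteq> {}" for n using zB[of n] by blast
  qed (rule finY finB)+
  then show ?thesis unfolding growth_rate_def quotient_growth_rate_def .
qed

section \<open>From a contracting isometry to the growth inequality\<close>

lemma contracting_mono: "contracting C Z \<Longrightarrow> C \<le> C' \<Longrightarrow> contracting C' Z"
  unfolding contracting_def by (meson order_trans)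

text \<open>The maximum with 1 makes the contraction constant positive, and \<open>k + c\<close>
  absorbs the additive constant because distinct indices differ by at least 1.\<close>

lemma contracting_isometry_action:
  assumes proper: "proper_space TYPE('a::metric_space)" and geodesic: "geodesic_space TYPE('a)"
    and \<Gamma>: "discrete_subgroup \<Gamma>" and f: "f \<in> \<Gamma>" "contracting_isometry (x :: 'a) f"
  shows "\<exists>C k c L. contracting_action (\<lambda>n::int. (f [^]\<^bsub>isometry_group\<^esub> n) x) C k c L \<Gamma>
    (\<lambda>n::int. f [^]\<^bsub>isometry_group\<^esub> n)"
proof -
  interpret G: group "isometry_group :: ('a \<Rightarrow> 'a) monoid" by (rule group_isometry_group)
  have \<Gamma>s: "subgroup \<Gamma> isometry_group" using \<Gamma> by (simp add: discrete_subgroup_def)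
  interpret isometry_subgroup \<Gamma> by (rule isometry_subgroup.intro[OF \<Gamma>s])
  let ?F = "\<lambda>n::int. f [^]\<^bsub>isometry_group\<^esub> n"
  let ?a = "\<lambda>n. ?F n x"
  obtain k c where kc: "k \<ge> 1" "c \<ge> 0"
    and qi: "\<forall>s\<in>\<int>. \<forall>t\<in>\<int>. \<bar>s - t\<bar> / k - c \<le> dist (?a \<lfloor>s\<rfloor>) (?a \<lfloor>t\<rfloor>) \<and> dist (?a \<lfloor>s\<rfloor>) (?a \<lfloor>t\<rfloor>) \<le> k * \<bar>s - t\<bar> + c"
    using f(2) unfolding contracting_isometry_def quasi_isometric_embedding_on_def by blast
  obtain C where C: "contracting C (range ?a)"
    using f(2) unfolding contracting_isometry_def by blast
  have qi': "\<bar>real_of_int i - real_of_int j\<bar> / k - c \<le> dist (?a i) (?a j)"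
    "dist (?a i) (?a j) \<le> k * \<bar>real_of_int i - real_of_int j\<bar> + c" for i j
    using qi[rule_format, of "real_of_int i" "real_of_int j"] by simp_all
  have F0: "?F 0 = id" by (simp add: isometry_group_simps)
  have "contracting_action ?a (max C 1) k (k * c) (k + c) \<Gamma> ?F"
  proof
    show "proper_space TYPE('a)" "geodesic_space TYPE('a)" by fact+
    show "contracting (max C 1) (range ?a)" using contracting_mono[OF C] by simp
    show "max C 1 > 0" "k > 0" "k * c \<ge> 0" "k + c \<ge> 0" using kc by auto
    fix i j :: int
    show "\<bar>real_of_int i - real_of_int j\<bar> \<le> k * dist (?a i) (?a j) + k * c"
      using qi'(1)[of i j] kc by (simp add: field_simps)
    show "dist (?a i) (?a j) \<le> (k + c) * \<bar>real_of_int i - real_of_int j\<bar>"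
    proof (cases "i = j")
      case False
      then have "1 \<le> \<bar>i - j\<bar>" by simp
      then have "1 \<le> \<bar>real_of_int i - real_of_int j\<bar>" by linarith
      then have "c * 1 \<le> c * \<bar>real_of_int i - real_of_int j\<bar>" using kc by (intro mult_left_mono)
      then show ?thesis using qi'(2)[of i j] by (simp add: distrib_right)
    qed simp
    show "?F i \<in> \<Gamma>" by (rule G.subgroup_int_pow_closed[OF \<Gamma>s f(1)])
    show "?F (i + j) = ?F i \<circ> ?F j"
      using G.int_pow_mult[OF isometry[OF f(1)]] by (simp add: isometry_group_simps)
    show "?a i = ?F i (?a 0)" by (simp only: F0 id_apply)
    show "?F 0 = id" by (rule F0)
    show "finite {g \<in> \<Gamma>. dist (?a 0) (g (?a 0)) \<le> r}" for r
      unfolding F0 id_apply by (rule discrete_subgroup_finite_balls[OF proper \<Gamma>])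
  qed
  then show ?thesis by blast
qed

theorem theorem1p15:
  fixes x\<^sub>0 :: "'a::metric_space"
    and \<Gamma> H P :: "('a \<Rightarrow> 'a) set"
    and \<iota> :: "'a \<Rightarrow> 'b::metric_space"
    and act :: "('a \<Rightarrow> 'a) \<Rightarrow> 'b \<Rightarrow> 'b"
    and R :: "('b \<times> 'b) set"
  assumes "proper_space TYPE('a)"
    and "geodesic_space TYPE('a)"
    and "convergence_boundary \<iota> act R \<Gamma>"
    and "discrete_subgroup \<Gamma>"
    and "\<not> elementary_group (isometry_group\<lparr>carrier := \<Gamma>\<rparr>)"
    and "divergence_type \<Gamma> x\<^sub>0"
    and "\<exists>f\<in>\<Gamma>. contracting_isometry x\<^sub>0 f \<and> non_pinched_isometry \<iota> R x\<^sub>0 f"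
    and "discrete_subgroup H"
    and "confined \<Gamma> H P"
    and "P \<inter> elliptic_radical \<iota> act R \<Gamma> x\<^sub>0 \<subseteq> {\<one>\<^bsub>isometry_group\<^esub>}"
  shows "growth_rate H x\<^sub>0 + quotient_growth_rate \<Gamma> H x\<^sub>0 / 2 \<ge> growth_rate \<Gamma> x\<^sub>0"
proof -
  interpret convergence_boundary \<iota> act R \<Gamma> by fact
  obtain f where f: "f \<in> \<Gamma>" "contracting_isometry x\<^sub>0 f" using assms(7) by blast
  define F where "F n = f [^]\<^bsub>isometry_group\<^esub> n" for n :: int
  obtain C k c L where "contracting_action (\<lambda>n. F n x\<^sub>0) C k c L \<Gamma> F"
    using contracting_isometry_action[OF assms(1,2,4) f] unfolding F_def by blast
  then interpret nonelementary_action "\<lambda>n. F n x\<^sub>0" C k c L \<Gamma> F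
    using assms(5) by (intro nonelementary_action.intro nonelementary_action_axioms.intro)
  have F0: "F 0 x\<^sub>0 = x\<^sub>0" by (simp add: F_zero)
  have H: "subgroup H isometry_group" using assms(8) by (simp add: discrete_subgroup_def)
  have finH: "finite {h \<in> H. dist x\<^sub>0 (h x\<^sub>0) \<le> r}" for r
    by (rule discrete_subgroup_finite_balls[OF assms(1,8)])
  \<comment> \<open>Bounded displacement on the whole orbit would put \<open>p\<close> into the
    elliptic radical, which meets \<open>P\<close> trivially.\<close>
  have "\<exists>g\<in>\<Gamma>. dist (p (g x\<^sub>0)) (g x\<^sub>0) > D" if p: "p \<in> P - {id}" for p D
  proof (rule ccontr)
    assume "\<not> ?thesis"
    then have D: "dist (p (g x\<^sub>0)) (g x\<^sub>0) \<le> D" if "g \<in> \<Gamma>" for g using that not_le by blast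
    have "p \<in> carrier isometry_group" using p assms(9) unfolding confined_def by blast
    then have "p \<in> elliptic_radical \<iota> act R \<Gamma> x\<^sub>0"
      using D by (rule bounded_displacement_elliptic_radical[OF assms(1,2)])
    then show False using p assms(10) by (auto simp: isometry_group_simps)
  qed
  then obtain Q r where Q: "finite Q" "Q \<subseteq> carrier isometry_group"
    and turn: "\<forall>x\<in>\<Gamma>. \<forall>z. \<exists>q\<in>Q. x \<circ> q \<circ> inv_into UNIV x \<in> H \<and>
       passes x\<^sub>0 (x (q (inv_into UNIV x z))) (x x\<^sub>0) r"
    using confined_turn[OF H _ assms(9), unfolded F0, OF finH] by metis
  show ?thesis
    by (rule growth_rate_le[where Q = Q and r = r])
      (use assms(2) is_subgroup finite_balls[unfolded F0] H finH Q turn in blast)+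
qed

end
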